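(* Let $\mathbb Z$ be given a $\Bbbk$-module structure, where $\Bbbk=\mathbb Z[X,Y,Z^{\pm1}]/(X^2=Y^2=1)$, and let $L$ be a link. Then the homology $\mathcal H(L;\mathbb Z)$ is isomorphic to the even Khovanov homology of $L$ if $XY$ acts on $\mathbb Z$ as the identity, and to the odd Khovanov homology of $L$ otherwise.
   Context: **Even and odd homology.** $\mathcal H(L;M)$ denotes the homology of $\mathcal FKh(D)\otimes_\Bbbk M$, for $D$ a diagram of $L$. The even Khovanov homology is $\mathcal H(L;\mathbb Z_{ev})$, where $X,Y,Z$ act on $\mathbb Z_{ev}=\mathbb Z$ as the identity; the odd Khovanov homology is $\mathcal H(L;\mathbb Z_{odd})$, where $X,Z$ act on $\mathbb Z_{odd}=\mathbb Z$ as the identity and $Y$ as $-1$ (it is known that these agree with Khovanov's and Ozsváth–Rasmussen–Szabó's theories). Put $\lambda(a,b,a',b')=X^{aa'}Y^{bb'}Z^{ab'-a'b}$. **Chronological cobordisms.** A chronological cobordism is a 2-dimensional cobordism $W$ with a Morse function $h:W\to[0,1]$, $h^{-1}(0)$ the input, $h^{-1}(1)$ the output, critical points at distinct levels, and an orientation of the unstable space at each critical point (drawn as an arrow), up to equivalence. Objects are finite ordered families of circles. All are generated, under composition and disjoint union with vertical tubes, by: the merge $\mu:2\to1$ (arrow pointing from the second = right circle to the first = left circle), the split $\Delta:1\to2$ (arrow pointing to the back, i.e. the first output lies to the left of the arrow), the birth $\iota$, the positive death $\epsilon_+$, the negative death $\epsilon_-$, and the twist $P$. Reversing the arrow of $\mu$,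 $\Delta$ gives $\mu P$, $P\Delta$. $\deg W=(\#\text{births}-\#\text{merges},\#\text{deaths}-\#\text{splits})$. $\Bbbk\mathbf{ChCob}$ is the $\Bbbk$-linear category of these cobordisms modulo: $\mu P=X\mu$; $P\Delta=Y\Delta$; $\epsilon_-=Y\epsilon_+$; $\mu(\iota\sqcup\mathrm{id})=\mathrm{id}$; $(\mathrm{id}\sqcup\epsilon_+)\Delta=\mathrm{id}=(\epsilon_-\sqcup\mathrm{id})\Delta$; $\mu(\mu\sqcup\mathrm{id})=X\mu(\mathrm{id}\sqcup\mu)$; $(\Delta\sqcup\mathrm{id})\Delta=Y(\mathrm{id}\sqcup\Delta)\Delta$; $(\mathrm{id}\sqcup\mu)(\Delta\sqcup\mathrm{id})=Z\Delta\mu=(\mu\sqcup\mathrm{id})(\mathrm{id}\sqcup\Delta)$; $(\mathrm{id}\sqcup W)(W'\sqcup\mathrm{id})=\lambda(\deg W,\deg W')(W'\sqcup\mathrm{id})(\mathrm{id}\sqcup W)$. **The complex $Kh(D)$.** Let $D$ have $n$ enumerated crossings, each decorated by an arrow joining the two arcs of its type 0 resolution. At a crossing whose overstrand runs NW–SE, type 0 joins NW–NE and SW–SE, type 1 joins NW–SW and NE–SE. For $\xi\in\{0,1\}^n$, $D_\xi$ is the resolved family of circles (ordered arbitrarily). An edge $\zeta:\xi\to\xi'$ of the cube carries the saddle cobordism $D_\zeta$ oriented by the arrow. It is known that there is a cubical 2-cocycle $\psi$ with values in $\Bbbk^*$ with $W_{1\star}W_{\star0}=\psi(S)W_{\star1}W_{0\star}$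 on each face $S$; fix it. (It is determined by the chronological relations except on faces where a circle is split and then merged back, where both $1$ and $XY$ satisfy the identity and the value is fixed by a local rule: the circle carries two arrows with alternating endpoints, $a$ inside and $b$ outside, and $\psi(S)$ is $1$ or $XY$ according to whether the first endpoint of $b$ met counterclockwise from the tail of $a$ is a tail or a head.) A sign assignment is a $\Bbbk^*$-valued 1-cochain $\epsilon$ with $\epsilon_{1\star}\epsilon_{\star0}\psi(S)=-\epsilon_{\star1}\epsilon_{0\star}$ on each face. $Kh(D)$ is the complex in the additive closure of $\Bbbk\mathbf{ChCob}$ with $Kh(D)^i=\bigoplus_{|\xi|=i+n_-}D_\xi$ ($n_-$ = number of negative crossings), differential $\sum_\zeta\epsilon(\zeta)D_\zeta$. **The functor $\mathcal F$.** $\mathcal F$ sends $k$ circles to $A^{\otimes k}$, $A=\Bbbk v_+\oplus\Bbbk v_-$, $\deg v_+=(1,0)$, $\deg v_-=(0,-1)$; it sends $(W\sqcup\mathrm{id})(\mathrm{id}\sqcup W')$ to $\mathcal F(W)\otimes\mathcal F(W')$, where $(f\otimes g)(m\otimes n)=\lambda(\deg g,\deg m)f(m)\otimes g(n)$, the twist to $m\otimes n\mapsto\lambda(\deg m,\deg n)n\otimes m$, and: $\mu$: $v_+v_+\mapsto v_+$, $v_+v_-\mapsto v_-$, $v_-v_+\mapsto XZv_-$, $v_-v_-\mapsto0$; $\Delta$: $v_+\mapsto v_-\otimes v_++YZv_+\otimes v_-$, $v_-\mapsto v_-\otimes v_-$; $\iota$: $1\mapsto v_+$; $\epsilon_-$: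 $v_+\mapsto0$, $v_-\mapsto1$. *)

theory Defs
  imports
    Complex_Main
    "HOL-Algebra.Free_Abelian_Groups"
    "HOL-Algebra.Generated_Groups"
    "HOL-Library.Product_Plus"
    "HOL-Library.Z2"
begin

section \<open>The ground ring\<close>

text \<open>The ring \<open>\<int>[X, Y, Z\<^sup>\<plusminus>\<^sup>1] / (X\<^sup>2 = Y\<^sup>2 = 1)\<close> is the group ring of
  \<open>\<int>/2 \<times> \<int>/2 \<times> \<int>\<close>; the triple \<open>(i, j, l)\<close> stands for the monomial \<open>X\<^sup>i Y\<^sup>j Z\<^sup>l\<close>.
  Multiplication of finitely supported functions is convolution.\<close>

type_synonym kring = "(bit \<times> bit \<times> int) \<Rightarrow>\<^sub>0 int"

definition KX :: kring where "KX = Poly_Mapping.single (1, 0, 0) 1"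
definition KY :: kring where "KY = Poly_Mapping.single (0, 1, 0) 1"
definition KZ :: kring where "KZ = Poly_Mapping.single (0, 0, 1) 1"

text \<open>\<open>\<lambda>(a, b, a', b') = X\<^bsup>aa'\<^esup> Y\<^bsup>bb'\<^esup> Z\<^bsup>ab' - a'b\<^esup>\<close>\<close>

definition lam :: "int \<times> int \<Rightarrow> int \<times> int \<Rightarrow> kring" where
  "lam p q = Poly_Mapping.single
     (of_int (fst p * fst q), of_int (snd p * snd q), fst p * snd q - fst q * snd p) 1"

lemma kring_relations:
  "KX * KX = 1" "KY * KY = 1" "KZ * Poly_Mapping.single (0, 0, -1) 1 = 1"
  by (simp_all add: KX_def KY_def KZ_def Poly_Mapping.mult_single flip: zero_prod_def)

text \<open>Free modules over the ground ring are finitely supported functions on a basis.\<close>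

definition kscale :: "kring \<Rightarrow> ('a \<Rightarrow>\<^sub>0 kring) \<Rightarrow> ('a \<Rightarrow>\<^sub>0 kring)" where
  "kscale r c = Poly_Mapping.map (\<lambda>s. r * s) c"

definition lin_extend :: "('a \<Rightarrow> ('b \<Rightarrow>\<^sub>0 kring)) \<Rightarrow> ('a \<Rightarrow>\<^sub>0 kring) \<Rightarrow> ('b \<Rightarrow>\<^sub>0 kring)" where
  "lin_extend f c = (\<Sum>x\<in>Poly_Mapping.keys c. kscale (Poly_Mapping.lookup c x) (f x))"

lemma lookup_kscale: "Poly_Mapping.lookup (kscale r c) x = r * Poly_Mapping.lookup c x"
  by (simp add: kscale_def Poly_Mapping.map.rep_eq when_def)

lemma module_kscale: "module kscale"
  by unfold_locales (auto intro!: poly_mapping_eqI simp: lookup_kscale lookup_add algebra_simps)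

text \<open>The modules \<open>\<int>\<^sub>e\<^sub>v\<close> and \<open>\<int>\<^sub>o\<^sub>d\<^sub>d\<close>.\<close>

definition even_act :: "kring \<Rightarrow> int \<Rightarrow> int" where
  "even_act r m = (\<Sum>g\<in>Poly_Mapping.keys r. Poly_Mapping.lookup r g) * m"

definition odd_act :: "kring \<Rightarrow> int \<Rightarrow> int" where
  "odd_act r m =
     (\<Sum>(i, j, l)\<in>Poly_Mapping.keys r. Poly_Mapping.lookup r (i, j, l) * (if j = 1 then -1 else 1)) * m"

lemma even_act_simps: "even_act KX m = m" "even_act KY m = m" "even_act KZ m = m"
  by (simp_all add: even_act_def KX_def KY_def KZ_def)

lemma odd_act_simps: "odd_act KX m = m" "odd_act KY m = - m" "odd_act KZ m = m"
  by (simp_all add: odd_act_def KX_def KY_def KZ_def)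

section \<open>Chronological cobordisms\<close>

text \<open>\<open>Merge\<close>: the arrow points from the second (right) input to the first (left) input.
  \<open>Split\<close>: the first output lies to the left of the arrow.\<close>

datatype cgen = Merge | Split | Birth | DeathP | DeathN | Twist

fun gsrc :: "cgen \<Rightarrow> nat" where
  "gsrc Merge = 2" | "gsrc Split = 1" | "gsrc Birth = 0"
| "gsrc DeathP = 1" | "gsrc DeathN = 1" | "gsrc Twist = 2"

fun gtgt :: "cgen \<Rightarrow> nat" where
  "gtgt Merge = 1" | "gtgt Split = 2" | "gtgt Birth = 1"
| "gtgt DeathP = 0" | "gtgt DeathN = 0" | "gtgt Twist = 2"

fun gdeg :: "cgen \<Rightarrow> int \<times> int" where
  "gdeg Merge = (-1, 0)" | "gdeg Split = (0, -1)" | "gdeg Birth = (1, 0)"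
| "gdeg DeathP = (0, 1)" | "gdeg DeathN = (0, 1)" | "gdeg Twist = (0, 0)"

text \<open>A layer \<open>(a, g, b)\<close> is the generator \<open>g\<close> with \<open>a\<close> vertical tubes on its left and \<open>b\<close> on its
  right.  A word lists its layers from the input upwards, so that \<open>V @ W\<close> is the composition
  \<open>W \<circ> V\<close> and the empty word is an identity.\<close>

type_synonym layer = "nat \<times> cgen \<times> nat"
type_synonym cob = "layer list"

fun cob_typed :: "nat \<Rightarrow> cob \<Rightarrow> nat \<Rightarrow> bool" where
  "cob_typed m [] n = (m = n)"
| "cob_typed m ((a, g, b) # W) n = (m = a + gsrc g + b \<and> cob_typed (a + gtgt g + b) W n)"

definition pad :: "nat \<Rightarrow> cob \<Rightarrow> nat \<Rightarrow> cob" where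
  "pad a W b = map (\<lambda>(a', g, b'). (a + a', g, b' + b)) W"

text \<open>\<open>strand_left s\<close> carries the last of \<open>s + 1\<close> strands to the front.\<close>

definition strand_left :: "nat \<Rightarrow> cob" where
  "strand_left s = map (\<lambda>j. (j, Twist, s - Suc j)) (rev [0..<s])"

text \<open>\<open>ch_rel W u W'\<close> is the relation \<open>W = u W'\<close>.  The last two rules are the equivalences of
  chronological cobordisms saying that the twist is a symmetry (naturality with respect to \<open>Twist\<close>
  is the braid relation).  In \<open>interchange\<close>, \<open>k\<close> is the number of tubes between the two
  generators.\<close>

inductive ch_rel :: "cob \<Rightarrow> kring \<Rightarrow> cob \<Rightarrow> bool" where
  merge_comm: "ch_rel [(0, Twist, 0), (0, Merge, 0)] KX [(0, Merge, 0)]"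
| split_comm: "ch_rel [(0, Split, 0), (0, Twist, 0)] KY [(0, Split, 0)]"
| death: "ch_rel [(0, DeathN, 0)] KY [(0, DeathP, 0)]"
| unit: "ch_rel [(0, Birth, 1), (0, Merge, 0)] 1 []"
| counit_right: "ch_rel [(0, Split, 0), (1, DeathP, 0)] 1 []"
| counit_left: "ch_rel [(0, Split, 0), (0, DeathN, 1)] 1 []"
| assoc: "ch_rel [(0, Merge, 1), (0, Merge, 0)] KX [(1, Merge, 0), (0, Merge, 0)]"
| coassoc: "ch_rel [(0, Split, 0), (0, Split, 1)] KY [(0, Split, 0), (1, Split, 0)]"
| frobenius_left: "ch_rel [(0, Split, 1), (1, Merge, 0)] KZ [(0, Merge, 0), (0, Split, 0)]"
| frobenius_right: "ch_rel [(1, Split, 0), (0, Merge, 1)] KZ [(0, Merge, 0), (0, Split, 0)]"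
| interchange: "ch_rel [(0, g', k + gsrc g), (gtgt g' + k, g, 0)] (lam (gdeg g) (gdeg g'))
    [(gsrc g' + k, g, 0), (0, g', k + gtgt g)]"
| twist_twist: "ch_rel [(0, Twist, 0), (0, Twist, 0)] 1 []"
| twist_natural: "ch_rel ((0, g, 1) # strand_left (gtgt g)) 1 (strand_left (gsrc g) @ [(1, g, 0)])"

text \<open>The module of morphisms \<open>m \<rightarrow> n\<close> of \<open>kChCob\<close> is the free module on the words \<open>m \<rightarrow> n\<close> modulo
  the span of the following elements.\<close>

definition ch_relators :: "nat \<Rightarrow> nat \<Rightarrow> (cob \<Rightarrow>\<^sub>0 kring) set" where
  "ch_relators m n =
     {Poly_Mapping.single (U @ pad a W b @ V) 1 - Poly_Mapping.single (U @ pad a W' b @ V) u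
      | U V a b W W' u. ch_rel W u W' \<and> cob_typed m (U @ pad a W b @ V) n
          \<and> cob_typed m (U @ pad a W' b @ V) n}"

definition ch_eq :: "nat \<Rightarrow> nat \<Rightarrow> (cob \<Rightarrow>\<^sub>0 kring) \<Rightarrow> (cob \<Rightarrow>\<^sub>0 kring) \<Rightarrow> bool" where
  "ch_eq m n f g \<longleftrightarrow> f - g \<in> module.span kscale (ch_relators m n)"

text \<open>A word of twists realising the permutation that rearranges the list \<open>xs\<close> of circles into the
  list \<open>ys\<close>, with \<open>a\<close> further circles on the left.\<close>

fun reorder :: "nat \<Rightarrow> 'c list \<Rightarrow> 'c list \<Rightarrow> cob" where
  "reorder a xs [] = []"
| "reorder a xs (y # ys) =
     pad a (strand_left (length (takeWhile (\<lambda>x. x \<noteq> y) xs)))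
       (length (tl (dropWhile (\<lambda>x. x \<noteq> y) xs)))
     @ reorder (Suc a) (remove1 y xs) ys"

section \<open>The functor\<close>

datatype vgen = Vplus | Vminus

fun vdeg :: "vgen \<Rightarrow> int \<times> int" where
  "vdeg Vplus = (1, 0)" | "vdeg Vminus = (0, -1)"

text \<open>The \<open>k\<close>-th tensor power of \<open>A = k v\<^sub>+ \<oplus> k v\<^sub>-\<close> is free on the words of length \<open>k\<close>.\<close>

type_synonym word = "vgen list"

definition wdeg :: "word \<Rightarrow> int \<times> int" where
  "wdeg w = sum_list (map vdeg w)"

fun F_gen :: "cgen \<Rightarrow> word \<Rightarrow> (word \<Rightarrow>\<^sub>0 kring)" where
  "F_gen Merge [Vplus, Vplus] = Poly_Mapping.single [Vplus] 1"
| "F_gen Merge [Vplus, Vminus] = Poly_Mapping.single [Vminus] 1"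
| "F_gen Merge [Vminus, Vplus] = Poly_Mapping.single [Vminus] (KX * KZ)"
| "F_gen Merge [Vminus, Vminus] = 0"
| "F_gen Split [Vplus] = Poly_Mapping.single [Vminus, Vplus] 1
     + Poly_Mapping.single [Vplus, Vminus] (KY * KZ)"
| "F_gen Split [Vminus] = Poly_Mapping.single [Vminus, Vminus] 1"
| "F_gen Birth [] = Poly_Mapping.single [Vplus] 1"
| "F_gen DeathN [Vplus] = 0"
| "F_gen DeathN [Vminus] = Poly_Mapping.single [] 1"
| "F_gen DeathP [Vplus] = 0"
| "F_gen DeathP [Vminus] = Poly_Mapping.single [] KY"
| "F_gen Twist [u, v] = Poly_Mapping.single [v, u] (lam (vdeg u) (vdeg v))"
| "F_gen _ _ = 0"

text \<open>A layer is sent to \<open>id \<otimes> F g \<otimes> id\<close>; by \<open>(f \<otimes> g)(m \<otimes> n) = \<lambda>(deg g, deg m) f(m) \<otimes> g(n)\<close> moving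
  \<open>F g\<close> past the tensor factors on its left costs \<open>\<lambda>\<close>.\<close>

fun F_layer :: "layer \<Rightarrow> word \<Rightarrow> (word \<Rightarrow>\<^sub>0 kring)" where
  "F_layer (a, g, b) w = kscale (lam (gdeg g) (wdeg (take a w)))
     (lin_extend (\<lambda>u. Poly_Mapping.single (take a w @ u @ drop (a + gsrc g) w) 1)
       (F_gen g (take (gsrc g) (drop a w))))"

fun F_cob :: "cob \<Rightarrow> word \<Rightarrow> (word \<Rightarrow>\<^sub>0 kring)" where
  "F_cob [] w = Poly_Mapping.single w 1"
| "F_cob (l # W) w = lin_extend (F_cob W) (F_layer l w)"

definition F_mor :: "(cob \<Rightarrow>\<^sub>0 kring) \<Rightarrow> word \<Rightarrow> (word \<Rightarrow>\<^sub>0 kring)" where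
  "F_mor f w = lin_extend (\<lambda>W. F_cob W w) f"

section \<open>Link diagrams\<close>

text \<open>A dart \<open>(c, s)\<close> is a half-edge at the crossing \<open>c\<close>.  Each crossing is drawn with its
  overstrand running NW--SE, and the slots \<open>s = 0, 1, 2, 3\<close> are NE, NW, SW, SE (counterclockwise).
  A diagram consists of crossings \<open>0, \<dots>, ncross - 1\<close>, the involution \<open>glue\<close> joining darts into edges,
  the set of darts oriented away from their crossing, and a number of components without
  crossings (whose orientations and positions play no role below).  It is decorated by an arrow at
  each crossing, joining the two arcs of its type 0 resolution (\<open>arrow_down c\<close> means from NW--NE to
  SW--SE), and by an ordering of the circles of each resolution.  A vertex of the cube is the set
  of crossings resolved by type 1.\<close>

type_synonym dart = "nat \<times> nat"
type_synonym circle = "dart set + nat"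

record diagram =
  ncross :: nat
  glue :: "dart \<Rightarrow> dart"
  outgoing :: "dart set"
  free_circles :: nat
  arrow_down :: "nat \<Rightarrow> bool"
  circ_order :: "nat set \<Rightarrow> circle list"

definition darts :: "diagram \<Rightarrow> dart set" where
  "darts D = {..<ncross D} \<times> {..<4}"

definition gen_class :: "('d \<times> 'd) set \<Rightarrow> 'd \<Rightarrow> 'd set" where
  "gen_class R d = (R \<union> R\<inverse>)\<^sup>* `` {d}"

definition glue_rel :: "diagram \<Rightarrow> (dart \<times> dart) set" where
  "glue_rel D = {(d, glue D d) | d. d \<in> darts D}"

definition rot :: "dart \<Rightarrow> dart" where
  "rot d = (fst d, (snd d + 1) mod 4)"

definition map_components :: "diagram \<Rightarrow> dart set set" where
  "map_components D = gen_class (glue_rel D \<union> {(d, rot d) | d. d \<in> darts D}) ` darts D"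

definition map_faces :: "diagram \<Rightarrow> dart set set" where
  "map_faces D = gen_class {(d, rot (glue D d)) | d. d \<in> darts D} ` darts D"

text \<open>Type 0 joins NW--NE and SW--SE, type 1 joins NW--SW and NE--SE.\<close>

definition smooth :: "nat set \<Rightarrow> dart \<Rightarrow> dart" where
  "smooth \<xi> d = (fst d, if fst d \<in> \<xi> then [3, 2, 1, 0] ! snd d else [1, 0, 3, 2] ! snd d)"

definition circ :: "diagram \<Rightarrow> nat set \<Rightarrow> dart \<Rightarrow> circle" where
  "circ D \<xi> d = Inl (gen_class (glue_rel D \<union> {(e, smooth \<xi> e) | e. e \<in> darts D}) d)"

definition circles :: "diagram \<Rightarrow> nat set \<Rightarrow> circle set" where
  "circles D \<xi> = circ D \<xi> ` darts D \<union> Inr ` {..<free_circles D}"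

text \<open>The last but one condition says that the 4-valent combinatorial map is planar: by
  \<open>V - E + F = 2C\<close> with \<open>V = n\<close>, \<open>E = 2n\<close>, each of its components has genus 0.\<close>

definition link_diagram :: "diagram \<Rightarrow> bool" where
  "link_diagram D \<longleftrightarrow>
     (\<forall>d\<in>darts D. glue D d \<in> darts D \<and> glue D d \<noteq> d \<and> glue D (glue D d) = d) \<and>
     outgoing D \<subseteq> darts D \<and>
     (\<forall>d\<in>darts D. glue D d \<in> outgoing D \<longleftrightarrow> d \<notin> outgoing D) \<and>
     (\<forall>c<ncross D. ((c, 0) \<in> outgoing D \<longleftrightarrow> (c, 2) \<notin> outgoing D) \<and>
                    ((c, 1) \<in> outgoing D \<longleftrightarrow> (c, 3) \<notin> outgoing D)) \<and>
     card (map_faces D) = ncross D + 2 * card (map_components D) \<and>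
     (\<forall>\<xi>\<subseteq>{..<ncross D}. distinct (circ_order D \<xi>) \<and> set (circ_order D \<xi>) = circles D \<xi>)"

text \<open>A crossing is positive iff type 0 is its oriented resolution; with the overstrand running
  NW--SE it is negative iff NE and NW are both outgoing or both incoming.\<close>

definition n_neg :: "diagram \<Rightarrow> nat" where
  "n_neg D = card {c. c < ncross D \<and> ((c, 0) \<in> outgoing D \<longleftrightarrow> (c, 1) \<in> outgoing D)}"

section \<open>The cube of resolutions and the complex\<close>

text \<open>The saddle at the crossing \<open>c\<close>, from \<open>D\<^sub>\<xi>\<close> to \<open>D\<^bsub>insert c \<xi>\<^esub>\<close>.  The dart \<open>t\<close> lies on the
  arc at the tail of the arrow and \<open>h\<close> on the arc at its head.  After surgery the arc to the
  left of the arrow is NE--SE for a downward and NW--SW for an upward arrow, so it also contains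
  the dart \<open>t\<close>.\<close>

definition saddle :: "diagram \<Rightarrow> nat set \<Rightarrow> nat \<Rightarrow> cob" where
  "saddle D \<xi> c =
    (let \<xi>' = insert c \<xi>;
         t = (c, if arrow_down D c then 0 else 2);
         h = (c, if arrow_down D c then 2 else 0);
         rest = filter (\<lambda>C. C \<noteq> circ D \<xi> t \<and> C \<noteq> circ D \<xi> h) (circ_order D \<xi>)
     in if circ D \<xi> t \<noteq> circ D \<xi> h
        then reorder 0 (circ_order D \<xi>) (circ D \<xi> h # circ D \<xi> t # rest)
             @ [(0, Merge, length rest)]
             @ reorder 0 (circ D \<xi>' t # rest) (circ_order D \<xi>')
        else reorder 0 (circ_order D \<xi>) (circ D \<xi> t # rest)
             @ [(0, Split, length rest)]
             @ reorder 0 (circ D \<xi>' t # circ D \<xi>' h # rest) (circ_order D \<xi>'))"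

text \<open>The face at \<open>\<xi>\<close> in directions \<open>i\<close>, \<open>j\<close> splits a circle at \<open>i\<close> and merges the two pieces
  at \<open>j\<close>.\<close>

definition split_merge_face :: "diagram \<Rightarrow> nat set \<Rightarrow> nat \<Rightarrow> nat \<Rightarrow> bool" where
  "split_merge_face D \<xi> i j \<longleftrightarrow>
     circ D \<xi> (i, 0) = circ D \<xi> (i, 2) \<and> circ D \<xi> (j, 0) = circ D \<xi> (j, 2) \<and>
     circ D (insert i \<xi>) (j, 0) \<noteq> circ D (insert i \<xi>) (j, 2)"

text \<open>Walk along the circle of \<open>D\<^sub>\<xi>\<close> from the tail of the arrow at \<open>a\<close>, counterclockwise with respect
  to the side containing that arrow (the crossing \<open>a\<close> is on the left), until the crossing \<open>b\<close> is
  met.  The walk starts through the slot 1 or 3, and \<open>first_met\<close> is the dart by which it enters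
  \<open>b\<close>.  No inside or outside has to be distinguished: exchanging the roles of \<open>a\<close> and \<open>b\<close> also
  reverses the direction of the walk, and on an alternating pair of arrows the answer (tail or
  head) is the same.\<close>

definition walk :: "diagram \<Rightarrow> nat set \<Rightarrow> nat \<Rightarrow> nat \<Rightarrow> dart" where
  "walk D \<xi> a k =
     glue D (((\<lambda>d. smooth \<xi> (glue D d)) ^^ k) (a, if arrow_down D a then 1 else 3))"

definition first_met :: "diagram \<Rightarrow> nat set \<Rightarrow> nat \<Rightarrow> nat \<Rightarrow> dart" where
  "first_met D \<xi> a b = walk D \<xi> a (LEAST k. fst (walk D \<xi> a k) = b)"

definition tail_slots :: "diagram \<Rightarrow> nat \<Rightarrow> nat set" where
  "tail_slots D c = (if arrow_down D c then {0, 1} else {2, 3})"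

definition split_merge_value :: "diagram \<Rightarrow> nat set \<Rightarrow> nat \<Rightarrow> nat \<Rightarrow> kring" where
  "split_merge_value D \<xi> i j =
     (if snd (first_met D \<xi> i j) \<in> tail_slots D j then 1 else KX * KY)"

text \<open>Faces are given by their lowest vertex and their directions \<open>i < j\<close>; the coordinate \<open>i\<close> comes
  first, so \<open>W\<^bsub>1\<star>\<^esub>W\<^bsub>\<star>0\<^esub>\<close> is the saddle at \<open>i\<close> followed by the saddle at \<open>j\<close>.  Units are
  the divisors of 1.\<close>

definition cube_face :: "diagram \<Rightarrow> nat set \<Rightarrow> nat \<Rightarrow> nat \<Rightarrow> bool" where
  "cube_face D \<xi> i j \<longleftrightarrow> \<xi> \<subseteq> {..<ncross D} \<and> i \<notin> \<xi> \<and> j \<notin> \<xi> \<and> i < j \<and> j < ncross D"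

definition face_cocycle :: "diagram \<Rightarrow> (nat set \<Rightarrow> nat \<Rightarrow> nat \<Rightarrow> kring) \<Rightarrow> bool" where
  "face_cocycle D \<psi> \<longleftrightarrow>
     (\<forall>\<xi> i j. cube_face D \<xi> i j \<longrightarrow>
        \<psi> \<xi> i j dvd 1 \<and>
        ch_eq (length (circ_order D \<xi>)) (length (circ_order D (insert i (insert j \<xi>))))
          (Poly_Mapping.single (saddle D \<xi> i @ saddle D (insert i \<xi>) j) 1)
          (Poly_Mapping.single (saddle D \<xi> j @ saddle D (insert j \<xi>) i) (\<psi> \<xi> i j)) \<and>
        (split_merge_face D \<xi> i j \<longrightarrow> \<psi> \<xi> i j = split_merge_value D \<xi> i j)) \<and>
     (\<forall>\<xi> i j k. cube_face D \<xi> i j \<and> cube_face D \<xi> j k \<longrightarrow>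
        \<psi> (insert k \<xi>) i j * \<psi> \<xi> i k * \<psi> (insert i \<xi>) j k =
        \<psi> \<xi> i j * \<psi> (insert j \<xi>) i k * \<psi> \<xi> j k)"

text \<open>\<open>\<epsilon> \<xi> c\<close> is the value on the edge from \<open>\<xi>\<close> to \<open>insert c \<xi>\<close>.\<close>

definition sign_assignment ::
  "diagram \<Rightarrow> (nat set \<Rightarrow> nat \<Rightarrow> nat \<Rightarrow> kring) \<Rightarrow> (nat set \<Rightarrow> nat \<Rightarrow> kring) \<Rightarrow> bool" where
  "sign_assignment D \<psi> \<epsilon> \<longleftrightarrow>
     (\<forall>\<xi> c. \<xi> \<subseteq> {..<ncross D} \<and> c < ncross D \<and> c \<notin> \<xi> \<longrightarrow> \<epsilon> \<xi> c dvd 1) \<and>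
     (\<forall>\<xi> i j. cube_face D \<xi> i j \<longrightarrow>
        \<epsilon> (insert i \<xi>) j * \<epsilon> \<xi> i * \<psi> \<xi> i j = - (\<epsilon> (insert j \<xi>) i * \<epsilon> \<xi> j))"

text \<open>The component \<open>D\<^sub>\<xi> \<rightarrow> D\<^bsub>\<xi>'\<^esub>\<close> of the differential of \<open>Kh(D)\<close>.\<close>

definition Kh_diff ::
  "diagram \<Rightarrow> (nat set \<Rightarrow> nat \<Rightarrow> kring) \<Rightarrow> nat set \<Rightarrow> nat set \<Rightarrow> (cob \<Rightarrow>\<^sub>0 kring)" where
  "Kh_diff D \<epsilon> \<xi> \<xi>' =
     (\<Sum>c | c < ncross D \<and> c \<notin> \<xi> \<and> \<xi>' = insert c \<xi>. Poly_Mapping.single (saddle D \<xi> c) (\<epsilon> \<xi> c))"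

text \<open>The complex \<open>F Kh(D)\<close>: in degree \<open>i\<close> the direct sum of \<open>F(D\<^sub>\<xi>)\<close> over \<open>|\<xi>| = i + n\<^sub>-\<close>, with the
  basis of pairs \<open>(\<xi>, w)\<close>.\<close>

type_synonym chain = "(nat set \<times> word) \<Rightarrow>\<^sub>0 kring"

definition FKh :: "diagram \<Rightarrow> int \<Rightarrow> chain set" where
  "FKh D i = {x. Poly_Mapping.keys x \<subseteq>
     {(\<xi>, w). \<xi> \<subseteq> {..<ncross D} \<and> int (card \<xi>) = i + int (n_neg D)
        \<and> length w = length (circ_order D \<xi>)}}"

definition FKh_diff :: "diagram \<Rightarrow> (nat set \<Rightarrow> nat \<Rightarrow> kring) \<Rightarrow> chain \<Rightarrow> chain" where
  "FKh_diff D \<epsilon> = lin_extend (\<lambda>(\<xi>, w). \<Sum>\<xi>'\<in>Pow {..<ncross D}.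
     lin_extend (\<lambda>w'. Poly_Mapping.single (\<xi>', w') 1) (F_mor (Kh_diff D \<epsilon> \<xi> \<xi>') w))"

section \<open>Tensor products and homology\<close>

text \<open>For a module \<open>C\<close> (a submodule of the free module on \<open>'a\<close>) and a module structure \<open>act\<close> on \<open>'m\<close>,
  \<open>C \<otimes> 'm\<close> is the free abelian group on \<open>C \<times> 'm\<close> modulo the bilinear, balanced relations.\<close>

definition tensor_relators ::
  "(kring \<Rightarrow> 'm \<Rightarrow> 'm) \<Rightarrow> ('a \<Rightarrow>\<^sub>0 kring) set \<Rightarrow> (('a \<Rightarrow>\<^sub>0 kring) \<times> 'm::ab_group_add \<Rightarrow>\<^sub>0 int) set" where
  "tensor_relators act C =
     {frag_of (x + y, m) - frag_of (x, m) - frag_of (y, m) | x y m. x \<in> C \<and> y \<in> C} \<union>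
     {frag_of (x, m + m') - frag_of (x, m) - frag_of (x, m') | x m m'. x \<in> C} \<union>
     {frag_of (kscale r x, m) - frag_of (x, act r m) | r x m. x \<in> C}"

definition tensor_null ::
  "(kring \<Rightarrow> 'm \<Rightarrow> 'm) \<Rightarrow> ('a \<Rightarrow>\<^sub>0 kring) set \<Rightarrow> (('a \<Rightarrow>\<^sub>0 kring) \<times> 'm::ab_group_add \<Rightarrow>\<^sub>0 int) set" where
  "tensor_null act C = generate (free_Abelian_group (C \<times> UNIV)) (tensor_relators act C)"

definition tensor ::
  "(kring \<Rightarrow> 'm \<Rightarrow> 'm) \<Rightarrow> ('a \<Rightarrow>\<^sub>0 kring) set \<Rightarrow> (('a \<Rightarrow>\<^sub>0 kring) \<times> 'm::ab_group_add \<Rightarrow>\<^sub>0 int) set monoid" where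
  "tensor act C = free_Abelian_group (C \<times> UNIV) Mod tensor_null act C"

text \<open>The map \<open>d \<otimes> id\<close> into \<open>C' \<otimes> 'm\<close> induced by \<open>d\<close>.  All summands of the union coincide when \<open>d\<close> is
  linear.\<close>

definition tensor_map ::
  "(kring \<Rightarrow> 'm \<Rightarrow> 'm) \<Rightarrow> ('a \<Rightarrow>\<^sub>0 kring) set \<Rightarrow> (('a \<Rightarrow>\<^sub>0 kring) \<Rightarrow> ('a \<Rightarrow>\<^sub>0 kring))
   \<Rightarrow> (('a \<Rightarrow>\<^sub>0 kring) \<times> 'm::ab_group_add \<Rightarrow>\<^sub>0 int) set \<Rightarrow> (('a \<Rightarrow>\<^sub>0 kring) \<times> 'm \<Rightarrow>\<^sub>0 int) set" where
  "tensor_map act C' d S =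
     (\<Union>s\<in>S. tensor_null act C' #>\<^bsub>free_Abelian_group (C' \<times> UNIV)\<^esub>
              frag_extend (\<lambda>(x, m). frag_of (d x, m)) s)"

definition kh_homology ::
  "diagram \<Rightarrow> (nat set \<Rightarrow> nat \<Rightarrow> kring) \<Rightarrow> (kring \<Rightarrow> 'm \<Rightarrow> 'm) \<Rightarrow> int
   \<Rightarrow> (chain \<times> 'm::ab_group_add \<Rightarrow>\<^sub>0 int) set set monoid" where
  "kh_homology D \<epsilon> act i =
     (let T = \<lambda>i. tensor act (FKh D i);
          d = \<lambda>i. tensor_map act (FKh D (i + 1)) (FKh_diff D \<epsilon>)
      in (T i)\<lparr>carrier := kernel (T i) (T (i + 1)) (d i)\<rparr> Mod (d (i - 1) ` carrier (T (i - 1))))"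

end

theory Submission
  imports Defs "HOL-Library.Multiset" "HOL-Library.Function_Algebras"
begin

text \<open>A module structure on \<open>\<int>\<close> is a ring homomorphism \<open>\<phi>\<close> with \<open>\<phi> X\<close>, \<open>\<phi> Y\<close>, \<open>\<phi> Z\<close> equal to \<open>\<plusminus>1\<close>,
  and two of them that agree on \<open>XY\<close> differ by \<open>X \<mapsto> \<sigma>X\<close>, \<open>Y \<mapsto> \<sigma>Y\<close>, \<open>Z \<mapsto> \<sigma>\<tau>Z\<close> for signs \<open>\<sigma>\<close>, \<open>\<tau>\<close>.
  Rescale a word in \<open>v\<^sub>+\<close>, \<open>v\<^sub>-\<close> by \<open>\<tau>\<close> to the power \<open>inv + q m\<close>, where \<open>inv\<close> counts the pairs in which \<open>v\<^sub>+\<close>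
  precedes \<open>v\<^sub>-\<close>, \<open>q\<close> counts the letters \<open>v\<^sub>-\<close> and \<open>m\<close> is the number of merges performed so far.  After
  this rescaling the change of signs multiplies the map of a saddle by a sign \<open>\<eta>\<close> that does not depend
  on the basis vector.  Comparing the two sides of the relation on a face \<open>S\<close> shows that the product
  of \<open>\<eta>\<close> around \<open>S\<close> is \<open>\<phi>(\<psi>(S)) \<phi>'(\<psi>(S))\<close> whenever the composite map is nonzero.  The composite
  can only vanish when a circle is split and merged back.  There \<open>\<psi>(S)\<close> is \<open>1\<close> or \<open>XY\<close>, so both
  homomorphisms agree on it, and since \<open>\<eta>\<close> depends only on \<open>\<sigma>\<close> and \<open>\<tau>\<close> it may be computed from the even
  homomorphism, for which the matrices are nonnegative and nothing cancels.  Hence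
  \<open>\<phi>(\<epsilon>) \<phi>'(\<epsilon>) \<eta>\<close> is a 1-cocycle on the cube; writing it as a coboundary turns the rescaling into an
  isomorphism of complexes.

  That each saddle is a merge or a split is where planarity enters: by Euler's formula the first
  cohomology modulo 2 vanishes, so the edges have a source-sink orientation (alternately in and out
  at each crossing).  It orients the circles of all resolutions at once, and a surgery multiplies the
  permutation that traces them by a transposition.\<close>

section \<open>Specialisations of the functor\<close>

text \<open>Powers of a sign with integer exponent. Exponents may be negative, since Z is invertible
  and degrees have negative entries, but for a sign only the parity matters.\<close>

definition spow :: "int \<Rightarrow> int \<Rightarrow> int" where
  "spow s n = (if even n then 1 else s)"

lemma spow_sign: "s * s = 1 \<Longrightarrow> spow s n * spow s n = 1"
  by (simp add: spow_def)

lemma spow_add: "s * s = 1 \<Longrightarrow> spow s (m + n) = spow s m * spow s n"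
  by (simp add: spow_def)

lemma int_square_eq_1: "(s::int) * s = 1 \<longleftrightarrow> s = 1 \<or> s = -1"
  by (metis mult_minus_left mult_minus_right mult.right_neutral minus_minus zmult_eq_1_iff)

lemma kring_monomial:
  "(Poly_Mapping.single (i, j, l) 1 :: kring) =
     Poly_Mapping.single (i, 0, 0) 1 * Poly_Mapping.single (0, j, 0) 1 * Poly_Mapping.single (0, 0, l) 1"
  by (simp add: Poly_Mapping.mult_single)

lemma of_int_bit_eq_0_iff: "(of_int n :: bit) = 0 \<longleftrightarrow> even n"
  by (metis even_of_int_iff even_zero bit_not_zero_iff odd_one)

section \<open>Homomorphisms from the ground ring to the integers\<close>

locale ground_hom =
  fixes \<phi> :: "kring \<Rightarrow> int"
  assumes hom_add: "\<phi> (r + s) = \<phi> r + \<phi> s"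
    and hom_mult: "\<phi> (r * s) = \<phi> r * \<phi> s"
    and hom_one: "\<phi> 1 = 1"
begin

lemma hom_zero: "\<phi> 0 = 0"
  using hom_add[of 0 0] by simp

lemma hom_uminus: "\<phi> (- r) = - \<phi> r"
  using hom_add[of r "- r"] by (simp add: hom_zero)

text \<open>Units go to units of \<int>, which are signs. Besides X, Y and Z this applies to the
  values of \<open>\<psi>\<close> and \<open>\<epsilon>\<close>.\<close>

lemma hom_unit: "r dvd 1 \<Longrightarrow> \<phi> r * \<phi> r = 1"
  by (metis dvd_def hom_mult hom_one int_square_eq_1 zmult_eq_1_iff)

lemma hom_XX: "\<phi> KX * \<phi> KX = 1" and hom_YY: "\<phi> KY * \<phi> KY = 1" and hom_ZZ: "\<phi> KZ * \<phi> KZ = 1"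
  using kring_relations by (auto intro!: hom_unit simp: dvd_def)

lemma hom_power_Z: "\<phi> (Poly_Mapping.single (0, 0, l) 1) = spow (\<phi> KZ) l"
proof -
  let ?m = "\<lambda>l. Poly_Mapping.single (0, 0, l) 1 :: kring"
  have m0: "?m 0 = 1" by (simp flip: zero_prod_def)
  have step: "\<phi> (?m (l + 1)) = \<phi> (?m l) * \<phi> KZ" for l
    by (simp add: KZ_def Poly_Mapping.mult_single flip: hom_mult)
  \<comment> \<open>Since \<open>\<phi> KZ\<close> is a sign, multiplying by it again undoes a step;
    this serves the downward half of the induction.\<close>
  have step': "\<phi> (?m l) = \<phi> (?m (l + 1)) * \<phi> KZ" for l
    by (simp add: step mult.assoc hom_ZZ)
  show ?thesis
  proof (induction l rule: int_induct[where k = 0])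
    case base
    then show ?case by (simp only: m0 hom_one) (simp add: spow_def)
  next
    case (step1 i)
    then show ?case by (simp add: step spow_def hom_ZZ)
  next
    case (step2 i)
    then show ?case using step'[of "i - 1"] by (simp add: spow_def hom_ZZ)
  qed
qed

lemma hom_lam:
  "\<phi> (lam p q) = spow (\<phi> KX) (fst p * fst q) * spow (\<phi> KY) (snd p * snd q)
     * spow (\<phi> KZ) (fst p * snd q - fst q * snd p)"
proof -
  have X: "\<phi> (Poly_Mapping.single (of_int n, 0, 0) 1) = spow (\<phi> KX) n" for n
  proof (cases "even n")
    case True
    then have "of_int n = (0::bit)" by (simp add: of_int_bit_eq_0_iff)
    with True show ?thesis by (simp add: spow_def hom_one flip: zero_prod_def)
  next
    case False
    then have "of_int n = (1::bit)" by (metis of_int_bit_eq_0_iff bit_not_zero_iff)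
    with False show ?thesis by (simp add: spow_def KX_def)
  qed
  have Y: "\<phi> (Poly_Mapping.single (0, of_int n, 0) 1) = spow (\<phi> KY) n" for n
  proof (cases "even n")
    case True
    then have "of_int n = (0::bit)" by (simp add: of_int_bit_eq_0_iff)
    with True show ?thesis by (simp add: spow_def hom_one flip: zero_prod_def)
  next
    case False
    then have "of_int n = (1::bit)" by (metis of_int_bit_eq_0_iff bit_not_zero_iff)
    with False show ?thesis by (simp add: spow_def KY_def)
  qed
  show ?thesis
    unfolding lam_def by (subst kring_monomial) (simp only: hom_mult X Y hom_power_Z)
qed

text \<open>The coefficients of \<open>c\<close> are specialised along \<open>\<phi>\<close>, and
  then the linear functional with values \<open>f\<close> on the basis is applied.\<close>

definition ev :: "('a \<Rightarrow> int) \<Rightarrow> ('a \<Rightarrow>\<^sub>0 kring) \<Rightarrow> int" where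
  "ev f c = (\<Sum>v\<in>Poly_Mapping.keys c. \<phi> (Poly_Mapping.lookup c v) * f v)"

lemma ev_superset:
  assumes "finite S" "Poly_Mapping.keys c \<subseteq> S"
  shows "ev f c = (\<Sum>v\<in>S. \<phi> (Poly_Mapping.lookup c v) * f v)"
  unfolding ev_def
  by (rule sum.mono_neutral_left) (use assms in \<open>auto simp: in_keys_iff hom_zero\<close>)

lemma ev_zero [simp]: "ev f 0 = 0"
  by (simp add: ev_def)

lemma ev_single [simp]: "ev f (Poly_Mapping.single v r) = \<phi> r * f v"
  by (simp add: ev_def hom_zero)

lemma ev_add: "ev f (c + d) = ev f c + ev f d"
proof -
  let ?S = "Poly_Mapping.keys c \<union> Poly_Mapping.keys d"
  have "ev f (c + d) = (\<Sum>v\<in>?S. \<phi> (Poly_Mapping.lookup (c + d) v) * f v)"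
    by (rule ev_superset) (use Poly_Mapping.keys_add[of c d] in auto)
  also have "\<dots> = ev f c + ev f d"
    by (simp add: ev_superset[of ?S c] ev_superset[of ?S d] lookup_add hom_add distrib_right sum.distrib)
  finally show ?thesis .
qed

lemma ev_sum: "ev f (\<Sum>i\<in>I. c i) = (\<Sum>i\<in>I. ev f (c i))"
  by (induction I rule: infinite_finite_induct) (simp_all add: ev_add)

lemma ev_kscale [simp]: "ev f (kscale r c) = \<phi> r * ev f c"
proof -
  have "ev f (kscale r c) = (\<Sum>v\<in>Poly_Mapping.keys c. \<phi> (Poly_Mapping.lookup (kscale r c) v) * f v)"
    by (rule ev_superset) (auto simp: in_keys_iff lookup_kscale)
  then show ?thesis
    by (simp add: ev_def lookup_kscale hom_mult sum_distrib_left mult.assoc)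
qed

lemma ev_lin_extend: "ev f (lin_extend g c) = ev (\<lambda>u. ev f (g u)) c"
  by (simp add: lin_extend_def ev_sum) (simp add: ev_def)

lemma ev_cmult: "ev (\<lambda>v. a * f v) c = a * ev f c"
  by (simp add: ev_def sum_distrib_left mult.left_commute)

lemma ev_swap: "ev (\<lambda>u. ev (\<lambda>v. h u v) d) c = ev (\<lambda>v. ev (\<lambda>u. h u v) c) d"
  unfolding ev_def sum_distrib_left by (subst sum.swap) (simp add: mult.left_commute)

text \<open>Indicator functionals recover single specialised coefficients; this is how statements
  about \<open>pull\<close> are turned back into statements about matrix entries.\<close>

lemma ev_indicator: "ev (\<lambda>v. if v = w then 1 else 0) c = \<phi> (Poly_Mapping.lookup c w)"
proof -
  have "ev (\<lambda>v. if v = w then 1 else 0) c =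
      (\<Sum>v\<in>Poly_Mapping.keys c. if v = w then \<phi> (Poly_Mapping.lookup c v) else 0)"
    unfolding ev_def by (rule sum.cong) auto
  then show ?thesis by (simp add: in_keys_iff hom_zero)
qed

text \<open>\<open>pull W\<close> is the transpose of \<open>F W\<close>: it acts on functionals on words, so that composites can be
  computed without sums over intermediate words.\<close>

definition gpull :: "cgen \<Rightarrow> (word \<Rightarrow> int) \<Rightarrow> word \<Rightarrow> int" where
  "gpull g f u = ev f (F_gen g u)"

definition pull :: "cob \<Rightarrow> (word \<Rightarrow> int) \<Rightarrow> word \<Rightarrow> int" where
  "pull W f w = ev f (F_cob W w)"

lemma gpull_simps [simp]:
  "gpull Merge f [Vplus, Vplus] = f [Vplus]"
  "gpull Merge f [Vplus, Vminus] = f [Vminus]"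
  "gpull Merge f [Vminus, Vplus] = \<phi> KX * \<phi> KZ * f [Vminus]"
  "gpull Merge f [Vminus, Vminus] = 0"
  "gpull Split f [Vplus] = f [Vminus, Vplus] + \<phi> KY * \<phi> KZ * f [Vplus, Vminus]"
  "gpull Split f [Vminus] = f [Vminus, Vminus]"
  "gpull Birth f [] = f [Vplus]"
  "gpull DeathN f [Vplus] = 0"
  "gpull DeathN f [Vminus] = f []"
  "gpull DeathP f [Vplus] = 0"
  "gpull DeathP f [Vminus] = \<phi> KY * f []"
  "gpull Twist f [u, v] = \<phi> (lam (vdeg u) (vdeg v)) * f [v, u]"
  by (simp_all add: gpull_def ev_add hom_one hom_mult)

lemma pull_Nil [simp]: "pull [] f w = f w"
  by (simp add: pull_def hom_one)

lemma pull_Cons_ev: "pull (l # W) f w = ev (pull W f) (F_layer l w)"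
proof -
  have "pull W f = (\<lambda>u. ev f (F_cob W u))" by (simp add: pull_def fun_eq_iff)
  then show ?thesis by (simp add: pull_def ev_lin_extend)
qed

lemma pull_Cons:
  "pull ((a, g, b) # W) f w = \<phi> (lam (gdeg g) (wdeg (take a w)))
     * gpull g (\<lambda>u. pull W f (take a w @ u @ drop (a + gsrc g) w)) (take (gsrc g) (drop a w))"
  by (simp add: pull_Cons_ev ev_lin_extend gpull_def hom_one)

lemma pull_layer:
  "length l = a \<Longrightarrow> length m = gsrc g \<Longrightarrow> pull ((a, g, b) # W) f (l @ m @ r) =
     \<phi> (lam (gdeg g) (wdeg l)) * gpull g (\<lambda>u. pull W f (l @ u @ r)) m"
  by (auto simp: pull_Cons)

lemma pull_append: "pull (U @ W) f = pull U (pull W f)"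
proof (induction U)
  case (Cons l U)
  then show ?case by (intro ext) (simp add: pull_Cons_ev)
qed (intro ext, simp)

lemma pull_cmult: "pull W (\<lambda>v. a * f v) w = a * pull W f w"
  by (simp add: pull_def ev_cmult)

end

section \<open>Padding and interchange for transposed words\<close>

lemma length_split3:
  assumes "length w = a + s + b"
  obtains l m r where "w = l @ m @ r" "length l = a" "length m = s" "length r = b"
  using assms by (metis append_take_drop_id length_take length_drop add.assoc diff_add_inverse le_add1 min.absorb2)

lemma wdeg_simps [simp]:
  "wdeg [] = 0" "wdeg (v # w) = vdeg v + wdeg w" "wdeg (u @ w) = wdeg u + wdeg w"
  by (simp_all add: wdeg_def)

lemma vgen_neq: "v \<noteq> Vplus \<longleftrightarrow> v = Vminus" "v \<noteq> Vminus \<longleftrightarrow> v = Vplus"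
  by (cases v; simp)+

text \<open>The table of all generators with all their input words. Claims about a single generator
  are proved by running through its fifteen entries.\<close>

lemma gen_words:
  assumes "length m = gsrc g"
  shows "(g, m) \<in> {(Merge, [Vplus, Vplus]), (Merge, [Vplus, Vminus]), (Merge, [Vminus, Vplus]),
    (Merge, [Vminus, Vminus]), (Split, [Vplus]), (Split, [Vminus]), (Birth, []), (DeathP, [Vplus]),
    (DeathP, [Vminus]), (DeathN, [Vplus]), (DeathN, [Vminus]), (Twist, [Vplus, Vplus]),
    (Twist, [Vplus, Vminus]), (Twist, [Vminus, Vplus]), (Twist, [Vminus, Vminus])}"
  using assms by (cases g) (auto simp: numeral_2_eq_2 length_Suc_conv vgen_neq)

context ground_hom
begin

lemma X_cases: "\<phi> KX = 1 \<or> \<phi> KX = -1" and Y_cases: "\<phi> KY = 1 \<or> \<phi> KY = -1"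
  and Z_cases: "\<phi> KZ = 1 \<or> \<phi> KZ = -1"
  using hom_XX hom_YY hom_ZZ by (simp_all only: int_square_eq_1)

text \<open>The exponents in \<open>lam\<close> are bilinear in the two degrees.\<close>

lemma hom_lam_add_right: "\<phi> (lam p (q + q')) = \<phi> (lam p q) * \<phi> (lam p q')"
  and hom_lam_add_left: "\<phi> (lam (p + p') q) = \<phi> (lam p q) * \<phi> (lam p' q)"
  using X_cases Y_cases Z_cases by (elim disjE; auto simp: hom_lam spow_def)+

lemma hom_lam_zero [simp]: "\<phi> (lam p 0) = 1" "\<phi> (lam 0 q) = 1"
  by (simp_all add: hom_lam spow_def)

lemma gpull_cong:
  assumes "length m = gsrc g" "\<And>u. length u = gtgt g \<Longrightarrow> f u = f' u"
  shows "gpull g f m = gpull g f' m"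
  using gen_words[OF assms(1)] by (auto simp: assms(2))

lemma gpull_cmult: "gpull g (\<lambda>u. a * f u) m = a * gpull g f m"
  by (simp add: gpull_def ev_cmult)

lemma gpull_swap:
  "gpull g (\<lambda>u. gpull g' (\<lambda>v. h u v) m') m = gpull g' (\<lambda>v. gpull g (\<lambda>u. h u v) m) m'"
  unfolding gpull_def by (rule ev_swap)

text \<open>The map of \<open>g\<close> is homogeneous of degree \<open>gdeg g\<close>, so a factor
  that depends only on the degree of the output is a constant on all terms.\<close>

lemma gpull_wdeg:
  assumes "length m = gsrc g"
  shows "gpull g (\<lambda>u. h (wdeg u) * f u) m = h (wdeg m + gdeg g) * gpull g f m"
  using gen_words[OF assms] by (auto simp: zero_prod_def distrib_left)

lemma pull_cong:
  assumes "cob_typed n W k" "length w = n" "\<And>v. length v = k \<Longrightarrow> f v = f' v"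
  shows "pull W f w = pull W f' w"
  using assms
proof (induction W arbitrary: n w)
  case (Cons L W)
  obtain a g b where L: "L = (a, g, b)" by (cases L)
  then obtain l m r where w: "w = l @ m @ r" "length l = a" "length m = gsrc g" "length r = b"
    using Cons.prems by (auto elim: length_split3)
  have "gpull g (\<lambda>u. pull W f (l @ u @ r)) m = gpull g (\<lambda>u. pull W f' (l @ u @ r)) m"
    by (rule gpull_cong) (use Cons w L in auto)
  then show ?case by (simp add: L w pull_layer)
qed simp

definition cdeg :: "cob \<Rightarrow> int \<times> int" where
  "cdeg W = sum_list (map (\<lambda>(a, g, b). gdeg g) W)"

text \<open>Each layer pays a factor \<open>lam\<close> for passing the letters \<open>l\<close>; by
  bimultiplicativity these factors combine to the one for the total degree of
  \<open>W\<close>.\<close>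

lemma pull_pad:
  assumes "cob_typed (length u) W k" "length l = a" "length r = b"
  shows "pull (pad a W b) f (l @ u @ r) =
    \<phi> (lam (cdeg W) (wdeg l)) * pull W (\<lambda>v. f (l @ v @ r)) u"
  using assms
proof (induction W arbitrary: u)
  case (Cons L W)
  obtain a' g b' where L: "L = (a', g, b')" by (cases L)
  then obtain l' m r' where u: "u = l' @ m @ r'" "length l' = a'" "length m = gsrc g" "length r' = b'"
    using Cons.prems by (auto elim: length_split3)
  have "pull (pad a (L # W) b) f (l @ u @ r) = pull ((a + a', g, b' + b) # pad a W b) f ((l @ l') @ m @ (r' @ r))"
    by (simp add: pad_def L u)
  also have "\<dots> = \<phi> (lam (gdeg g) (wdeg l + wdeg l')) *
      gpull g (\<lambda>v. pull (pad a W b) f (l @ (l' @ v @ r') @ r)) m"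
    by (subst pull_layer) (use u Cons.prems in auto)
  also have "gpull g (\<lambda>v. pull (pad a W b) f (l @ (l' @ v @ r') @ r)) m =
     gpull g (\<lambda>v. \<phi> (lam (cdeg W) (wdeg l)) * pull W (\<lambda>v. f (l @ v @ r)) (l' @ v @ r')) m"
  proof (rule gpull_cong)
    fix v :: word assume "length v = gtgt g"
    then have "cob_typed (length (l' @ v @ r')) W k" using Cons.prems u L by (simp add: add.assoc)
    from Cons.IH[OF this] Cons.prems show "pull (pad a W b) f (l @ (l' @ v @ r') @ r) =
        \<phi> (lam (cdeg W) (wdeg l)) * pull W (\<lambda>v. f (l @ v @ r)) (l' @ v @ r')" by simp
  qed (use u in simp)
  finally show ?case
    by (simp add: L u pull_layer cdeg_def gpull_cmult hom_lam_add_right hom_lam_add_left)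
qed (simp add: pad_def cdeg_def)

text \<open>The two generators act on disjoint groups of letters. If \<open>g'\<close> is applied
  first, the letters to the left of \<open>g\<close> have their degree shifted by
  \<open>gdeg g'\<close>, and this shift alone accounts for the factor.\<close>

lemma pull_interchange:
  assumes "length w = gsrc g' + (k + gsrc g)"
  shows "pull [(0, g', k + gsrc g), (gtgt g' + k, g, 0)] f w =
    \<phi> (lam (gdeg g) (gdeg g')) * pull [(gsrc g' + k, g, 0), (0, g', k + gtgt g)] f w"
proof -
  obtain m' mid m where w: "w = m' @ mid @ m" "length m' = gsrc g'" "length mid = k" "length m = gsrc g"
    using assms by (metis length_split3 add.assoc)
  have "pull [(0, g', k + gsrc g), (gtgt g' + k, g, 0)] f w =
      gpull g' (\<lambda>u. pull [(gtgt g' + k, g, 0)] f (u @ mid @ m)) m'"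
    using pull_layer[of "[]" 0 m' g' "k + gsrc g" "[(gtgt g' + k, g, 0)]" f "mid @ m"] w by simp
  also have "\<dots> = gpull g' (\<lambda>u. \<phi> (lam (gdeg g) (wdeg u + wdeg mid)) * gpull g (\<lambda>v. f (u @ mid @ v)) m) m'"
  proof (rule gpull_cong[OF w(2)])
    fix u :: word assume "length u = gtgt g'"
    then show "pull [(gtgt g' + k, g, 0)] f (u @ mid @ m) =
        \<phi> (lam (gdeg g) (wdeg u + wdeg mid)) * gpull g (\<lambda>v. f (u @ mid @ v)) m"
      using pull_layer[of "u @ mid" "gtgt g' + k" m g 0 "[]" f "[]"] w by simp
  qed
  also have "\<dots> = \<phi> (lam (gdeg g) (wdeg m' + gdeg g' + wdeg mid)) *
      gpull g' (\<lambda>u. gpull g (\<lambda>v. f (u @ mid @ v)) m) m'"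
    by (rule gpull_wdeg[OF w(2), where h = "\<lambda>d. \<phi> (lam (gdeg g) (d + wdeg mid))"])
  also have "\<dots> = \<phi> (lam (gdeg g) (gdeg g')) * (\<phi> (lam (gdeg g) (wdeg (m' @ mid))) *
      gpull g (\<lambda>v. gpull g' (\<lambda>u. f (u @ mid @ v)) m') m)"
    by (subst gpull_swap) (simp add: hom_lam_add_right)
  also have "gpull g (\<lambda>v. gpull g' (\<lambda>u. f (u @ mid @ v)) m') m =
      gpull g (\<lambda>v. pull [(0, g', k + gtgt g)] f (m' @ mid @ v)) m"
    using pull_layer[of "[]" 0 m' g' "k + gtgt g" "[]" f "mid @ _"] w by simp
  also have "\<phi> (lam (gdeg g) (wdeg (m' @ mid))) * \<dots> =
      pull [(gsrc g' + k, g, 0), (0, g', k + gtgt g)] f w"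
    using pull_layer[of "m' @ mid" "gsrc g' + k" m g 0 "[(0, g', k + gtgt g)]" f "[]"] w by simp
  finally show ?thesis .
qed

end

section \<open>Compatibility of the functor with the chronological relations\<close>

lemma words_1: "length w = Suc 0 \<Longrightarrow> w = [Vplus] \<or> w = [Vminus]"
  by (auto simp: length_Suc_conv vgen_neq)

lemma words_2: "length w = Suc (Suc 0) \<Longrightarrow>
    w = [Vplus, Vplus] \<or> w = [Vplus, Vminus] \<or> w = [Vminus, Vplus] \<or> w = [Vminus, Vminus]"
  by (auto simp: length_Suc_conv vgen_neq)

lemma words_3: "length w = Suc (Suc (Suc 0)) \<Longrightarrow> \<exists>u v. w = u # v \<and> (u = Vplus \<or> u = Vminus) \<and>
    (v = [Vplus, Vplus] \<or> v = [Vplus, Vminus] \<or> v = [Vminus, Vplus] \<or> v = [Vminus, Vminus])"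
  by (auto simp: length_Suc_conv vgen_neq)

lemma cob_typed_unique: "cob_typed n W k \<Longrightarrow> cob_typed n W k' \<Longrightarrow> k = k'"
  by (induction n W k rule: cob_typed.induct) auto

context ground_hom
begin

lemma sign_simps:
  "\<phi> KX * \<phi> KX = 1" "\<phi> KX * (\<phi> KX * a) = a" "\<phi> KY * \<phi> KY = 1" "\<phi> KY * (\<phi> KY * a) = a"
  "\<phi> KZ * \<phi> KZ = 1" "\<phi> KZ * (\<phi> KZ * a) = a"
  by (simp_all add: hom_XX hom_YY hom_ZZ flip: mult.assoc)

lemma pull_twist_natural:
  assumes "length w = gsrc g + 1"
  shows "pull ((0, g, 1) # strand_left (gtgt g)) f w = pull (strand_left (gsrc g) @ [(1, g, 0)]) f w"
proof -
  obtain m v where w: "w = m @ [v]" "length m = gsrc g"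
    using assms by (metis Suc_eq_plus1 length_Suc_conv_rev)
  have [simp]: "strand_left 0 = []" "strand_left 1 = [(0, Twist, 0)]"
    "strand_left (Suc 0) = [(0, Twist, 0)]"
    "strand_left 2 = [(1, Twist, 0), (0, Twist, 1)]" by (simp_all add: strand_left_def upt_rec)
  have "(v = Vplus \<or> v = Vminus)" by (cases v) auto
  with gen_words[OF w(2)] show ?thesis
    unfolding insert_iff empty_iff prod.inject
    by (elim disjE conjE) (simp_all add: w pull_Cons hom_lam spow_def sign_simps algebra_simps hom_one hom_mult)
qed

text \<open>Interchange and naturality of the twist were treated separately; each remaining relation
  has at most three inputs and is checked on every basis word.\<close>

lemma ch_rel_pull:
  assumes "ch_rel W u W'" "cob_typed (length w) W k"
  shows "pull W f w = \<phi> u * pull W' f w"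
  using assms
proof (cases rule: ch_rel.cases)
  case (interchange g' k' g)
  then show ?thesis using assms(2) by (simp only:) (rule pull_interchange, simp)
next
  case (twist_natural g)
  then show ?thesis using assms(2) pull_twist_natural[of w g] by (simp add: hom_one)
next
  case assoc
  then have "length w = Suc (Suc (Suc 0))" using assms(2) by simp
  from words_3[OF this] show ?thesis
    by (elim disjE exE conjE) (simp_all add: assoc pull_Cons hom_lam spow_def sign_simps algebra_simps hom_one hom_mult)
next
  case frobenius_left
  then have "length w = Suc (Suc 0)" using assms(2) by simp
  from words_2[OF this] show ?thesis
    by (elim disjE exE conjE) (simp_all add: frobenius_left pull_Cons hom_lam spow_def sign_simps algebra_simps hom_one hom_mult)
next
  case frobenius_right
  then have "length w = Suc (Suc 0)" using assms(2) by simp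
  from words_2[OF this] show ?thesis
    by (elim disjE exE conjE) (simp_all add: frobenius_right pull_Cons hom_lam spow_def sign_simps algebra_simps hom_one hom_mult)
next
  case merge_comm
  then have "length w = Suc (Suc 0)" using assms(2) by simp
  from words_2[OF this] show ?thesis
    by (elim disjE exE conjE) (simp_all add: merge_comm pull_Cons hom_lam spow_def sign_simps algebra_simps hom_one hom_mult)
next
  case twist_twist
  then have "length w = Suc (Suc 0)" using assms(2) by simp
  from words_2[OF this] show ?thesis
    by (elim disjE exE conjE) (simp_all add: twist_twist pull_Cons hom_lam spow_def sign_simps algebra_simps hom_one hom_mult)
next
  case split_comm
  then have "length w = Suc 0" using assms(2) by simp
  from words_1[OF this] show ?thesis
    by (elim disjE exE conjE) (simp_all add: split_comm pull_Cons hom_lam spow_def sign_simps algebra_simps hom_one hom_mult)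
next
  case death
  then have "length w = Suc 0" using assms(2) by simp
  from words_1[OF this] show ?thesis
    by (elim disjE exE conjE) (simp_all add: death pull_Cons hom_lam spow_def sign_simps algebra_simps hom_one hom_mult)
next
  case unit
  then have "length w = Suc 0" using assms(2) by simp
  from words_1[OF this] show ?thesis
    by (elim disjE exE conjE) (simp_all add: unit pull_Cons hom_lam spow_def sign_simps algebra_simps hom_one hom_mult)
next
  case counit_right
  then have "length w = Suc 0" using assms(2) by simp
  from words_1[OF this] show ?thesis
    by (elim disjE exE conjE) (simp_all add: counit_right pull_Cons hom_lam spow_def sign_simps algebra_simps hom_one hom_mult)
next
  case counit_left
  then have "length w = Suc 0" using assms(2) by simp
  from words_1[OF this] show ?thesis
    by (elim disjE exE conjE) (simp_all add: counit_left pull_Cons hom_lam spow_def sign_simps algebra_simps hom_one hom_mult)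
next
  case coassoc
  then have "length w = Suc 0" using assms(2) by simp
  from words_1[OF this] show ?thesis
    by (elim disjE exE conjE) (simp_all add: coassoc pull_Cons hom_lam spow_def sign_simps algebra_simps hom_one hom_mult)
qed
end

lemma cob_typed_append:
  "cob_typed n (U @ W) k \<longleftrightarrow> (\<exists>j. cob_typed n U j \<and> cob_typed j W k)"
  by (induction n U k rule: cob_typed.induct) auto

lemma cob_typed_pad:
  "cob_typed (a + p + b) (pad a W b) k \<longleftrightarrow> (\<exists>q. k = a + q + b \<and> cob_typed p W q)"
proof (induction W arbitrary: p)
  case Nil
  show ?case by (auto simp: pad_def)
next
  case (Cons L W)
  obtain a' g b' where L: "L = (a', g, b')" by (cases L)
  have "cob_typed (a + (a' + gtgt g + b') + b) (pad a W b) k =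
      cob_typed (a + a' + gtgt g + (b' + b)) (pad a W b) k"
    by (simp add: add.assoc)
  then show ?case using Cons[of "a' + gtgt g + b'"] by (auto simp: L pad_def)
qed

context ground_hom
begin

text \<open>The relations are homogeneous, so padding costs the same factor on both sides.\<close>

lemma ch_rel_cdeg: "ch_rel W u W' \<Longrightarrow> cdeg W = cdeg W'"
proof (induction rule: ch_rel.induct)
  case (twist_natural g)
  show ?case by (cases g) (simp_all add: cdeg_def strand_left_def upt_rec numeral_2_eq_2)
qed (simp_all add: cdeg_def zero_prod_def add.commute)

text \<open>The left side of a relation is never the empty word, so its first layer shows that the
  padding fits into the \<open>n\<close> strands.\<close>

lemma ch_rel_source:
  assumes "ch_rel W u W'" "cob_typed n (pad a W b) k"
  obtains p where "n = a + p + b"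
proof -
  have "W \<noteq> []" using assms(1) by (cases rule: ch_rel.cases) auto
  then obtain a' g b' V where "W = (a', g, b') # V" by (cases W) auto
  then have "n = a + (a' + gsrc g + b') + b" using assms(2) by (simp add: pad_def)
  then show ?thesis by (rule that)
qed

lemma ch_relators_pull:
  assumes "c \<in> ch_relators (length w) n"
  shows "ev (\<lambda>W. pull W f w) c = 0"
proof -
  obtain U V a b W W' u where c: "c = Poly_Mapping.single (U @ pad a W b @ V) 1 -
      Poly_Mapping.single (U @ pad a W' b @ V) u"
    and rel: "ch_rel W u W'" and t: "cob_typed (length w) (U @ pad a W b @ V) n"
    and t': "cob_typed (length w) (U @ pad a W' b @ V) n"
    using assms unfolding ch_relators_def by blast
  obtain j where j: "cob_typed (length w) U j" "cob_typed j (pad a W b @ V) n"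
    using t by (auto simp: cob_typed_append)
  then have "cob_typed j (pad a W' b @ V) n"
    using t' cob_typed_unique by (fastforce simp: cob_typed_append)
  then obtain k' where k': "cob_typed j (pad a W' b) k'"
    by (auto simp: cob_typed_append)
  obtain k where k: "cob_typed j (pad a W b) k" using j(2) by (auto simp: cob_typed_append)
  obtain p where p: "j = a + p + b" by (rule ch_rel_source[OF rel k])
  obtain q q' where q: "cob_typed p W q" "cob_typed p W' q'"
    using k k' unfolding p cob_typed_pad by auto
  have pads: "pull (pad a W b) h v = \<phi> u * pull (pad a W' b) h v" if "length v = j" for h v
  proof -
    obtain l m r where v: "v = l @ m @ r" "length l = a" "length m = p" "length r = b"
      using \<open>length v = j\<close> p by (auto elim: length_split3)
    show ?thesis
      using q v ch_rel_pull[OF rel, of m q "\<lambda>v. h (l @ v @ r)"] ch_rel_cdeg[OF rel]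
      by (simp add: pull_pad)
  qed
  have "pull (U @ pad a W b @ V) f w = pull U (\<lambda>v. \<phi> u * pull (pad a W' b) (pull V f) v) w"
    unfolding pull_append by (rule pull_cong[OF j(1)]) (simp_all add: pads)
  then have "pull (U @ pad a W b @ V) f w = \<phi> u * pull (U @ pad a W' b @ V) f w"
    by (simp add: pull_cmult pull_append)
  moreover have "ev h (c1 - c2) = ev h c1 - ev h c2" for h :: "cob \<Rightarrow> int" and c1 c2
    using ev_add[of h "c1 - c2" c2] by simp
  ultimately show ?thesis by (simp add: c hom_one)
qed

text \<open>For a fixed functional and input word, the elements with value 0 form a submodule; it
  contains the relators, hence their span.\<close>

lemma ch_eq_pull:
  assumes "ch_eq (length w) n c d"
  shows "ev (\<lambda>W. pull W f w) c = ev (\<lambda>W. pull W f w) d"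
proof -
  let ?h = "\<lambda>W. pull W f w"
  have "module.span kscale (ch_relators (length w) n) \<subseteq> {c. ev ?h c = 0}"
  proof (rule module.span_minimal[OF module_kscale])
    show "module.subspace kscale {c. ev ?h c = 0}"
      by (rule module.subspaceI[OF module_kscale]) (auto simp: ev_add)
  qed (use ch_relators_pull in auto)
  then have "ev ?h (c - d) = 0" using assms by (auto simp: ch_eq_def)
  then show ?thesis using ev_add[of ?h "c - d" d] by simp
qed

end

section \<open>Changing the signs of X, Y and Z\<close>

fun plus_count minus_count inversions :: "word \<Rightarrow> nat" where
  "plus_count [] = 0" | "plus_count (v # w) = (if v = Vplus then 1 else 0) + plus_count w"
| "minus_count [] = 0" | "minus_count (v # w) = (if v = Vminus then 1 else 0) + minus_count w"
| "inversions [] = 0"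
| "inversions (v # w) = (if v = Vplus then minus_count w else 0) + inversions w"

lemma count_append [simp]:
  "plus_count (u @ w) = plus_count u + plus_count w"
  "minus_count (u @ w) = minus_count u + minus_count w"
  "inversions (u @ w) = inversions u + inversions w + plus_count u * minus_count w"
  by (induction u) (auto simp: algebra_simps)

lemma wdeg_count: "wdeg w = (int (plus_count w), - int (minus_count w))"
  by (induction w) (auto simp: zero_prod_def vgen_neq)

lemma plus_minus_count: "plus_count w + minus_count w = length w"
  by (induction w) (auto simp: vgen_neq)

definition tsign :: "int \<Rightarrow> int \<Rightarrow> word \<Rightarrow> int" where
  "tsign \<tau> m w = spow \<tau> (int (inversions w) + int (minus_count w) * m)"

text \<open>The argument \<open>m\<close> is the number of merges below the word.\<close>

fun eta :: "int \<Rightarrow> int \<Rightarrow> int \<Rightarrow> cob \<Rightarrow> int" where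
  "eta \<sigma> \<tau> m [] = 1"
| "eta \<sigma> \<tau> m ((a, g, b) # W) = (if g = Twist then \<sigma> else spow \<sigma> (int a))
     * (if g = Split then spow \<tau> m else 1) * eta \<sigma> \<tau> (if g = Merge then m + 1 else m) W"

definition merges :: "cob \<Rightarrow> int" where
  "merges W = int (length (filter (\<lambda>(a, g, b). g = Merge) W))"

lemma merges_simps [simp]:
  "merges [] = 0" "merges ((a, g, b) # W) = (if g = Merge then 1 else 0) + merges W"
  "merges (U @ W) = merges U + merges W"
  by (simp_all add: merges_def)

definition elementary :: "cob \<Rightarrow> bool" where
  "elementary W \<longleftrightarrow> (\<forall>(a, g, b)\<in>set W. g \<in> {Merge, Split, Twist})"

lemma eta_append: "eta \<sigma> \<tau> m (U @ W) = eta \<sigma> \<tau> m U * eta \<sigma> \<tau> (m + merges U) W"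
  by (induction \<sigma> \<tau> m U rule: eta.induct) (auto simp: add_ac)

lemma sign_mult: "(s::int) * s = 1 \<Longrightarrow> t * t = 1 \<Longrightarrow> s * t * (s * t) = 1"
  by (metis mult.assoc mult.commute mult.right_neutral)

lemma eta_sign:
  assumes "\<sigma> * \<sigma> = 1" "\<tau> * \<tau> = 1"
  shows "eta \<sigma> \<tau> m W * eta \<sigma> \<tau> m W = 1"
proof (induction W arbitrary: m)
  case (Cons L W)
  obtain a g b where "L = (a, g, b)" by (cases L)
  then show ?case
    using assms Cons by (simp add: sign_mult spow_sign)
qed simp

lemma tsign_sign: "\<tau> * \<tau> = 1 \<Longrightarrow> tsign \<tau> m w * tsign \<tau> m w = 1"
  by (simp add: tsign_def spow_sign)

locale sign_change = A: ground_hom \<phi> + B: ground_hom \<phi>' for \<phi> \<phi>' +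
  fixes \<sigma> \<tau> :: int
  assumes sg: "\<sigma> * \<sigma> = 1" and tt: "\<tau> * \<tau> = 1"
    and X': "\<phi>' KX = \<sigma> * \<phi> KX" and Y': "\<phi>' KY = \<sigma> * \<phi> KY" and Z': "\<phi>' KZ = \<sigma> * \<tau> * \<phi> KZ"
begin

text \<open>For degrees (a, b) and (a', b'), X, Y and Z contribute aa', bb' and ab' - a'b to the
  exponent of \<open>\<sigma>\<close>. Modulo 2 their sum is (a + b)(a' + b').\<close>

lemma lam_change:
  "\<phi>' (lam p q) = spow \<sigma> ((fst p + snd p) * (fst q + snd q)) *
     spow \<tau> (fst p * snd q - fst q * snd p) * \<phi> (lam p q)"
  using sg tt unfolding int_square_eq_1
  by (elim disjE; simp add: A.hom_lam B.hom_lam X' Y' Z'; auto simp: spow_def)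

text \<open>Every letter has odd total degree, so \<open>\<sigma>\<close> enters through
  \<open>length l\<close> only, and once for each twist. The powers of \<open>\<tau>\<close> balance
  as follows. A twist of distinct letters changes \<open>inversions\<close> by one, matching its
  \<open>lam\<close>. A merge deletes one v+: the v- to its right are lost inversions, the other v-
  enter through \<open>lam\<close> and the coefficient XZ, and together these are all v-, which is
  what passing from m to m + 1 contributes. A split inserts one v-: its new inversions are cancelled
  by \<open>lam\<close> and the coefficient YZ, and the additional letter leaves the factor
  \<open>spow \<tau> m\<close>.\<close>

lemma layer_change:
  assumes "length x = gsrc g" "g \<in> {Merge, Split, Twist}"
  shows "\<phi>' (lam (gdeg g) (wdeg l)) *
      B.gpull g (\<lambda>u. tsign \<tau> (if g = Merge then m + 1 else m) (l @ u @ r) * f u) x * tsign \<tau> m (l @ x @ r) =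
    (if g = Twist then \<sigma> else spow \<sigma> (int (length l))) * (if g = Split then spow \<tau> m else 1) *
      (\<phi> (lam (gdeg g) (wdeg l)) * A.gpull g f x)"
proof -
  have L: "int (length l) = int (plus_count l) + int (minus_count l)"
    by (simp flip: plus_minus_count)
  have c: "s * (s * a) = a" "spow s n * (spow s n * a) = a" "spow s (- n) = spow s n"
    "spow s 1 = s" "spow s 0 = 1" "spow s (n * 2) = 1" "spow s (k - n) = spow s k * spow s n" if "s * s = 1" for s a n k
    using that spow_sign[OF that, of n] by (simp_all add: spow_def flip: mult.assoc)
  note cs = c[OF sg] c[OF tt]
  show ?thesis
    unfolding L lam_change wdeg_count tsign_def
    using gen_words[OF assms(1)] assms(2)
    unfolding insert_iff empty_iff prod.inject
    by (elim disjE conjE)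
      (simp_all add: X' Y' Z' lam_change sg tt cs spow_add[OF sg] spow_add[OF tt] algebra_simps)
qed

text \<open>The signs of the single layers multiply to \<open>eta\<close>. The rescaling at the top
  uses the number of merges reached there, so consecutive words fit together.\<close>

lemma pull_change:
  assumes "elementary W" "cob_typed n W k" "length w = n"
  shows "B.pull W f w * tsign \<tau> m w =
    eta \<sigma> \<tau> m W * A.pull W (\<lambda>v. tsign \<tau> (m + merges W) v * f v) w"
  using assms
proof (induction W arbitrary: n w m)
  case Nil
  then show ?case by simp
next
  case (Cons L W)
  obtain a g b where L: "L = (a, g, b)" by (cases L)
  then obtain l x r where w: "w = l @ x @ r" "length l = a" "length x = gsrc g" "length r = b"
    using Cons.prems by (auto elim: length_split3)
  have g: "g \<in> {Merge, Split, Twist}" and W: "elementary W"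
    using Cons.prems by (auto simp: elementary_def L)
  let ?m = "if g = Merge then m + 1 else m"
  let ?h = "A.pull W (\<lambda>v. tsign \<tau> (?m + merges W) v * f v)"
  have IH: "B.pull W f v = eta \<sigma> \<tau> ?m W * (tsign \<tau> ?m v * ?h v)" if "length v = a + gtgt g + b" for v
  proof -
    have "B.pull W f v * tsign \<tau> ?m v * tsign \<tau> ?m v = eta \<sigma> \<tau> ?m W * ?h v * tsign \<tau> ?m v"
      using Cons.IH[OF W _ that, of ?m] Cons.prems(2) by (simp add: L)
    then show ?thesis by (simp add: mult.assoc tsign_sign[OF tt] mult.commute mult.left_commute)
  qed
  have "B.gpull g (\<lambda>u. B.pull W f (l @ u @ r)) x =
      B.gpull g (\<lambda>u. eta \<sigma> \<tau> ?m W * (tsign \<tau> ?m (l @ u @ r) * ?h (l @ u @ r))) x"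
    by (rule B.gpull_cong[OF w(3)]) (rule IH, use w in simp)
  then have "B.pull (L # W) f w * tsign \<tau> m w = eta \<sigma> \<tau> ?m W * (\<phi>' (lam (gdeg g) (wdeg l)) *
      B.gpull g (\<lambda>u. tsign \<tau> ?m (l @ u @ r) * ?h (l @ u @ r)) x * tsign \<tau> m (l @ x @ r))"
    by (simp add: L w B.pull_layer B.gpull_cmult)
  also note layer_change[OF w(3) g]
  finally show ?case
    by (simp add: L w A.pull_layer add.assoc)
qed

end

section \<open>Words of twists, merges and splits\<close>

definition twisty :: "nat \<Rightarrow> cob \<Rightarrow> bool" where
  "twisty n W \<longleftrightarrow> (\<forall>(a, g, b)\<in>set W. g = Twist \<and> n = a + 2 + b)"

lemma twisty_simps [simp]:
  "twisty n []" "twisty n ((a, g, b) # W) \<longleftrightarrow> g = Twist \<and> n = a + 2 + b \<and> twisty n W"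
  "twisty n (U @ W) \<longleftrightarrow> twisty n U \<and> twisty n W"
  by (fastforce simp: twisty_def)+

lemma twisty_typed: "twisty n W \<Longrightarrow> cob_typed n W n"
  by (induction W) auto

lemma twisty_elementary: "twisty n W \<Longrightarrow> elementary W"
  by (auto simp: twisty_def elementary_def)

lemma elementary_append: "elementary (U @ W) \<longleftrightarrow> elementary U \<and> elementary W"
  and elementary_Cons: "elementary ((a, g, b) # W) \<longleftrightarrow> g \<in> {Merge, Split, Twist} \<and> elementary W"
  unfolding elementary_def set_append ball_Un by auto

lemma twisty_merges: "twisty n W \<Longrightarrow> merges W = 0"
  by (induction W) auto

text \<open>Since the multisets agree, each next circle is found in the remaining list, so every
  block of twists stays within the available strands.\<close>

lemma twisty_reorder: "mset xs = mset ys \<Longrightarrow> twisty (a + length xs) (reorder a xs ys)"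
proof (induction a xs ys rule: reorder.induct)
  case (2 a xs y ys)
  have "y \<in> set xs" using 2(2) by (metis list.set_intros(1) set_mset_mset)
  then have d: "dropWhile (\<lambda>x. x \<noteq> y) xs \<noteq> []" by auto
  have "length (takeWhile (\<lambda>x. x \<noteq> y) xs) + length (dropWhile (\<lambda>x. x \<noteq> y) xs) = length xs"
    by (metis length_append takeWhile_dropWhile_id)
  then have len: "length xs = Suc (length (takeWhile (\<lambda>x. x \<noteq> y) xs) + length (tl (dropWhile (\<lambda>x. x \<noteq> y) xs)))"
    using d by (cases "dropWhile (\<lambda>x. x \<noteq> y) xs") auto
  have "mset (remove1 y xs) = mset ys" using 2(2) by (metis add_mset_remove_trivial mset.simps(2) mset_remove1)
  from 2(1)[OF this] \<open>y \<in> set xs\<close> have "twisty (a + length xs) (reorder (Suc a) (remove1 y xs) ys)"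
    using len by (simp add: length_remove1)
  moreover have "twisty (a + length xs) (pad a (strand_left (length (takeWhile (\<lambda>x. x \<noteq> y) xs)))
      (length (tl (dropWhile (\<lambda>x. x \<noteq> y) xs))))"
    unfolding len by (auto simp: twisty_def pad_def strand_left_def)
  ultimately show ?case by simp
qed simp

definition merge_word :: "nat \<Rightarrow> cob \<Rightarrow> bool" where
  "merge_word b S \<longleftrightarrow> (\<exists>U V. S = U @ (0, Merge, b) # V \<and> twisty (b + 2) U \<and> twisty (b + 1) V)"

definition split_word :: "nat \<Rightarrow> cob \<Rightarrow> bool" where
  "split_word b S \<longleftrightarrow> (\<exists>U V. S = U @ (0, Split, b) # V \<and> twisty (b + 1) U \<and> twisty (b + 2) V)"

lemma merge_word_props:
  assumes "merge_word b S"
  shows "elementary S" "cob_typed (b + 2) S (b + 1)" "merges S = 1"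
  using assms
  by (auto simp: merge_word_def cob_typed_append elementary_append twisty_merges twisty_elementary
      elementary_Cons dest: twisty_typed)

lemma split_word_props:
  assumes "split_word b S"
  shows "elementary S" "cob_typed (b + 1) S (b + 2)" "merges S = 0"
  using assms
  by (auto simp: split_word_def cob_typed_append elementary_append twisty_merges twisty_elementary
      elementary_Cons dest: twisty_typed)

lemma mset_eq_replicate: "mset v = mset (replicate n a) \<Longrightarrow> v = replicate n a"
  using mset_eq_length[of v] mset_eq_setD[of v] by (intro replicate_eqI) (fastforce simp del: mset_replicate)+

section \<open>Nonvanishing of composites of two saddles\<close>

context ground_hom
begin

definition even_hom :: bool where
  "even_hom \<longleftrightarrow> \<phi> KX = 1 \<and> \<phi> KY = 1 \<and> \<phi> KZ = 1"

lemma even_lam: "even_hom \<Longrightarrow> \<phi> (lam p q) = 1"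
  by (simp add: even_hom_def hom_lam spow_def)

lemma lam_sign: "\<phi> (lam p q) * \<phi> (lam p q) = 1"
  unfolding hom_lam by (intro sign_mult spow_sign hom_XX hom_YY hom_ZZ)

text \<open>A word of twists acts on basis words by a permutation of letters with signs; all signs
  are 1 in the even case.\<close>

lemma twisty_pull:
  assumes "twisty n W" "length w = n"
  obtains v s where "mset v = mset w" "s * s = 1" "even_hom \<Longrightarrow> s = 1" "\<And>f. pull W f w = s * f v"
  using assms
proof (induction W arbitrary: w thesis)
  case Nil
  show ?case by (rule Nil(1)[of w 1]) auto
next
  case (Cons L W)
  obtain a b where L: "L = (a, Twist, b)" "n = a + 2 + b" using Cons.prems by (cases L) auto
  obtain l x r where w: "w = l @ x @ r" "length l = a" "length x = 2" "length r = b"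
    using length_split3[of w a 2 b] Cons.prems(3) L(2) by blast
  obtain y z where x: "x = [y, z]" using w(3) by (auto simp: numeral_2_eq_2 length_Suc_conv)
  obtain v s where v: "mset v = mset (l @ [z, y] @ r)" "s * s = 1" "even_hom \<Longrightarrow> s = 1"
    "\<And>f. pull W f (l @ [z, y] @ r) = s * f v"
    using Cons.IH[of "l @ [z, y] @ r"] Cons.prems w L by auto
  show ?case
  proof (rule Cons.prems(1)[of v "\<phi> (lam (0, 0) (wdeg l)) * (\<phi> (lam (vdeg y) (vdeg z)) * s)"])
    show "pull (L # W) f w = \<phi> (lam (0, 0) (wdeg l)) * (\<phi> (lam (vdeg y) (vdeg z)) * s) * f v" for f
      using pull_layer[OF w(2), of x Twist b W f r] w v(4)[of f] x by (simp add: L)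
  qed (use v in \<open>auto simp: w x even_lam intro!: sign_mult lam_sign\<close>)
qed

text \<open>Signed permutations are onto: for a prescribed word above the twists there is an input
  word that is sent to it up to sign.\<close>

lemma twisty_pull_onto:
  assumes "twisty n W" "length v = n"
  obtains w s where "length w = n" "s * s = 1" "\<And>f. pull W f w = s * f v"
  using assms
proof (induction W arbitrary: thesis)
  case Nil
  show ?case by (rule Nil(1)[of v 1]) (use Nil in auto)
next
  case (Cons L W)
  obtain a b where L: "L = (a, Twist, b)" "n = a + 2 + b" using Cons.prems by (cases L) auto
  obtain w s where w: "length w = n" "s * s = 1" "\<And>f. pull W f w = s * f v"
    using Cons.IH Cons.prems L by auto
  obtain l x r where w': "w = l @ x @ r" "length l = a" "length x = 2" "length r = b"
    using length_split3[of w a 2 b] w(1) L(2) by blast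
  obtain y z where x: "x = [y, z]" using w'(3) by (auto simp: numeral_2_eq_2 length_Suc_conv)
  show ?case
  proof (rule Cons.prems(1)[of "l @ [z, y] @ r" "\<phi> (lam (0, 0) (wdeg l)) * (\<phi> (lam (vdeg z) (vdeg y)) * s)"])
    show "pull (L # W) f (l @ [z, y] @ r) = \<phi> (lam (0, 0) (wdeg l)) * (\<phi> (lam (vdeg z) (vdeg y)) * s) * f v" for f
      using pull_layer[OF w'(2), of "[z, y]" Twist b W f r] w' w(3)[of f] x by (simp add: L)
  qed (use w w' L in \<open>auto intro!: sign_mult lam_sign\<close>)
qed

text \<open>Constant words are fixed by every permutation of letters, so with them no permutation
  has to be tracked.\<close>

lemma twisty_pull_replicate:
  assumes "twisty n W"
  obtains s where "s * s = 1" "even_hom \<Longrightarrow> s = 1" "\<And>f. pull W f (replicate n a) = s * f (replicate n a)"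
proof -
  obtain v s where v: "mset v = mset (replicate n a)" "s * s = 1" "even_hom \<Longrightarrow> s = 1"
    "\<And>f. pull W f (replicate n a) = s * f v"
    by (rule twisty_pull[OF assms length_replicate]) (rule that)
  then have "v = replicate n a" by (intro mset_eq_replicate)
  with v show ?thesis by (intro that[of s]) auto
qed

lemma merge_word_plus:
  assumes "merge_word b S"
  obtains s where "s * s = 1" "\<And>f. pull S f (replicate (b + 2) Vplus) = s * f (replicate (b + 1) Vplus)"
proof -
  obtain U V where S: "S = U @ (0, Merge, b) # V" "twisty (b + 2) U" "twisty (b + 1) V"
    using assms by (auto simp: merge_word_def)
  obtain s where s: "s * s = 1" "\<And>f. pull U f (replicate (b + 2) Vplus) = s * f (replicate (b + 2) Vplus)"
    by (rule twisty_pull_replicate[OF S(2)]) (rule that)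
  obtain t where t: "t * t = 1" "\<And>f. pull V f (replicate (b + 1) Vplus) = t * f (replicate (b + 1) Vplus)"
    by (rule twisty_pull_replicate[OF S(3)]) (rule that)
  show ?thesis
  proof (rule that[of "s * t"])
    show "pull S f (replicate (b + 2) Vplus) = s * t * f (replicate (b + 1) Vplus)" for f
      using pull_layer[of "[]" 0 "[Vplus, Vplus]" Merge b V f "replicate b Vplus"] s(2)[of "pull ((0, Merge, b) # V) f"] t(2)[of f]
      by (simp add: S pull_append)
  qed (use s t in \<open>simp add: sign_mult\<close>)
qed

text \<open>The product of two v- is zero, so a word with one v+ is placed at the merge and then
  pulled back through the twists below it.\<close>

lemma merge_word_minus:
  assumes "merge_word b S"
  obtains w s where "length w = b + 2" "s * s = 1" "\<And>f. pull S f w = s * f (replicate (b + 1) Vminus)"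
proof -
  obtain U V where S: "S = U @ (0, Merge, b) # V" "twisty (b + 2) U" "twisty (b + 1) V"
    using assms by (auto simp: merge_word_def)
  obtain w s where s: "length w = b + 2" "s * s = 1" "\<And>f. pull U f w = s * f (Vplus # replicate (b + 1) Vminus)"
    by (rule twisty_pull_onto[OF S(2), of "Vplus # replicate (b + 1) Vminus"]) auto
  obtain t where t: "t * t = 1" "\<And>f. pull V f (replicate (b + 1) Vminus) = t * f (replicate (b + 1) Vminus)"
    by (rule twisty_pull_replicate[OF S(3)]) (rule that)
  show ?thesis
  proof (rule that[of w "s * t"])
    show "pull S f w = s * t * f (replicate (b + 1) Vminus)" for f
      using pull_layer[of "[]" 0 "[Vplus, Vminus]" Merge b V f "replicate b Vminus"] s(3)[of "pull ((0, Merge, b) # V) f"] t(2)[of f]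
      by (simp add: S pull_append)
  qed (use s t in \<open>simp_all add: sign_mult\<close>)
qed

lemma split_word_minus:
  assumes "split_word b S"
  obtains s where "s * s = 1" "\<And>f. pull S f (replicate (b + 1) Vminus) = s * f (replicate (b + 2) Vminus)"
proof -
  obtain U V where S: "S = U @ (0, Split, b) # V" "twisty (b + 1) U" "twisty (b + 2) V"
    using assms by (auto simp: split_word_def)
  obtain s where s: "s * s = 1" "\<And>f. pull U f (replicate (b + 1) Vminus) = s * f (replicate (b + 1) Vminus)"
    by (rule twisty_pull_replicate[OF S(2)]) (rule that)
  obtain t where t: "t * t = 1" "\<And>f. pull V f (replicate (b + 2) Vminus) = t * f (replicate (b + 2) Vminus)"
    by (rule twisty_pull_replicate[OF S(3)]) (rule that)
  show ?thesis
  proof (rule that[of "s * t"])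
    show "pull S f (replicate (b + 1) Vminus) = s * t * f (replicate (b + 2) Vminus)" for f
      using pull_layer[of "[]" 0 "[Vminus]" Split b V f "replicate b Vminus"] s(2)[of "pull ((0, Split, b) # V) f"] t(2)[of f]
      by (simp add: S pull_append)
  qed (use s t in \<open>simp add: sign_mult\<close>)
qed

text \<open>Before a split the first merge is made to produce only letters v-, which the split
  preserves; two consecutive merges preserve words of v+.\<close>

lemma merge_first_nonzero:
  assumes "merge_word b S" "split_word b S' \<or> (\<exists>c. b = Suc c \<and> merge_word c S')"
  shows "\<exists>w. length w = b + 2 \<and> pull (S @ S') (\<lambda>_. 1) w \<noteq> 0"
proof (cases "split_word b S'")
  case True
  obtain w s where w: "length w = b + 2" "s * s = 1" "\<And>f. pull S f w = s * f (replicate (b + 1) Vminus)"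
    by (rule merge_word_minus[OF assms(1)]; rule that)
  obtain t where t: "t * t = 1" "\<And>f. pull S' f (replicate (b + 1) Vminus) = t * f (replicate (b + 2) Vminus)"
    by (rule split_word_minus[OF True]; rule that)
  have "pull (S @ S') (\<lambda>_. 1) w = s * t" by (simp only: pull_append w(3) t(2) mult.right_neutral)
  then show ?thesis using w t by (intro exI[of _ w]) auto
next
  case False
  then obtain c where c: "b = Suc c" "merge_word c S'" using assms(2) by blast
  obtain s where s: "s * s = 1" "\<And>f. pull S f (replicate (b + 2) Vplus) = s * f (replicate (b + 1) Vplus)"
    by (rule merge_word_plus[OF assms(1)]; rule that)
  obtain t where t: "t * t = 1" "\<And>f. pull S' f (replicate (b + 1) Vplus) = t * f (replicate b Vplus)"
    using merge_word_plus[OF c(2)] c(1) by auto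
  have "pull (S @ S') (\<lambda>_. 1) (replicate (b + 2) Vplus) = s * t" by (simp only: pull_append s(2) t(2) mult.right_neutral)
  then show ?thesis using s t by (intro exI[of _ "replicate (b + 2) Vplus"]) auto
qed

lemma split_split_nonzero:
  assumes "split_word b S" "split_word (Suc b) S'"
  shows "\<exists>w. length w = b + 1 \<and> pull (S @ S') (\<lambda>_. 1) w \<noteq> 0"
proof -
  obtain s where s: "s * s = 1" "\<And>f. pull S f (replicate (b + 1) Vminus) = s * f (replicate (b + 2) Vminus)"
    by (rule split_word_minus[OF assms(1)]; rule that)
  obtain t where t: "t * t = 1" "\<And>f. pull S' f (replicate (b + 2) Vminus) = t * f (replicate (Suc b + 2) Vminus)"
    using split_word_minus[OF assms(2)] by auto
  have "pull (S @ S') (\<lambda>_. 1) (replicate (b + 1) Vminus) = s * t" by (simp only: pull_append s(2) t(2) mult.right_neutral)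
  then show ?thesis using s t by (intro exI[of _ "replicate (b + 1) Vminus"]) auto
qed

text \<open>With a single v- in the word, the two letters at the merge are never both v-, so the
  product is one basis word, with coefficient 1 in the even case.\<close>

lemma merge_word_even:
  assumes "merge_word b S" "even_hom" "mset u = mset (Vminus # replicate (b + 1) Vplus)"
  shows "pull S (\<lambda>_. 1) u = 1"
proof -
  obtain U V where S: "S = U @ (0, Merge, b) # V" "twisty (b + 2) U" "twisty (b + 1) V"
    using assms(1) by (auto simp: merge_word_def)
  have V: "pull V (\<lambda>_. 1) x = 1" if "length x = b + 1" for x
    by (rule twisty_pull[OF S(3) that]) (use assms(2) in simp)
  have "length u = b + 2" using assms(3) mset_eq_length by fastforce
  then obtain v where v: "mset v = mset u" "\<And>f. pull U f u = f v"
    by (rule twisty_pull[OF S(2)]) (use assms(2) in auto)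
  have "length v = b + 2" using v(1) \<open>length u = b + 2\<close> mset_eq_length by fastforce
  then obtain y z r where r: "v = [y, z] @ r" "length r = b" by (auto simp: length_Suc_conv)
  have "count (mset v) Vminus = 1" unfolding v(1) assms(3) by simp
  then have "(y = Vplus \<and> z = Vplus) \<or> (y = Vplus \<and> z = Vminus) \<or> (y = Vminus \<and> z = Vplus)"
    by (cases y; cases z) (auto simp: r)
  then show ?thesis
    using pull_layer[of "[]" 0 "[y, z]" Merge b V "\<lambda>_. 1" r] assms(2) r
    by (elim disjE) (simp_all add: S pull_append v(2) V even_hom_def)
qed

text \<open>The split of v+ gives two words with exactly one v- each, and both survive the merge
  with coefficient 1. The value is 1 + 1 = 2; with other signs the two terms may cancel, hence the
  restriction to \<open>even_hom\<close>.\<close>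

lemma split_merge_even_nonzero:
  assumes "split_word b S" "merge_word b S'" "even_hom"
  shows "\<exists>w. length w = b + 1 \<and> pull (S @ S') (\<lambda>_. 1) w \<noteq> 0"
proof -
  obtain U V where S: "S = U @ (0, Split, b) # V" "twisty (b + 1) U" "twisty (b + 2) V"
    using assms by (auto simp: split_word_def)
  obtain s where s: "s * s = 1" "even_hom \<Longrightarrow> s = 1"
    "\<And>f. pull U f (replicate (b + 1) Vplus) = s * f (replicate (b + 1) Vplus)"
    by (rule twisty_pull_replicate[OF S(2)]) (rule that)
  have V: "pull V (pull S' (\<lambda>_. 1)) x = 1" if "mset x = mset (Vminus # replicate (b + 1) Vplus)" for x
  proof -
    have "length x = b + 2" using that mset_eq_length by fastforce
    then obtain v where v: "mset v = mset x" "\<And>f. pull V f x = f v"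
      by (rule twisty_pull[OF S(3)]) (use assms(3) in auto)
    show ?thesis unfolding v(2) by (rule merge_word_even) (use assms v that in auto)
  qed
  have "pull (S @ S') (\<lambda>_. 1) (replicate (b + 1) Vplus) = 2"
    using pull_layer[of "[]" 0 "[Vplus]" Split b V "pull S' (\<lambda>_. 1)" "replicate b Vplus"] s(2,3) assms(3)
    by (simp add: S pull_append V even_hom_def pull_append[of "(0, Split, b) # V" S', unfolded append_Cons])
  then show ?thesis by (intro exI[of _ "replicate (b + 1) Vplus"]) auto
qed

end

section \<open>Planarity and source-sink orientations\<close>

text \<open>Rank and nullity in counting form: all nonempty fibres are translates of the
  kernel.\<close>

lemma card_kernel_image:
  fixes h :: "'a::ab_group_add \<Rightarrow> 'b::ab_group_add"
  assumes fin: "finite A" and diff: "\<And>x y. x \<in> A \<Longrightarrow> y \<in> A \<Longrightarrow> x - y \<in> A"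
    and add: "\<And>x y. x \<in> A \<Longrightarrow> y \<in> A \<Longrightarrow> x + y \<in> A"
    and h: "\<And>x y. x \<in> A \<Longrightarrow> y \<in> A \<Longrightarrow> h (x + y) = h x + h y"
  shows "card A = card {x \<in> A. h x = 0} * card (h ` A)"
proof -
  have fib: "card {x \<in> A. h x = b} = card {x \<in> A. h x = 0}" if b: "b \<in> h ` A" for b
  proof -
    obtain a where a: "a \<in> A" "h a = b" using b by auto
    have "h (x - a) = h x - h a" if "x \<in> A" for x
      using h[of "x - a" a] diff[OF that a(1)] a(1) by simp
    then have "bij_betw (\<lambda>x. x + a) {x \<in> A. h x = 0} {x \<in> A. h x = b}"
      by (intro bij_betw_byWitness[where f' = "\<lambda>x. x - a"]) (use a add diff h in auto)
    then show ?thesis by (simp add: bij_betw_same_card)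
  qed
  have "card A = (\<Sum>b\<in>h ` A. card {x \<in> A. h x = b})"
    using fin by (subst card_UN_disjoint[symmetric]) (auto intro: arg_cong[where f = card])
  then show ?thesis by (simp add: fib)
qed

section \<open>Classes of a relation and functions modulo 2 on them\<close>

lemma gen_class_refl: "d \<in> gen_class R d"
  by (simp add: gen_class_def)

lemma gen_class_eq: "e \<in> gen_class R d \<Longrightarrow> gen_class R e = gen_class R d"
proof -
  assume "e \<in> gen_class R d"
  then have "(d, e) \<in> (R \<union> R\<inverse>)\<^sup>*" by (simp add: gen_class_def)
  moreover have "sym ((R \<union> R\<inverse>)\<^sup>*)" by (intro sym_rtrancl sym_Un_converse)
  ultimately show ?thesis unfolding gen_class_def by (auto dest: symD intro: rtrancl_trans)
qed

lemma gen_class_disjoint: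
  assumes "K \<in> gen_class R ` X" "L \<in> gen_class R ` X" "d \<in> K" "d \<in> L"
  shows "K = L"
proof -
  obtain x y where "K = gen_class R x" "L = gen_class R y" using assms by auto
  with assms(3,4) show ?thesis using gen_class_eq[of d R x] gen_class_eq[of d R y] by simp
qed

lemma gen_class_step: "(d, e) \<in> R \<Longrightarrow> gen_class R d = gen_class R e"
  by (rule gen_class_eq[symmetric]) (auto simp: gen_class_def)

lemma gen_class_subset: "R \<subseteq> X \<times> X \<Longrightarrow> d \<in> X \<Longrightarrow> gen_class R d \<subseteq> X"
proof
  fix e assume "R \<subseteq> X \<times> X" "d \<in> X" "e \<in> gen_class R d"
  then have "(d, e) \<in> (R \<union> R\<inverse>)\<^sup>*" by (simp add: gen_class_def)
  then show "e \<in> X" by (induction rule: rtrancl_induct) (use \<open>R \<subseteq> X \<times> X\<close> \<open>d \<in> X\<close> in auto)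
qed

lemma gen_class_invariant:
  assumes "\<And>x y. (x, y) \<in> R \<Longrightarrow> f x = f y" "e \<in> gen_class R d"
  shows "f e = f d"
proof -
  have "(d, e) \<in> (R \<union> R\<inverse>)\<^sup>*" using assms(2) by (simp add: gen_class_def)
  then show ?thesis by (induction rule: rtrancl_induct) (use assms(1) in force)+
qed

text \<open>The vector space over the two-element field of functions on the classes of
  \<open>R\<close>. Vanishing off \<open>X\<close> makes the values outside unambiguous, so that
  functions can be counted.\<close>

definition cochains :: "'d set \<Rightarrow> ('d \<times> 'd) set \<Rightarrow> ('d \<Rightarrow> bit) set" where
  "cochains X R = {f. (\<forall>d. d \<notin> X \<longrightarrow> f d = 0) \<and> (\<forall>(d, e)\<in>R. f d = f e)}"

lemma cochainsD: "f \<in> cochains X R \<Longrightarrow> (d, e) \<in> R \<Longrightarrow> f e = f d"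
  by (auto simp: cochains_def)

lemma cochainsI:
  "(\<And>d. d \<notin> X \<Longrightarrow> f d = 0) \<Longrightarrow> (\<And>d e. (d, e) \<in> R \<Longrightarrow> f e = f d) \<Longrightarrow> f \<in> cochains X R"
  by (auto simp: cochains_def)

lemma cochains_outside: "f \<in> cochains X R \<Longrightarrow> d \<notin> X \<Longrightarrow> f d = 0"
  by (simp add: cochains_def)

text \<open>Such a function amounts to the set of classes on which it is 1, and every set of classes
  occurs.\<close>

lemma card_cochains:
  assumes "finite X" "R \<subseteq> X \<times> X"
  shows "finite (cochains X R)" "card (cochains X R) = 2 ^ card (gen_class R ` X)"
proof -
  let ?P = "gen_class R ` X"
  let ?w = "\<lambda>Q d. if d \<in> \<Union>Q then (1::bit) else 0"
  have bij: "bij_betw (\<lambda>f. {K \<in> ?P. \<exists>d\<in>K. f d = 1}) (cochains X R) (Pow ?P)"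
  proof (rule bij_betw_byWitness[where f' = ?w])
    show "\<forall>f\<in>cochains X R. ?w {K \<in> ?P. \<exists>d\<in>K. f d = 1} = f"
    proof (intro ballI ext)
      fix f d assume f: "f \<in> cochains X R"
      have inv: "f e' = f e" if "e' \<in> gen_class R e" for e e'
        by (rule gen_class_invariant[OF _ that]) (use f in \<open>auto simp: cochains_def\<close>)
      have "d \<in> \<Union>{K \<in> ?P. \<exists>d\<in>K. f d = 1} \<longleftrightarrow> f d = 1"
      proof
        assume "f d = 1"
        then have "d \<in> X" using f by (cases "d \<in> X") (auto simp: cochains_def)
        with \<open>f d = 1\<close> show "d \<in> \<Union>{K \<in> ?P. \<exists>d\<in>K. f d = 1}"
          using gen_class_refl by fastforce
      qed (use inv in force)
      then show "?w {K \<in> ?P. \<exists>d\<in>K. f d = 1} d = f d" by (cases "f d") auto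
    qed
    show "\<forall>Q\<in>Pow ?P. {K \<in> ?P. \<exists>d\<in>K. ?w Q d = 1} = Q"
    proof
      fix Q assume Q: "Q \<in> Pow ?P"
      have disj: "K = L" if "K \<in> ?P" "L \<in> ?P" "d \<in> K" "d \<in> L" for K L d
        by (rule gen_class_disjoint[OF that])
      have ne: "\<exists>d. d \<in> K" if "K \<in> ?P" for K using that gen_class_refl by fastforce
      have "(\<exists>d\<in>K. ?w Q d = 1) \<longleftrightarrow> K \<in> Q" if K: "K \<in> ?P" for K
      proof
        assume "\<exists>d\<in>K. ?w Q d = 1"
        then obtain d L where "d \<in> K" "L \<in> Q" "d \<in> L" by (auto split: if_splits)
        then show "K \<in> Q" using disj[OF K, of L d] Q by blast
      next
        assume "K \<in> Q"
        then show "\<exists>d\<in>K. ?w Q d = 1" using ne[OF K] by auto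
      qed
      then show "{K \<in> ?P. \<exists>d\<in>K. ?w Q d = 1} = Q" using Q by blast
    qed
    show "(\<lambda>f. {K \<in> ?P. \<exists>d\<in>K. f d = 1}) ` cochains X R \<subseteq> Pow ?P" by auto
    show "?w ` Pow ?P \<subseteq> cochains X R"
    proof
      fix f assume "f \<in> ?w ` Pow ?P"
      then obtain Q where Q: "Q \<subseteq> ?P" "f = ?w Q" by auto
      have cls: "K = gen_class R d" if "K \<in> Q" "d \<in> K" for K d
      proof -
        obtain x where "K = gen_class R x" using Q(1) \<open>K \<in> Q\<close> by blast
        then show ?thesis using gen_class_eq[of d R x] \<open>d \<in> K\<close> by simp
      qed
      have a: "d \<in> \<Union>Q \<longleftrightarrow> e \<in> \<Union>Q" if de: "(d, e) \<in> R" for d e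
        using cls gen_class_step[OF de] gen_class_refl[of d R] gen_class_refl[of e R] by (metis UnionE UnionI)
      have "\<Union>Q \<subseteq> X" using Q(1) gen_class_subset[OF assms(2)] by blast
      then have b: "d \<notin> \<Union>Q" if "d \<notin> X" for d using that by blast
      show "f \<in> cochains X R"
        unfolding cochains_def Q(2) using a b by (auto simp del: Union_iff)
    qed
  qed
  then show "finite (cochains X R)" using assms(1) by (simp add: bij_betw_finite)
  show "card (cochains X R) = 2 ^ card ?P"
    using bij_betw_same_card[OF bij] assms(1) by (simp add: card_Pow)
qed

lemma bit_add_self [simp]: "(b::bit) + b = 0"
  by (cases b) auto

lemma bit_fun_add_self: "(h :: 'a \<Rightarrow> bit) + h = 0"
  by (rule ext) simp

lemma cochains_add: "f \<in> cochains X R \<Longrightarrow> g \<in> cochains X R \<Longrightarrow> f + g \<in> cochains X R"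
  by (auto simp: cochains_def)

lemma cochains_diff: "f \<in> cochains X R \<Longrightarrow> g \<in> cochains X R \<Longrightarrow> f - g \<in> cochains X R"
  by (auto simp: cochains_def)

lemma rot_simps: "rot (c, 0) = (c, 1)" "rot (c, Suc 0) = (c, 2)" "rot (c, 2) = (c, 3)" "rot (c, 3) = (c, 0)"
  by (simp_all add: rot_def)

section \<open>Counting cochains on a planar diagram\<close>

locale planar_diagram =
  fixes D :: diagram
  assumes link: "link_diagram D"
begin

lemma glue: "d \<in> darts D \<Longrightarrow> glue D d \<in> darts D" "d \<in> darts D \<Longrightarrow> glue D d \<noteq> d"
  "d \<in> darts D \<Longrightarrow> glue D (glue D d) = d"
  using link by (auto simp: link_diagram_def)

lemma darts_cases:
  assumes "d \<in> darts D"
  obtains c where "c < ncross D" "d = (c, 0) \<or> d = (c, 1) \<or> d = (c, 2) \<or> d = (c, 3)"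
proof -
  obtain c s where "d = (c, s)" "c < ncross D" "s < 4" using assms by (auto simp: darts_def)
  moreover from \<open>s < 4\<close> have "s = 0 \<or> s = 1 \<or> s = 2 \<or> s = 3" by linarith
  ultimately show ?thesis using that by blast
qed

lemma finite_darts: "finite (darts D)"
  by (simp add: darts_def)

lemma rot_darts: "d \<in> darts D \<Longrightarrow> rot d \<in> darts D"
  by (auto simp: darts_def rot_def)

definition rot_rel :: "(dart \<times> dart) set" where
  "rot_rel = {(d, rot d) | d. d \<in> darts D}"

definition face_rel :: "(dart \<times> dart) set" where
  "face_rel = {(d, rot (glue D d)) | d. d \<in> darts D}"

abbreviation "comps \<equiv> map_components D"
abbreviation "edge_cochains \<equiv> cochains (darts D) (glue_rel D)"
abbreviation "face_cochains \<equiv> cochains (darts D) face_rel"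

lemma rels: "glue_rel D \<subseteq> darts D \<times> darts D" "rot_rel \<subseteq> darts D \<times> darts D"
  "face_rel \<subseteq> darts D \<times> darts D"
  unfolding glue_rel_def rot_rel_def face_rel_def by (blast intro: glue rot_darts)+

lemma rel_iff:
  "(d, e) \<in> glue_rel D \<longleftrightarrow> d \<in> darts D \<and> e = glue D d"
  "(d, e) \<in> rot_rel \<longleftrightarrow> d \<in> darts D \<and> e = rot d"
  "(d, e) \<in> face_rel \<longleftrightarrow> d \<in> darts D \<and> e = rot (glue D d)"
  unfolding glue_rel_def rot_rel_def face_rel_def by blast+

lemma face_cochainsD: "f \<in> face_cochains \<Longrightarrow> d \<in> darts D \<Longrightarrow> f (rot (glue D d)) = f d"
  by (rule cochainsD[of f "darts D" face_rel]) (simp_all add: rel_iff)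

text \<open>The gluing is an involution without fixed points, so the 4n darts fall into classes of
  size two.\<close>

lemma card_edges: "card (gen_class (glue_rel D) ` darts D) = 2 * ncross D"
proof -
  let ?P = "gen_class (glue_rel D) ` darts D"
  have cl: "gen_class (glue_rel D) d = {d, glue D d}" if "d \<in> darts D" for d
  proof
    show "gen_class (glue_rel D) d \<subseteq> {d, glue D d}"
    proof
      fix e assume "e \<in> gen_class (glue_rel D) d"
      then have "{e, glue D e} = {d, glue D d}"
        by (rule gen_class_invariant[rotated]) (simp add: rel_iff glue(3) insert_commute split: prod.splits)
      then show "e \<in> {d, glue D d}" by (metis insertI1)
    qed
    show "{d, glue D d} \<subseteq> gen_class (glue_rel D) d"
      using that gen_class_step[of d "glue D d" "glue_rel D"] gen_class_refl[of "glue D d" "glue_rel D"] gen_class_refl[of d "glue_rel D"]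
      by (simp add: rel_iff)
  qed
  have union: "\<Union>?P = darts D" using cl glue by auto
  have "2 * card ?P = card (\<Union>?P)"
  proof (rule card_partition)
    show "card K = 2" if K: "K \<in> ?P" for K
    proof -
      obtain d where "d \<in> darts D" "K = {d, glue D d}" using K cl by auto
      then show ?thesis by (metis card_2_iff glue(2))
    qed
    show "K \<inter> L = {}" if "K \<in> ?P" "L \<in> ?P" "K \<noteq> L" for K L
      using gen_class_disjoint[OF that(1,2)] that(3) by blast
    show "finite (\<Union>?P)" unfolding union by (rule finite_darts)
  qed (use finite_darts in simp)
  with union have "2 * card ?P = card (darts D)" by simp
  then show ?thesis by (simp add: darts_def)
qed

text \<open>Cochains of the dual cell structure: a function constant on faces has as coboundary the edges
  separating two values, and \<open>vertex_sum\<close> is the sum around a crossing.\<close>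

definition dual_cobound :: "(dart \<Rightarrow> bit) \<Rightarrow> dart \<Rightarrow> bit" where
  "dual_cobound f = (\<lambda>d. if d \<in> darts D then f d + f (glue D d) else 0)"

definition vertex_sum :: "(dart \<Rightarrow> bit) \<Rightarrow> nat \<Rightarrow> bit" where
  "vertex_sum f = (\<lambda>c. if c < ncross D then f (c, 0) + f (c, 1) + f (c, 2) + f (c, 3) else 0)"

lemma dual_cobound_add: "dual_cobound (f + g) = dual_cobound f + dual_cobound g"
  by (rule ext) (simp only: dual_cobound_def plus_fun_apply add.commute add.left_commute
    add_0_right split: if_split, simp)

lemma vertex_sum_add: "vertex_sum (f + g) = vertex_sum f + vertex_sum g"
  by (rule ext) (simp only: vertex_sum_def plus_fun_apply add.commute add.left_commute add.assoc
    add_0_right split: if_split, simp)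

text \<open>The kernel of the coboundary consists of the functions constant on whole components of
  the diagram; the count is then \<open>card_kernel_image\<close>.\<close>

lemma card_dual_cobound: "2 ^ card comps * card (dual_cobound ` face_cochains) = 2 ^ card (map_faces D)"
proof -
  have "{f \<in> face_cochains. dual_cobound f = 0} = cochains (darts D) (glue_rel D \<union> rot_rel)"
  proof (intro equalityI subsetI)
    fix f assume f: "f \<in> {f \<in> face_cochains. dual_cobound f = 0}"
    have 1: "f (glue D d) = f d" if "d \<in> darts D" for d
    proof -
      have "dual_cobound f d = 0" using f by simp
      then show ?thesis using that by (cases "f d"; cases "f (glue D d)") (auto simp: dual_cobound_def)
    qed
    have "f (rot (glue D d)) = f d" if "d \<in> darts D" for d using f that face_cochainsD by auto
    then have "f (rot d) = f d" if "d \<in> darts D" for d using 1 that glue by metis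
    moreover have "f e = 0" if "e \<notin> darts D" for e
      by (rule cochains_outside[of f _ face_rel]) (use f that in auto)
    ultimately show "f \<in> cochains (darts D) (glue_rel D \<union> rot_rel)"
      using 1 by (intro cochainsI) (auto simp: rel_iff)
  next
    fix f assume "f \<in> cochains (darts D) (glue_rel D \<union> rot_rel)"
    then have f: "f (glue D d) = f d" "f (rot d) = f d" if "d \<in> darts D" for d
      using that by (auto intro!: cochainsD[of f "darts D" "glue_rel D \<union> rot_rel" d] simp: rel_iff)
    have "f e = 0" if "e \<notin> darts D" for e
      using \<open>f \<in> cochains _ _\<close> that by (rule cochains_outside)
    then have "f \<in> face_cochains"
      by (rule cochainsI) (use f glue(1) in \<open>auto simp: rel_iff\<close>)
    then show "f \<in> {f \<in> face_cochains. dual_cobound f = 0}"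
      using f by (auto simp: dual_cobound_def fun_eq_iff)
  qed
  then have "card {f \<in> face_cochains. dual_cobound f = 0} = 2 ^ card comps"
    using card_cochains(2)[OF finite_darts, of "glue_rel D \<union> rot_rel"] rels by (simp add: map_components_def rot_rel_def)
  moreover have "card face_cochains = 2 ^ card (map_faces D)"
    using card_cochains(2)[OF finite_darts rels(3)] by (simp add: map_faces_def face_rel_def)
  ultimately show ?thesis
    using card_kernel_image[of face_cochains dual_cobound] card_cochains(1)[OF finite_darts rels(3)]
      cochains_add cochains_diff dual_cobound_add by metis
qed

text \<open>The two sides of an edge at a crossing lie in the faces of consecutive slots. Around the
  crossing each of these values is therefore added twice.\<close>

lemma dual_cobound_cocycle: "dual_cobound ` face_cochains \<subseteq> {f \<in> edge_cochains. vertex_sum f = 0}"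
proof
  fix g assume "g \<in> dual_cobound ` face_cochains"
  then obtain f where f: "f \<in> face_cochains" "g = dual_cobound f" by auto
  have "f (rot (glue D d)) = f d" if "d \<in> darts D" for d using f that face_cochainsD by auto
  then have rot: "f (glue D d) = f (rot d)" if "d \<in> darts D" for d using that glue by metis
  have "g \<in> edge_cochains"
    using glue f by (auto simp: cochains_def glue_rel_def dual_cobound_def add.commute)
  moreover have "vertex_sum g = 0"
    by (auto simp: fun_eq_iff vertex_sum_def f(2) dual_cobound_def darts_def rot rot_simps
      add.commute add.left_commute)
  ultimately show "g \<in> {f \<in> edge_cochains. vertex_sum f = 0}" by simp
qed

definition point :: "'a \<Rightarrow> 'a \<Rightarrow> bit" where
  "point x = (\<lambda>y. if y = x then 1 else 0)"

lemma vertex_sum_zero: "vertex_sum 0 = 0"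
  by (simp add: vertex_sum_def fun_eq_iff)

lemma zero_cochain: "0 \<in> edge_cochains"
  by (simp add: cochains_def)

lemma vertex_sum_point: "d \<in> darts D \<Longrightarrow> vertex_sum (point d) = point (fst d)"
  by (erule darts_cases) (auto simp: vertex_sum_def point_def fun_eq_iff)

text \<open>A path of darts joins the two crossings; the edges along it, added modulo 2, contribute
  at its ends only.\<close>

lemma connecting_cochain:
  assumes "d \<in> darts D" "e \<in> gen_class (glue_rel D \<union> rot_rel) d"
  shows "\<exists>f\<in>edge_cochains. vertex_sum f = point (fst d) + point (fst e)"
proof -
  have "(d, e) \<in> ((glue_rel D \<union> rot_rel) \<union> (glue_rel D \<union> rot_rel)\<inverse>)\<^sup>*"
    using assms(2) by (simp add: gen_class_def)
  then show ?thesis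
  proof (induction rule: rtrancl_induct)
    case base
    show ?case by (rule bexI[OF _ zero_cochain]) (simp only: vertex_sum_zero bit_fun_add_self)
  next
    case (step x y)
    obtain f where f: "f \<in> edge_cochains" "vertex_sum f = point (fst d) + point (fst x)"
      using step.IH by blast
    consider "x \<in> darts D" "y = glue D x" | "fst y = fst x"
      using step.hyps(2) glue(1,3)[of y] by (auto simp: rel_iff rot_def)
    then show ?case
    proof cases
      case 1
      \<comment> \<open>The indicator of the edge with darts \<open>x\<close> and \<open>y\<close>;
        turning around a crossing, the other kind of step, adds nothing.\<close>
      let ?g = "point x + point y"
      have y: "y \<in> darts D" using 1 glue(1) by simp
      have "?g \<in> edge_cochains"
      proof (rule cochainsI)
        fix d e assume "(d, e) \<in> glue_rel D"
        then have d: "d \<in> darts D" "e = glue D d" by (simp_all add: rel_iff)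
        have "e = x \<longleftrightarrow> d = y" "e = y \<longleftrightarrow> d = x" using d 1 y glue(3) by metis+
        then show "?g e = ?g d" by (simp add: point_def add.commute)
      qed (use 1 y in \<open>auto simp: point_def\<close>)
      moreover have "vertex_sum ?g = point (fst x) + point (fst y)"
        by (simp only: vertex_sum_add vertex_sum_point 1(1) y)
      then have "vertex_sum (f + ?g) =
          point (fst d) + ((point (fst x) + point (fst x)) + point (fst y))"
        by (simp only: vertex_sum_add f(2) add.assoc)
      then have "vertex_sum (f + ?g) = point (fst d) + point (fst y)"
        by (simp only: bit_fun_add_self add_0_left)
      ultimately show ?thesis using f(1) cochains_add by blast
    next
      case 2
      show ?thesis using f unfolding 2 by blast
    qed
  qed
qed

text \<open>One crossing is chosen as the root of each component, and every crossing is connected to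
  the root of its own component.\<close>

lemma comps_roots:
  obtains r where "inj_on r comps" "r ` comps \<subseteq> {..<ncross D}"
    "\<And>c. c < ncross D \<Longrightarrow> \<exists>f\<in>edge_cochains. \<exists>K\<in>comps. vertex_sum f = point c + point (r K)"
proof -
  let ?R = "glue_rel D \<union> rot_rel"
  have R: "?R \<subseteq> darts D \<times> darts D" using rels by blast
  define r where "r K = fst (SOME d. d \<in> K)" for K :: "dart set"
  have pick: "(SOME d. d \<in> K) \<in> K \<and> (SOME d. d \<in> K) \<in> darts D" if K: "K \<in> comps" for K
  proof -
    obtain d where d: "d \<in> darts D" "K = gen_class ?R d" using K by (auto simp: map_components_def rot_rel_def)
    then have "(SOME d. d \<in> K) \<in> K" using someI[of "\<lambda>d. d \<in> K" d] gen_class_refl[of d ?R] by blast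
    then show ?thesis using gen_class_subset[OF R d(1)] d by auto
  qed
  have same: "gen_class ?R (c, s) = gen_class ?R (c, 0)" if "(c, s) \<in> darts D" for c s
  proof -
    have st: "gen_class ?R d = gen_class ?R (rot d)" if "d \<in> darts D" for d
      by (rule gen_class_step) (use that in \<open>simp add: rel_iff\<close>)
    have "c < ncross D" using that by (auto simp: darts_def)
    then have dd: "(c, 0) \<in> darts D" "(c, 1) \<in> darts D" "(c, 2) \<in> darts D" by (auto simp: darts_def)
    show ?thesis
      using that by (rule darts_cases) (use st[OF dd(1)] st[OF dd(2)] st[OF dd(3)] in \<open>auto simp: rot_simps\<close>)
  qed
  have cls: "gen_class ?R (r K, 0) = K" if K: "K \<in> comps" for K
  proof -
    obtain d where d: "d \<in> darts D" "K = gen_class ?R d" using K by (auto simp: map_components_def rot_rel_def)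
    have p: "(SOME d. d \<in> K) \<in> K" "(SOME d. d \<in> K) \<in> darts D" using pick[OF K] by auto
    then have "gen_class ?R (r K, 0) = gen_class ?R (SOME d. d \<in> K)"
      using same[of "r K" "snd (SOME d. d \<in> K)"] by (simp add: r_def)
    then show ?thesis using p(1) gen_class_eq d(2) by metis
  qed
  show ?thesis
  proof (rule that)
    show "inj_on r comps" by (rule inj_onI) (metis cls)
    show "r ` comps \<subseteq> {..<ncross D}" using pick by (fastforce simp: r_def darts_def)
    fix c assume "c < ncross D"
    then have d: "(c, 0) \<in> darts D" by (auto simp: darts_def)
    let ?K = "gen_class ?R (c, 0)"
    have K: "?K \<in> comps" using d by (auto simp: map_components_def rot_rel_def)
    have "(r ?K, 0) \<in> ?K" using cls[OF K] gen_class_refl by metis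
    then show "\<exists>f\<in>edge_cochains. \<exists>K\<in>comps. vertex_sum f = point c + point (r K)"
      using connecting_cochain[OF d] K by fastforce
  qed
qed

lemma finite_comps: "finite comps"
  by (simp add: map_components_def finite_darts)

lemma card_comps_le: "card comps \<le> ncross D"
  by (rule comps_roots) (metis card_inj_on_le card_lessThan finite_lessThan)

text \<open>The values of \<open>vertex_sum\<close> at the crossings other than the roots can be
  prescribed freely, which bounds its rank from below.\<close>

lemma card_vertex_sum: "2 ^ (ncross D - card comps) \<le> card (vertex_sum ` edge_cochains)"
proof -
  obtain r where r: "inj_on r comps" "r ` comps \<subseteq> {..<ncross D}"
    "\<And>c. c < ncross D \<Longrightarrow> \<exists>f\<in>edge_cochains. \<exists>K\<in>comps. vertex_sum f = point c + point (r K)"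
    by (rule comps_roots; rule that)
  let ?U = "{..<ncross D} - r ` comps"
  have surj: "\<exists>f\<in>edge_cochains. {c \<in> ?U. vertex_sum f c = 1} = Q" if "Q \<subseteq> ?U" for Q
  proof -
    have "finite Q" using that finite_subset by blast
    then show ?thesis using that
    proof (induction Q rule: finite_induct)
      case empty
      have "{c \<in> ?U. vertex_sum 0 c = 1} = {}" unfolding vertex_sum_zero by simp
      then show ?case by (rule bexI[OF _ zero_cochain])
    next
      case (insert c Q)
      obtain f where f: "f \<in> edge_cochains" "{c \<in> ?U. vertex_sum f c = 1} = Q" using insert by auto
      \<comment> \<open>The roots lie outside \<open>?U\<close>, so within \<open>?U\<close> adding
        \<open>g\<close> changes the value at \<open>c\<close> alone.\<close>
      obtain g K where g: "g \<in> edge_cochains" "K \<in> comps" "vertex_sum g = point c + point (r K)"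
        using r(3)[of c] insert by auto
      have "vertex_sum (f + g) d = 1 \<longleftrightarrow> d \<in> insert c Q" if "d \<in> ?U" for d
      proof -
        have "vertex_sum f d = 1 \<longleftrightarrow> d \<in> Q" using f(2) that by blast
        moreover have "d \<noteq> r K" using that g(2) by blast
        ultimately show ?thesis
          using insert.hyps by (cases "vertex_sum f d") (auto simp: vertex_sum_add g(3) point_def)
      qed
      then have "{d \<in> ?U. vertex_sum (f + g) d = 1} = insert c Q" using insert.prems by blast
      then show ?case using f(1) g(1) cochains_add by blast
    qed
  qed
  have "Pow ?U \<subseteq> (\<lambda>v. {c \<in> ?U. v c = 1}) ` (vertex_sum ` edge_cochains)"
  proof
    fix Q assume "Q \<in> Pow ?U"
    then obtain f where "f \<in> edge_cochains" "{c \<in> ?U. vertex_sum f c = 1} = Q" using surj by blast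
    then show "Q \<in> (\<lambda>v. {c \<in> ?U. v c = 1}) ` (vertex_sum ` edge_cochains)" by blast
  qed
  then have "card (Pow ?U) \<le> card (vertex_sum ` edge_cochains)"
    by (rule surj_card_le[rotated]) (use card_cochains(1)[OF finite_darts rels(1)] in simp)
  moreover have "card ?U = ncross D - card comps"
    using r(1,2) finite_comps by (simp add: card_Diff_subset card_image)
  ultimately show ?thesis by (simp add: card_Pow)
qed

text \<open>With n crossings and c components, Euler's formula gives exactly 2^(n + c) coboundaries,
  while the rank of \<open>vertex_sum\<close> leaves at most 2^(2n - (n - c)) = 2^(n + c) cocycles.
  So every cocycle is a coboundary. Applied to the set of all edges this gives a checkerboard
  colouring of the faces, and its value on darts is the orientation.\<close>

lemma source_sink_orientation:
  obtains u :: "dart \<Rightarrow> bit" where "\<And>d. d \<in> darts D \<Longrightarrow> u (glue D d) = u d + 1"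
    "\<And>d. d \<in> darts D \<Longrightarrow> u (rot d) = u d + 1"
proof -
  let ?Z = "{f \<in> edge_cochains. vertex_sum f = 0}"
  let ?n = "ncross D" and ?c = "card comps"
  have F: "card (map_faces D) = ?n + 2 * ?c" using link by (simp add: link_diagram_def)
  have fin: "finite edge_cochains" by (rule card_cochains(1)[OF finite_darts rels(1)])
  have "(2::nat) ^ ?c * card (dual_cobound ` face_cochains) = 2 ^ ?c * 2 ^ (?n + ?c)"
    unfolding card_dual_cobound F by (simp add: power_add mult_2)
  then have B: "card (dual_cobound ` face_cochains) = 2 ^ (?n + ?c)" by simp
  have "card ?Z * card (vertex_sum ` edge_cochains) = 2 ^ (2 * ?n)"
    using card_kernel_image[of edge_cochains vertex_sum] fin cochains_add cochains_diff vertex_sum_add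
      card_cochains(2)[OF finite_darts rels(1)] card_edges by metis
  moreover have "2 * ?n = (?n + ?c) + (?n - ?c)" using card_comps_le by simp
  ultimately have "card ?Z * card (vertex_sum ` edge_cochains) = 2 ^ (?n + ?c) * 2 ^ (?n - ?c)"
    by (simp only: power_add)
  moreover have "card ?Z * 2 ^ (?n - ?c) \<le> card ?Z * card (vertex_sum ` edge_cochains)"
    using card_vertex_sum by simp
  ultimately have "card ?Z \<le> 2 ^ (?n + ?c)" by simp
  then have eq: "dual_cobound ` face_cochains = ?Z"
    using dual_cobound_cocycle B fin by (intro card_seteq) auto
  \<comment> \<open>The cochain that is 1 on every edge; it is a cocycle because four darts meet at
    each crossing.\<close>
  define u where "u d = (if d \<in> darts D then 1 else 0 :: bit)" for d
  have "u \<in> ?Z"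
    using glue by (auto simp: u_def cochains_def glue_rel_def vertex_sum_def darts_def fun_eq_iff)
  then obtain f where f: "f \<in> face_cochains" "u = dual_cobound f" using eq by blast
  have 1: "f (glue D d) = f d + 1" if "d \<in> darts D" for d
    using fun_cong[OF f(2), of d] that by (cases "f d"; cases "f (glue D d)") (auto simp: dual_cobound_def u_def)
  have "f (rot (glue D d)) = f d" if "d \<in> darts D" for d using f that face_cochainsD by auto
  \<comment> \<open>The face of \<open>rot d\<close> is also the face of \<open>glue D d\<close>, so
    turning by one slot crosses an edge.\<close>
  then have "f (rot d) = f d + 1" if "d \<in> darts D" for d using 1 that glue by metis
  with 1 show ?thesis by (rule that)
qed

end

section \<open>Saddles are merges or splits\<close>

lemma funpow_cancel:
  assumes "inj_on p O'" "p ` O' \<subseteq> O'" "a \<in> O'" "(p ^^ (i + n)) a = (p ^^ i) a"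
  shows "(p ^^ n) a = a"
  using assms(4)
proof (induction i)
  case (Suc i)
  have mem: "(p ^^ k) a \<in> O'" for k
    by (induction k) (use assms(2,3) in auto)
  then have "(p ^^ (i + n)) a = (p ^^ i) a"
    using Suc.prems inj_onD[OF assms(1), of "(p ^^ (i + n)) a" "(p ^^ i) a"] by simp
  then show ?case by (rule Suc.IH)
qed simp

lemma funpow_period:
  assumes "finite O'" "inj_on p O'" "p ` O' \<subseteq> O'" "a \<in> O'"
  obtains n where "n > 0" "(p ^^ n) a = a"
proof -
  have mem: "(p ^^ k) a \<in> O'" for k
    by (induction k) (use assms(3,4) in auto)
  then have "finite (range (\<lambda>k. (p ^^ k) a))"
    using assms(1) by (meson finite_subset image_subsetI)
  then have "\<not> inj (\<lambda>k. (p ^^ k) a)" using finite_imageD by fastforce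
  then obtain i j where "(p ^^ i) a = (p ^^ j) a" "i < j"
    unfolding inj_def by (metis linorder_neqE_nat)
  then show ?thesis
    using funpow_cancel[OF assms(2,3,4), of i "j - i"] that[of "j - i"] by simp
qed

text \<open>Here \<open>q\<close> is \<open>p\<close> followed by the transposition of
  \<open>a\<close> and \<open>b\<close>, which splits a cycle or joins two. Starting from
  \<open>a\<close>, both maps agree until \<open>p\<close> meets \<open>a\<close> or
  \<open>b\<close> again; at that moment \<open>q\<close> reaches the other of the two
  points.\<close>

lemma transposition_orbit:
  assumes "finite O'" "inj_on p O'" "p ` O' \<subseteq> O'" "a \<in> O'" "b \<in> O'" "a \<noteq> b"
    and q: "\<And>d. d \<in> O' \<Longrightarrow> q d = (if p d = a then b else if p d = b then a else p d)"
  shows "(\<exists>k. (q ^^ k) a = b) \<longleftrightarrow> (\<nexists>k. (p ^^ k) a = b)"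
proof -
  have mem: "(p ^^ k) a \<in> O'" for k
    by (induction k) (use assms(3,4) in auto)
  have agree: "(q ^^ j) a = (p ^^ j) a"
    if "\<And>i. 0 < i \<Longrightarrow> i < n \<Longrightarrow> (p ^^ i) a \<noteq> a \<and> (p ^^ i) a \<noteq> b" "j < n" for j n
    using that(2)
  proof (induction j)
    case (Suc j)
    then show ?case using that(1)[of "Suc j"] q[OF mem[of j]] by simp
  qed simp
  show ?thesis
  proof (cases "\<exists>k. (p ^^ k) a = b")
    case True
    define k where "k = (LEAST k. (p ^^ k) a = b)"
    have k: "(p ^^ k) a = b" unfolding k_def using True by (rule LeastI_ex)
    have least: "(p ^^ i) a \<noteq> b" if "i < k" for i using that not_less_Least unfolding k_def by blast
    have "k > 0" using k \<open>a \<noteq> b\<close> by (cases k) auto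
    have no: "(p ^^ i) a \<noteq> a \<and> (p ^^ i) a \<noteq> b" if "0 < i" "i < k" for i
    proof -
      have "(p ^^ (k - i + i)) a = (p ^^ (k - i)) ((p ^^ i) a)" by (simp add: funpow_add)
      then have "(p ^^ (k - i)) ((p ^^ i) a) = b" using k that by simp
      then show ?thesis using least[of "k - i"] least[of i] that by auto
    qed
    have ag: "(q ^^ j) a = (p ^^ j) a" if "j < k" for j by (rule agree[OF no that])
    \<comment> \<open>At time \<open>k\<close> the map \<open>p\<close> arrives at \<open>b\<close>,
      where \<open>q\<close> returns to \<open>a\<close>; the orbit of \<open>a\<close> under
      \<open>q\<close> is closed before it meets \<open>b\<close>.\<close>
    have per: "(q ^^ k) a = a"
      using ag[of "k - 1"] \<open>k > 0\<close> k q[OF mem[of "k - 1"]] \<open>a \<noteq> b\<close> by (cases k) auto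
    have "(q ^^ i) a \<noteq> b" for i
    proof -
      have "(q ^^ i) a = (q ^^ (i mod k)) a" using funpow_mod_eq[OF per] by metis
      then show ?thesis using ag[of "i mod k"] least[of "i mod k"] \<open>k > 0\<close> by simp
    qed
    with True show ?thesis by blast
  next
    case False
    obtain m where "m > 0 \<and> (p ^^ m) a = a" by (rule funpow_period[OF assms(1-4)]) blast
    then have ex: "\<exists>m. m > 0 \<and> (p ^^ m) a = a" by blast
    define n where "n = (LEAST m. m > 0 \<and> (p ^^ m) a = a)"
    have n: "n > 0" "(p ^^ n) a = a" unfolding n_def using LeastI_ex[OF ex] by auto
    have least: "(p ^^ i) a \<noteq> a" if "0 < i" "i < n" for i using that not_less_Least unfolding n_def by blast
    have ag: "(q ^^ j) a = (p ^^ j) a" if "j < n" for j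
      by (rule agree[OF _ that]) (use least False in auto)
    have "(q ^^ n) a = b"
      using ag[of "n - 1"] n q[OF mem[of "n - 1"]] by (cases n) auto
    with False show ?thesis by blast
  qed
qed

section \<open>Circles of a resolution under surgery\<close>

lemma smooth_simps:
  "smooth \<xi> (c, 0) = (c, if c \<in> \<xi> then 3 else 1)" "smooth \<xi> (c, 1) = (c, if c \<in> \<xi> then 2 else 0)"
  "smooth \<xi> (c, Suc 0) = (c, if c \<in> \<xi> then 2 else 0)"
  "smooth \<xi> (c, 2) = (c, if c \<in> \<xi> then 1 else 3)" "smooth \<xi> (c, 3) = (c, if c \<in> \<xi> then 0 else 2)"
  by (simp_all add: smooth_def eval_nat_numeral)

context planar_diagram
begin

lemma smooth_darts:
  assumes "d \<in> darts D"
  shows "smooth \<xi> d \<in> darts D" "smooth \<xi> (smooth \<xi> d) = d" "fst (smooth \<xi> d) = fst d"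
  by (rule darts_cases[OF assms]; auto simp: smooth_simps darts_def)+

definition state_rel :: "nat set \<Rightarrow> (dart \<times> dart) set" where
  "state_rel \<xi> = glue_rel D \<union> {(e, smooth \<xi> e) | e. e \<in> darts D}"

lemma state_rel_iff:
  "(d, e) \<in> state_rel \<xi> \<longleftrightarrow> d \<in> darts D \<and> (e = glue D d \<or> e = smooth \<xi> d)"
  unfolding state_rel_def Un_iff rel_iff by blast

abbreviation circle_of :: "nat set \<Rightarrow> dart \<Rightarrow> dart set" where
  "circle_of \<xi> d \<equiv> gen_class (state_rel \<xi>) d"

lemma circ_eq: "circ D \<xi> d = Inl (circle_of \<xi> d)"
  by (simp add: circ_def state_rel_def)

lemma state_rel_subset: "state_rel \<xi> \<subseteq> darts D \<times> darts D"
  using glue(1) smooth_darts(1) by (auto simp: state_rel_iff)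

lemma circle_of_smooth: "d \<in> darts D \<Longrightarrow> circle_of \<xi> (smooth \<xi> d) = circle_of \<xi> d"
  by (rule gen_class_step[symmetric]) (simp add: state_rel_iff)

lemma circle_of_glue: "d \<in> darts D \<Longrightarrow> circle_of \<xi> (glue D d) = circle_of \<xi> d"
  by (rule gen_class_step[symmetric]) (simp add: state_rel_iff)

text \<open>Either smoothing joins each of the slots 1 and 3 to slot 0 or slot 2, so these two slots
  represent all circles through the crossing.\<close>

lemma circle_of_crossing:
  assumes "(c, s) \<in> darts D"
  shows "circle_of \<xi> (c, s) = circle_of \<xi> (c, 0) \<or> circle_of \<xi> (c, s) = circle_of \<xi> (c, 2)"
proof -
  have "c < ncross D" using assms by (simp add: darts_def)
  then have "(c, 0) \<in> darts D" "(c, 2) \<in> darts D" by (simp_all add: darts_def)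
  then have sm: "circle_of \<xi> (smooth \<xi> (c, 0)) = circle_of \<xi> (c, 0)"
    "circle_of \<xi> (smooth \<xi> (c, 2)) = circle_of \<xi> (c, 2)" by (simp_all only: circle_of_smooth)
  show ?thesis
    by (rule darts_cases[OF assms]) (use sm in \<open>auto simp: smooth_simps split: if_splits\<close>)
qed

text \<open>A circle that avoids the crossing \<open>c\<close> is closed under the moves of both
  resolutions, since these differ only at \<open>c\<close>.\<close>

lemma circle_of_transfer_subset:
  assumes "d \<in> darts D" "\<xi> - {c} = \<xi>' - {c}" "\<And>e. e \<in> circle_of \<xi> d \<Longrightarrow> fst e \<noteq> c"
  shows "circle_of \<xi>' d \<subseteq> circle_of \<xi> d"
proof
  have sub: "circle_of \<xi> d \<subseteq> darts D" by (rule gen_class_subset[OF state_rel_subset assms(1)])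
  have closed: "glue D x \<in> circle_of \<xi> d" "smooth \<xi>' x \<in> circle_of \<xi> d" if x: "x \<in> circle_of \<xi> d" for x
  proof -
    have xd: "x \<in> darts D" using sub x by auto
    have "smooth \<xi>' x = smooth \<xi> x"
      using assms(2) assms(3)[OF x] by (auto simp: smooth_def)
    then show "glue D x \<in> circle_of \<xi> d" "smooth \<xi>' x \<in> circle_of \<xi> d"
      using circle_of_smooth[OF xd, of \<xi>] circle_of_glue[OF xd, of \<xi>] gen_class_eq[OF x]
        gen_class_refl[of "glue D x" "state_rel \<xi>"] gen_class_refl[of "smooth \<xi> x" "state_rel \<xi>"] by auto
  qed
  fix e assume "e \<in> circle_of \<xi>' d"
  then have "(e \<in> circle_of \<xi> d) = (d \<in> circle_of \<xi> d)"
  proof (rule gen_class_invariant[rotated])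
    fix x y assume "(x, y) \<in> state_rel \<xi>'"
    then have x: "x \<in> darts D" "y = glue D x \<or> y = smooth \<xi>' x" by (auto simp: state_rel_iff)
    then have "(y = glue D x \<and> x = glue D y) \<or> (y = smooth \<xi>' x \<and> x = smooth \<xi>' y)"
      using glue(3)[OF x(1)] smooth_darts(2)[OF x(1), of \<xi>'] by auto
    then show "(x \<in> circle_of \<xi> d) = (y \<in> circle_of \<xi> d)" using closed by metis
  qed
  then show "e \<in> circle_of \<xi> d" by (simp add: gen_class_refl)
qed

lemma circle_of_transfer:
  assumes "d \<in> darts D" "\<xi> - {c} = \<xi>' - {c}" "\<And>e. e \<in> circle_of \<xi> d \<Longrightarrow> fst e \<noteq> c"
  shows "circle_of \<xi>' d = circle_of \<xi> d"
proof
  show "circle_of \<xi>' d \<subseteq> circle_of \<xi> d" by (rule circle_of_transfer_subset[OF assms])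
  then show "circle_of \<xi> d \<subseteq> circle_of \<xi>' d"
    by (intro circle_of_transfer_subset[of d \<xi>' c]) (use assms in auto)
qed

text \<open>Stated symmetrically in the two resolutions, so that the equality follows from two
  applications. It makes the list of uninvolved circles in \<open>saddle\<close> serve both below
  and above.\<close>

lemma circles_away_subset:
  assumes "\<xi> - {c} = \<xi>' - {c}" "c < ncross D"
  shows "circles D \<xi> - {circ D \<xi> (c, 0), circ D \<xi> (c, 2)}
    \<subseteq> circles D \<xi>' - {circ D \<xi>' (c, 0), circ D \<xi>' (c, 2)}"
proof
  fix C assume C: "C \<in> circles D \<xi> - {circ D \<xi> (c, 0), circ D \<xi> (c, 2)}"
  show "C \<in> circles D \<xi>' - {circ D \<xi>' (c, 0), circ D \<xi>' (c, 2)}"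
  proof (cases C)
    case (Inr j)
    then show ?thesis using C by (auto simp: circles_def circ_def)
  next
    case (Inl K)
    then obtain d where d: "d \<in> darts D" "C = circ D \<xi> d" using C by (auto simp: circles_def)
    have away: "fst e \<noteq> c" if e: "e \<in> circle_of \<xi> d" for e
    proof
      assume "fst e = c"
      then have ce: "(c, snd e) = e" by auto
      have "e \<in> darts D" using gen_class_subset[OF state_rel_subset d(1)] e by blast
      then have "circle_of \<xi> e = circle_of \<xi> (c, 0) \<or> circle_of \<xi> e = circle_of \<xi> (c, 2)"
        using circle_of_crossing[of c "snd e"] unfolding ce by blast
      then show False using C d gen_class_eq[OF e] by (auto simp: circ_eq)
    qed
    have eq: "circle_of \<xi>' d = circle_of \<xi> d" by (rule circle_of_transfer[OF d(1) assms(1) away])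
    then have "(c, s) \<notin> circle_of \<xi>' d" for s using away by fastforce
    then have "circle_of \<xi>' d \<noteq> circle_of \<xi>' (c, s)" for s using gen_class_refl by metis
    then show ?thesis using d eq by (auto simp: circles_def circ_eq)
  qed
qed

lemma circles_away:
  assumes "c < ncross D"
  shows "circles D (insert c \<xi>) - {circ D (insert c \<xi>) (c, 0), circ D (insert c \<xi>) (c, 2)} =
    circles D \<xi> - {circ D \<xi> (c, 0), circ D \<xi> (c, 2)}"
  by (intro equalityI circles_away_subset) (use assms in auto)

text \<open>Both smoothings join cyclically adjacent slots, and the orientation alternates around
  the crossing.\<close>

lemma smooth_orientation:
  assumes "\<And>d. d \<in> darts D \<Longrightarrow> u (rot d) = u d + (1::bit)" "d \<in> darts D"
  shows "u (smooth \<xi> d) = u d + 1"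
proof -
  obtain c where c: "c < ncross D" "d = (c, 0) \<or> d = (c, 1) \<or> d = (c, 2) \<or> d = (c, 3)"
    using assms(2) by (rule darts_cases)
  then have "u (c, 1) = u (c, 0) + 1" "u (c, 2) = u (c, 1) + 1" "u (c, 3) = u (c, 2) + 1"
    using assms(1)[of "(c, 0)"] assms(1)[of "(c, 1)"] assms(1)[of "(c, 2)"]
    by (simp_all add: rot_simps darts_def)
  then show ?thesis using c(2) by (cases "u (c, 0)") (auto simp: smooth_simps)
qed

text \<open>Gluing and smoothing both reverse the orientation, so their composite \<open>p\<close>
  permutes the darts of one orientation and its cycles trace the circles. Changing the smoothing at
  \<open>c\<close> composes \<open>p\<close> with the transposition of the slots 0 and 2, so the two
  slots pass from one circle to two or from two to one.\<close>

lemma surgery: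
  assumes "c < ncross D" "c \<notin> \<xi>"
  shows "circ D (insert c \<xi>) (c, 0) = circ D (insert c \<xi>) (c, 2) \<longleftrightarrow> circ D \<xi> (c, 0) \<noteq> circ D \<xi> (c, 2)"
proof -
  obtain u :: "dart \<Rightarrow> bit" where u: "\<And>d. d \<in> darts D \<Longrightarrow> u (glue D d) = u d + 1"
    "\<And>d. d \<in> darts D \<Longrightarrow> u (rot d) = u d + 1"
    by (rule source_sink_orientation; rule that)
  \<comment> \<open>The half of the darts oriented like slot 0; it contains slot 2 of the same
    crossing as well.\<close>
  define Q where "Q = {d \<in> darts D. u d = u (c, 0)}"
  define p where "p \<zeta> d = smooth \<zeta> (glue D d)" for \<zeta> d
  have cd: "(c, 0) \<in> darts D" "(c, 1) \<in> darts D" "(c, 2) \<in> darts D" "(c, 3) \<in> darts D"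
    using assms(1) by (simp_all add: darts_def)
  have cQ: "(c, 0) \<in> Q" "(c, 2) \<in> Q"
    using cd u(2)[OF cd(1)] u(2)[OF cd(2)] by (auto simp: Q_def rot_simps)
  have finQ: "finite Q" using finite_darts by (simp add: Q_def)
  have QD: "d \<in> darts D" if "d \<in> Q" for d using that by (simp add: Q_def)
  have su: "u (smooth \<zeta> d) = u d + 1" if "d \<in> darts D" for \<zeta> d
    by (rule smooth_orientation[of u]) (use u(2) that in auto)
  have injp: "inj_on (p \<zeta>) Q" for \<zeta>
    using QD glue(1,3) smooth_darts(2) unfolding inj_on_def p_def by metis
  have pQ: "p \<zeta> ` Q \<subseteq> Q" for \<zeta>
  proof (rule image_subsetI)
    fix d assume d: "d \<in> Q"
    have g: "glue D d \<in> darts D" using glue(1) QD[OF d] by simp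
    show "p \<zeta> d \<in> Q"
      using d g smooth_darts(1)[OF g, of \<zeta>] su[OF g, of \<zeta>] u(1)[OF QD[OF d]]
      by (cases "u d") (simp_all add: Q_def p_def)
  qed
  have flip: "glue D d \<in> Q \<longleftrightarrow> d \<notin> Q" "smooth \<zeta> d \<in> Q \<longleftrightarrow> d \<notin> Q" if "d \<in> darts D" for d \<zeta>
    using that glue(1) smooth_darts(1) u(1) su by (auto simp: Q_def)
  have orbit: "circle_of \<zeta> (c, 0) = circle_of \<zeta> (c, 2) \<longleftrightarrow> (\<exists>k. (p \<zeta> ^^ k) (c, 0) = (c, 2))" for \<zeta>
  proof
    assume "\<exists>k. (p \<zeta> ^^ k) (c, 0) = (c, 2)"
    then obtain k where k: "(p \<zeta> ^^ k) (c, 0) = (c, 2)" by blast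
    have "(p \<zeta> ^^ j) (c, 0) \<in> Q \<and> circle_of \<zeta> ((p \<zeta> ^^ j) (c, 0)) = circle_of \<zeta> (c, 0)" for j
    proof (induction j)
      case (Suc j)
      then show ?case
        using pQ[of \<zeta>] QD glue(1) circle_of_smooth circle_of_glue by (auto simp: p_def)
    qed (use cQ in simp)
    from this[of k] k show "circle_of \<zeta> (c, 0) = circle_of \<zeta> (c, 2)" by simp
  next
    assume same: "circle_of \<zeta> (c, 0) = circle_of \<zeta> (c, 2)"
    \<comment> \<open>The orbit of slot 0 under \<open>p\<close>. It is to be shown that a dart of
      \<open>Q\<close> on the same circle belongs to it.\<close>
    define B where "B = {(p \<zeta> ^^ k) (c, 0) | k. True}"
    have BQ: "B \<subseteq> Q"
    proof -
      have "(p \<zeta> ^^ k) (c, 0) \<in> Q" for k by (induction k) (use pQ cQ in auto)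
      then show ?thesis by (auto simp: B_def)
    qed
    obtain n where n: "n > 0" "(p \<zeta> ^^ n) (c, 0) = (c, 0)"
      by (rule funpow_period[OF finQ injp pQ cQ(1)])
    have B: "p \<zeta> d \<in> B \<longleftrightarrow> d \<in> B" if d: "d \<in> Q" for d
    proof
      assume "d \<in> B"
      then obtain k where "d = (p \<zeta> ^^ k) (c, 0)" by (auto simp: B_def)
      then have "p \<zeta> d = (p \<zeta> ^^ Suc k) (c, 0)" by simp
      then show "p \<zeta> d \<in> B" unfolding B_def by blast
    next
      assume "p \<zeta> d \<in> B"
      then obtain k where k: "p \<zeta> d = (p \<zeta> ^^ k) (c, 0)" by (auto simp: B_def)
      \<comment> \<open>The starting point itself is an image under \<open>p\<close> because it is
        periodic; this covers exponent 0.\<close>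
      obtain j where j: "p \<zeta> d = (p \<zeta> ^^ Suc j) (c, 0)"
      proof (cases k)
        case 0
        then show ?thesis using k n that[of "n - 1"] by (cases n) auto
      qed (use k that in blast)
      have jB: "(p \<zeta> ^^ j) (c, 0) \<in> B" unfolding B_def by blast
      have "d = (p \<zeta> ^^ j) (c, 0)"
        by (rule inj_onD[OF injp[of \<zeta>]]) (use j d jB BQ in auto)
      then show "d \<in> B" using jB by simp
    qed
    \<comment> \<open>Membership in the orbit, extended to all darts: one outside \<open>Q\<close>
      is represented by its partner under gluing. This makes it invariant along circles.\<close>
    define I where "I d = (if d \<in> Q then d \<in> B else glue D d \<in> B)" for d
    have "I (c, 2) = I (c, 0)"
    proof (rule gen_class_invariant[where f = I and R = "state_rel \<zeta>"])
      show "(c, 2) \<in> circle_of \<zeta> (c, 0)" using same gen_class_refl by metis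
    next
      fix x y assume "(x, y) \<in> state_rel \<zeta>"
      then have x: "x \<in> darts D" "y = glue D x \<or> y = smooth \<zeta> x" by (auto simp: state_rel_iff)
      show "I x = I y"
      proof (cases "y = glue D x")
        case True
        then show ?thesis using flip(1)[OF x(1)] glue(3)[OF x(1)] by (auto simp: I_def)
      next
        case False
        then have y: "y = smooth \<zeta> x" using x(2) by simp
        have yd: "y \<in> darts D" and xy: "x = smooth \<zeta> y" using smooth_darts x(1) y by auto
        have step: "I a = I b" if "a \<in> darts D" "a \<notin> Q" "b = smooth \<zeta> a" for a b
          using that flip[OF that(1)] glue[OF that(1)] B[of "glue D a"] by (auto simp: I_def p_def)
        show ?thesis
          using step[OF x(1) _ y] step[OF yd _ xy] flip(2)[OF x(1)] y by auto
      qed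
    qed
    moreover have "(c, 0) \<in> B" unfolding B_def using funpow_0 by (metis (mono_tags, lifting) mem_Collect_eq)
    ultimately show "\<exists>k. (p \<zeta> ^^ k) (c, 0) = (c, 2)" using cQ by (auto simp: I_def B_def)
  qed
  have "(\<exists>k. (p (insert c \<xi>) ^^ k) (c, 0) = (c, 2)) \<longleftrightarrow> (\<nexists>k. (p \<xi> ^^ k) (c, 0) = (c, 2))"
  proof (rule transposition_orbit[OF finQ injp pQ cQ])
    fix d assume "d \<in> Q"
    then have g: "glue D d \<in> darts D" "glue D d \<notin> Q" using QD glue(1) flip by auto
    then obtain e s where e: "glue D d = (e, s)" by (metis surj_pair)
    show "p (insert c \<xi>) d = (if p \<xi> d = (c, 0) then (c, 2) else if p \<xi> d = (c, 2) then (c, 0) else p \<xi> d)"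
    proof (cases "e = c")
      case True
      \<comment> \<open>Slots 0 and 2 are excluded because they lie in \<open>Q\<close>, while
        \<open>glue D d\<close> does not.\<close>
      have "s = 1 \<or> s = 3" using g e cQ True by (auto elim!: darts_cases)
      then show ?thesis using assms(2) e True by (auto simp: p_def smooth_simps)
    next
      case False
      then have "smooth (insert c \<xi>) (e, s) = smooth \<xi> (e, s)" "fst (smooth \<xi> (e, s)) = e"
        by (simp_all add: smooth_def)
      then show ?thesis using False e by (auto simp: p_def)
    qed
  qed simp
  then show ?thesis using orbit by (simp add: circ_eq)
qed

lemma circ_order: "\<xi> \<subseteq> {..<ncross D} \<Longrightarrow> distinct (circ_order D \<xi>)"
  "\<xi> \<subseteq> {..<ncross D} \<Longrightarrow> set (circ_order D \<xi>) = circles D \<xi>"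
  using link by (auto simp: link_diagram_def)

abbreviation ncirc :: "nat set \<Rightarrow> nat" where
  "ncirc \<xi> \<equiv> length (circ_order D \<xi>)"

text \<open>The definition of \<open>saddle\<close> inspects only the circles below. By
  \<open>surgery\<close> the number of circles at the crossing above is the expected one, so both
  reorderings are between lists of the same circles.\<close>

lemma saddle_word:
  assumes "\<xi> \<subseteq> {..<ncross D}" "c < ncross D" "c \<notin> \<xi>"
  shows "\<exists>b. if circ D \<xi> (c, 0) = circ D \<xi> (c, 2)
    then split_word b (saddle D \<xi> c) \<and> ncirc \<xi> = b + 1 \<and> ncirc (insert c \<xi>) = b + 2
    else merge_word b (saddle D \<xi> c) \<and> ncirc \<xi> = b + 2 \<and> ncirc (insert c \<xi>) = b + 1"
proof -
  let ?\<xi> = "insert c \<xi>"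
  define t where "t = (c, if arrow_down D c then 0 else 2 :: nat)"
  define h where "h = (c, if arrow_down D c then 2 else 0 :: nat)"
  have th: "{circ D \<zeta> t, circ D \<zeta> h} = {circ D \<zeta> (c, 0), circ D \<zeta> (c, 2)}" for \<zeta>
    by (auto simp: t_def h_def)
  have th_eq: "circ D \<zeta> t = circ D \<zeta> h \<longleftrightarrow> circ D \<zeta> (c, 0) = circ D \<zeta> (c, 2)" for \<zeta>
    by (auto simp: t_def h_def)
  define rest where "rest = filter (\<lambda>C. C \<noteq> circ D \<xi> t \<and> C \<noteq> circ D \<xi> h) (circ_order D \<xi>)"
  have \<xi>': "?\<xi> \<subseteq> {..<ncross D}" using assms by auto
  have cd: "(c, 0) \<in> darts D" "(c, 2) \<in> darts D" using assms(2) by (simp_all add: darts_def)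
  have mem: "{circ D \<zeta> t, circ D \<zeta> h} \<subseteq> circles D \<zeta>" for \<zeta>
    unfolding th using cd by (auto simp: circles_def)
  have rest: "distinct rest" "set rest = circles D \<xi> - {circ D \<xi> t, circ D \<xi> h}"
    using circ_order[OF assms(1)] by (auto simp: rest_def)
  have rest': "set rest = circles D ?\<xi> - {circ D ?\<xi> t, circ D ?\<xi> h}"
    unfolding rest(2) th using circles_away[OF assms(2)] by simp
  have sad: "saddle D \<xi> c = (if circ D \<xi> t \<noteq> circ D \<xi> h
        then reorder 0 (circ_order D \<xi>) (circ D \<xi> h # circ D \<xi> t # rest)
             @ [(0, Merge, length rest)]
             @ reorder 0 (circ D ?\<xi> t # rest) (circ_order D ?\<xi>)
        else reorder 0 (circ_order D \<xi>) (circ D \<xi> t # rest)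
             @ [(0, Split, length rest)]
             @ reorder 0 (circ D ?\<xi> t # circ D ?\<xi> h # rest) (circ_order D ?\<xi>))"
    unfolding saddle_def Let_def t_def h_def rest_def by simp
  have perm: "mset (circ_order D \<zeta>) = mset ys"
    if "\<zeta> \<subseteq> {..<ncross D}" "distinct ys" "set ys = circles D \<zeta>" for \<zeta> ys
    using circ_order[OF that(1)] that set_eq_iff_mset_eq_distinct[of "circ_order D \<zeta>" ys] by simp
  have tw: "twisty n (reorder 0 xs ys)" if "mset xs = mset ys" "length xs = n" for n and xs ys :: "circle list"
    using twisty_reorder[OF that(1), of 0] that(2) by simp
  show ?thesis
  proof (cases "circ D \<xi> t = circ D \<xi> h")
    case True
    then have neq: "circ D ?\<xi> t \<noteq> circ D ?\<xi> h"
      using surgery[OF assms(2,3)] th_eq by auto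
    have m: "mset (circ_order D \<xi>) = mset (circ D \<xi> t # rest)"
      by (rule perm[OF assms(1)]) (use rest mem[of \<xi>] True in auto)
    have m': "mset (circ_order D ?\<xi>) = mset (circ D ?\<xi> t # circ D ?\<xi> h # rest)"
      by (rule perm[OF \<xi>']) (use rest(1) rest' mem[of ?\<xi>] neq in auto)
    have "saddle D \<xi> c = reorder 0 (circ_order D \<xi>) (circ D \<xi> t # rest) @ (0, Split, length rest)
        # reorder 0 (circ D ?\<xi> t # circ D ?\<xi> h # rest) (circ_order D ?\<xi>)"
      using True by (simp add: sad)
    moreover have "twisty (length rest + 1) (reorder 0 (circ_order D \<xi>) (circ D \<xi> t # rest))"
      by (rule tw[OF m]) (use mset_eq_length[OF m] in simp)
    moreover have "twisty (length rest + 2)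
        (reorder 0 (circ D ?\<xi> t # circ D ?\<xi> h # rest) (circ_order D ?\<xi>))"
      by (rule tw[OF m'[symmetric]]) simp
    ultimately have "split_word (length rest) (saddle D \<xi> c)"
      unfolding split_word_def by blast
    then show ?thesis
      using True th_eq mset_eq_length[OF m] mset_eq_length[OF m'] by (intro exI[of _ "length rest"]) simp
  next
    case False
    then have eq: "circ D ?\<xi> t = circ D ?\<xi> h"
      using surgery[OF assms(2,3)] th_eq by auto
    have m: "mset (circ_order D \<xi>) = mset (circ D \<xi> h # circ D \<xi> t # rest)"
      by (rule perm[OF assms(1)]) (use rest mem[of \<xi>] False in auto)
    have m': "mset (circ_order D ?\<xi>) = mset (circ D ?\<xi> t # rest)"
      by (rule perm[OF \<xi>']) (use rest(1) rest' mem[of ?\<xi>] eq in auto)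
    have "saddle D \<xi> c = reorder 0 (circ_order D \<xi>) (circ D \<xi> h # circ D \<xi> t # rest)
        @ (0, Merge, length rest) # reorder 0 (circ D ?\<xi> t # rest) (circ_order D ?\<xi>)"
      using False by (simp add: sad)
    moreover have "twisty (length rest + 2) (reorder 0 (circ_order D \<xi>) (circ D \<xi> h # circ D \<xi> t # rest))"
      by (rule tw[OF m]) (use mset_eq_length[OF m] in simp)
    moreover have "twisty (length rest + 1) (reorder 0 (circ D ?\<xi> t # rest) (circ_order D ?\<xi>))"
      by (rule tw[OF m'[symmetric]]) simp
    ultimately have "merge_word (length rest) (saddle D \<xi> c)"
      unfolding merge_word_def by blast
    then show ?thesis
      using False th_eq mset_eq_length[OF m] mset_eq_length[OF m'] by (intro exI[of _ "length rest"]) simp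
  qed
qed

end

section \<open>The cube of resolutions\<close>

definition spec_hom :: "int \<Rightarrow> int \<Rightarrow> int \<Rightarrow> kring \<Rightarrow> int" where
  "spec_hom x y z r = (\<Sum>(i, j, l)\<in>Poly_Mapping.keys r. Poly_Mapping.lookup r (i, j, l) *
     ((if i = 0 then 1 else x) * (if j = 0 then 1 else y) * spow z l))"

text \<open>The ground ring is a group ring, so a character of the group extends linearly.
  Multiplicativity is checked on group elements and extended one argument at a time by induction
  over the free abelian group.\<close>

lemma ground_hom_character:
  fixes \<chi> :: "bit \<times> bit \<times> int \<Rightarrow> int"
  assumes "\<chi> 0 = 1" "\<And>g h. \<chi> (g + h) = \<chi> g * \<chi> h"
  shows "ground_hom (\<lambda>r. \<Sum>g\<in>Poly_Mapping.keys r. Poly_Mapping.lookup r g * \<chi> g)"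
proof -
  define S where "S r = (\<Sum>g\<in>Poly_Mapping.keys r. Poly_Mapping.lookup r g * \<chi> g)" for r :: kring
  have sup: "S r = (\<Sum>g\<in>A. Poly_Mapping.lookup r g * \<chi> g)"
    if "finite A" "Poly_Mapping.keys r \<subseteq> A" for r A
    unfolding S_def by (rule sum.mono_neutral_left) (use that in \<open>auto simp: in_keys_iff\<close>)
  have S_diff: "S (r - s) = S r - S s" for r s
  proof -
    let ?A = "Poly_Mapping.keys r \<union> Poly_Mapping.keys s"
    have "S (r - s) = (\<Sum>g\<in>?A. Poly_Mapping.lookup (r - s) g * \<chi> g)"
      by (rule sup) (use keys_diff[of r s] in auto)
    then show ?thesis
      by (simp add: sup[of ?A r] sup[of ?A s] lookup_minus left_diff_distrib sum_subtractf)
  qed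
  have single: "S (frag_of g) = \<chi> g" for g by (simp add: S_def)
  have zero: "S 0 = 0" by (simp add: S_def)
  have mult1: "S (frag_of g * s) = \<chi> g * S s" for g s
    using subset_UNIV[of "Poly_Mapping.keys s"]
  proof (induction s rule: frag_induction)
    case (diff a b)
    then show ?case by (simp add: right_diff_distrib S_diff)
  qed (simp_all add: zero single Poly_Mapping.mult_single assms(2))
  have mult: "S (r * s) = S r * S s" for r s
    using subset_UNIV[of "Poly_Mapping.keys r"]
  proof (induction r rule: frag_induction)
    case (diff a b)
    then show ?case by (simp add: left_diff_distrib S_diff)
  qed (simp_all add: zero single mult1)
  have "S (r + s) = S r + S s" for r s using S_diff[of r "- s"] S_diff[of 0 s] zero by simp
  moreover have "S 1 = 1" using single[of 0] assms(1) by (simp flip: single_one)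
  ultimately have "ground_hom S" using mult by (simp add: ground_hom_def)
  then show ?thesis unfolding S_def[abs_def] .
qed

lemma ground_hom_spec:
  assumes "x * x = 1" "y * y = 1" "z * z = 1"
  shows "ground_hom (spec_hom x y z)"
proof -
  define \<chi> where "\<chi> = (\<lambda>(i :: bit, j :: bit, l). (if i = 0 then 1 else x) * (if j = 0 then 1 else y) * spow z l)"
  have b: "(if i + i' = 0 then 1 else s) = (if i = 0 then 1 else s) * (if i' = 0 then 1 else s)"
    if "s * s = 1" for s :: int and i i' :: bit
    using that by (cases i; cases i') auto
  have "ground_hom (\<lambda>r. \<Sum>g\<in>Poly_Mapping.keys r. Poly_Mapping.lookup r g * \<chi> g)"
  proof (rule ground_hom_character)
    show "\<chi> 0 = 1" by (simp add: \<chi>_def zero_prod_def spow_def)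
    fix g h :: "bit \<times> bit \<times> int"
    obtain i j l i' j' l' where gh: "g = (i, j, l)" "h = (i', j', l')" by (metis surj_pair)
    show "\<chi> (g + h) = \<chi> g * \<chi> h"
      by (simp only: gh \<chi>_def add_Pair prod.case b[OF assms(1)] b[OF assms(2)] spow_add[OF assms(3)] mult_ac)
  qed
  moreover have "spec_hom x y z = (\<lambda>r. \<Sum>g\<in>Poly_Mapping.keys r. Poly_Mapping.lookup r g * \<chi> g)"
    by (intro ext) (simp add: spec_hom_def \<chi>_def case_prod_beta)
  ultimately show ?thesis by simp
qed

lemma spec_hom_values: "spec_hom x y z KX = x" "spec_hom x y z KY = y" "spec_hom x y z KZ = z"
  by (simp_all add: spec_hom_def KX_def KY_def KZ_def spow_def)

lemma even_act_spec: "even_act r m = spec_hom 1 1 1 r * m"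
  by (simp add: even_act_def spec_hom_def spow_def case_prod_beta)

lemma odd_act_spec: "odd_act r m = spec_hom 1 (-1) 1 r * m"
  unfolding odd_act_def spec_hom_def
  by (intro arg_cong2[where f = "(*)"] sum.cong) (auto simp: spow_def)

text \<open>An additive endomorphism of \<int> is multiplication by the image of 1.\<close>

lemma module_act_hom:
  fixes act :: "kring \<Rightarrow> int \<Rightarrow> int"
  assumes "module act"
  obtains \<phi> where "ground_hom \<phi>" "\<And>r m. act r m = \<phi> r * m"
proof -
  interpret module act by fact
  define \<phi> where "\<phi> r = act r 1" for r
  have act: "act r m = \<phi> r * m" for r m
  proof (induction m rule: int_induct[where k = 0])
    case base
    show ?case by simp
  next
    case (step1 i)
    then show ?case by (simp add: \<phi>_def scale_right_distrib distrib_left)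
  next
    case (step2 i)
    then show ?case by (simp add: \<phi>_def scale_right_diff_distrib right_diff_distrib)
  qed
  have "ground_hom \<phi>"
  proof
    fix r s
    show "\<phi> (r + s) = \<phi> r + \<phi> s" by (simp add: \<phi>_def scale_left_distrib)
    show "\<phi> (r * s) = \<phi> r * \<phi> s" using act[of r "\<phi> s"] by (simp add: \<phi>_def flip: scale_scale)
    show "\<phi> 1 = 1" by (simp add: \<phi>_def)
  qed
  then show ?thesis using act by (rule that)
qed

text \<open>The value \<open>\<kappa> \<xi>\<close> is the product of \<open>\<theta>\<close> along
  the path that adds the elements of \<open>\<xi>\<close> in increasing order. To insert a new
  element, it is moved past the larger ones, one face at a time, by the cocycle condition.\<close>

lemma cube_coboundary:
  fixes \<theta> :: "nat set \<Rightarrow> nat \<Rightarrow> int"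
  assumes sign: "\<And>\<xi> c. \<theta> \<xi> c * \<theta> \<xi> c = 1"
    and cocycle: "\<And>\<xi> i j. \<xi> \<subseteq> {..<n} \<Longrightarrow> i < n \<Longrightarrow> j < n \<Longrightarrow> i \<notin> \<xi> \<Longrightarrow> j \<notin> \<xi> \<Longrightarrow> i < j \<Longrightarrow>
      \<theta> (insert i \<xi>) j * \<theta> \<xi> i = \<theta> (insert j \<xi>) i * \<theta> \<xi> j"
  obtains \<kappa> where "\<And>\<xi>. \<kappa> \<xi> * \<kappa> \<xi> = 1"
    "\<And>\<xi> c. \<xi> \<subseteq> {..<n} \<Longrightarrow> c < n \<Longrightarrow> c \<notin> \<xi> \<Longrightarrow> \<kappa> (insert c \<xi>) = \<kappa> \<xi> * \<theta> \<xi> c"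
proof -
  define \<kappa> where "\<kappa> \<xi> = (\<Prod>c\<in>\<xi>. \<theta> (\<xi> \<inter> {..<c}) c)" for \<xi>
  have top: "\<kappa> (insert e \<xi>) = \<kappa> \<xi> * \<theta> \<xi> e" if "finite \<xi>" "\<And>x. x \<in> \<xi> \<Longrightarrow> x < e" for \<xi> e
  proof -
    have "e \<notin> \<xi>" using that(2) by blast
    moreover have "insert e \<xi> \<inter> {..<e} = \<xi>" using that(2) by auto
    moreover have "insert e \<xi> \<inter> {..<c} = \<xi> \<inter> {..<c}" if "c \<in> \<xi>" for c
      using \<open>\<And>x. x \<in> \<xi> \<Longrightarrow> x < e\<close>[OF that] by auto
    ultimately show ?thesis using that(1) by (simp add: \<kappa>_def mult.commute)
  qed
  have main: "\<kappa> (insert c \<xi>) = \<kappa> \<xi> * \<theta> \<xi> c" if "finite \<xi>" "\<xi> \<subseteq> {..<n}" "c < n" "c \<notin> \<xi>" for \<xi> c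
    using that
  proof (induction \<xi> rule: finite_linorder_max_induct)
    case empty
    show ?case by (rule top) auto
  next
    case (insert e \<xi>)
    show ?case
    proof (cases "e < c")
      case True
      then show ?thesis using insert by (intro top) auto
    next
      case False
      then have "c < e" using insert.prems by auto
      have "\<kappa> (insert c (insert e \<xi>)) = \<kappa> (insert e (insert c \<xi>))" by (simp add: insert_commute)
      also have "\<dots> = \<kappa> (insert c \<xi>) * \<theta> (insert c \<xi>) e"
        using insert \<open>c < e\<close> by (intro top) auto
      also have "\<dots> = \<kappa> \<xi> * (\<theta> (insert c \<xi>) e * \<theta> \<xi> c)"
        using insert by simp
      also have "\<theta> (insert c \<xi>) e * \<theta> \<xi> c = \<theta> (insert e \<xi>) c * \<theta> \<xi> e"
        using insert \<open>c < e\<close> by (intro cocycle) auto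
      also have "\<kappa> \<xi> * (\<theta> (insert e \<xi>) c * \<theta> \<xi> e) = \<kappa> (insert e \<xi>) * \<theta> (insert e \<xi>) c"
        using insert.hyps by (simp add: top)
      finally show ?thesis .
    qed
  qed
  have "\<kappa> \<xi> * \<kappa> \<xi> = 1" for \<xi>
    unfolding \<kappa>_def by (simp add: sign flip: prod.distrib)
  moreover have "\<kappa> (insert c \<xi>) = \<kappa> \<xi> * \<theta> \<xi> c" if "\<xi> \<subseteq> {..<n}" "c < n" "c \<notin> \<xi>" for \<xi> c
    by (rule main[OF finite_subset[OF that(1) finite_lessThan] that])
  ultimately show ?thesis by (rule that)
qed

section \<open>Signs on the faces of the cube\<close>

locale link_cube = planar_diagram D for D +
  fixes \<psi> :: "nat set \<Rightarrow> nat \<Rightarrow> nat \<Rightarrow> kring" and \<epsilon> :: "nat set \<Rightarrow> nat \<Rightarrow> kring"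
  assumes face: "face_cocycle D \<psi>" and signs: "sign_assignment D \<psi> \<epsilon>"
begin

text \<open>Up to a constant, the number of merges on any path of saddles from the bottom of the cube: a merge
  raises \<open>card \<xi> - ncirc \<xi>\<close> by 2 and a split leaves it unchanged.\<close>

definition merge_level :: "nat set \<Rightarrow> int" where
  "merge_level \<xi> = (int (card \<xi>) - int (ncirc \<xi>)) div 2"

lemma saddle_typed:
  assumes "\<xi> \<subseteq> {..<ncross D}" "c < ncross D" "c \<notin> \<xi>"
  shows "elementary (saddle D \<xi> c)" "cob_typed (ncirc \<xi>) (saddle D \<xi> c) (ncirc (insert c \<xi>))"
    "merge_level (insert c \<xi>) = merge_level \<xi> + merges (saddle D \<xi> c)"
proof -
  have card: "card (insert c \<xi>) = card \<xi> + 1" using assms finite_subset by fastforce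
  obtain b where b: "if circ D \<xi> (c, 0) = circ D \<xi> (c, 2)
    then split_word b (saddle D \<xi> c) \<and> ncirc \<xi> = b + 1 \<and> ncirc (insert c \<xi>) = b + 2
    else merge_word b (saddle D \<xi> c) \<and> ncirc \<xi> = b + 2 \<and> ncirc (insert c \<xi>) = b + 1"
    using saddle_word[OF assms] by blast
  then show "elementary (saddle D \<xi> c)" "cob_typed (ncirc \<xi>) (saddle D \<xi> c) (ncirc (insert c \<xi>))"
    using split_word_props[of b] merge_word_props[of b] by (auto split: if_splits)
  have "(int (card \<xi>) - int b) div 2 = (int (card \<xi>) - int (b + 2)) div 2 + 1" by presburger
  then show "merge_level (insert c \<xi>) = merge_level \<xi> + merges (saddle D \<xi> c)"
    using b split_word_props(3)[of b] merge_word_props(3)[of b] card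
    by (auto simp: merge_level_def split: if_splits)
qed

definition face_path :: "nat set \<Rightarrow> nat \<Rightarrow> nat \<Rightarrow> cob" where
  "face_path \<xi> i j = saddle D \<xi> i @ saddle D (insert i \<xi>) j"

lemma face_path_typed:
  assumes "\<xi> \<subseteq> {..<ncross D}" "i < ncross D" "j < ncross D" "i \<notin> \<xi>" "j \<notin> \<xi>" "i \<noteq> j"
  shows "elementary (face_path \<xi> i j)"
    "cob_typed (ncirc \<xi>) (face_path \<xi> i j) (ncirc (insert j (insert i \<xi>)))"
    "merge_level (insert j (insert i \<xi>)) = merge_level \<xi> + merges (face_path \<xi> i j)"
  using saddle_typed[OF assms(1,2,4)] saddle_typed[of "insert i \<xi>" j] assms
  by (auto simp: face_path_def elementary_append cob_typed_append)

lemma cube_faceD: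
  assumes "cube_face D \<xi> i j"
  shows "\<xi> \<subseteq> {..<ncross D}" "i < ncross D" "j < ncross D" "i \<notin> \<xi>" "j \<notin> \<xi>" "i \<noteq> j"
  using assms by (auto simp: cube_face_def)

text \<open>The relation in the cobordism category that \<open>\<psi>\<close> satisfies on a face
  passes to every specialisation of the functor.\<close>

lemma face_pull:
  assumes "ground_hom \<phi>" "cube_face D \<xi> i j" "length w = ncirc \<xi>"
  shows "ground_hom.pull \<phi> (face_path \<xi> i j) f w = \<phi> (\<psi> \<xi> i j) * ground_hom.pull \<phi> (face_path \<xi> j i) f w"
proof -
  interpret ground_hom \<phi> by fact
  have "ch_eq (length w) (ncirc (insert i (insert j \<xi>)))
          (Poly_Mapping.single (face_path \<xi> i j) 1) (Poly_Mapping.single (face_path \<xi> j i) (\<psi> \<xi> i j))"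
    using face assms(2,3) by (simp add: face_cocycle_def face_path_def)
  from ch_eq_pull[OF this, of f] show ?thesis by (simp add: hom_one)
qed

lemma merge_path_nonzero:
  assumes "ground_hom \<phi>" "\<xi> \<subseteq> {..<ncross D}" "i < ncross D" "j < ncross D" "i \<notin> \<xi>" "j \<notin> \<xi>" "i \<noteq> j"
    and "circ D \<xi> (i, 0) \<noteq> circ D \<xi> (i, 2)"
  shows "\<exists>w. length w = ncirc \<xi> \<and> ground_hom.pull \<phi> (face_path \<xi> i j) (\<lambda>_. 1) w \<noteq> 0"
proof -
  obtain b where b: "merge_word b (saddle D \<xi> i)" "ncirc \<xi> = b + 2" "ncirc (insert i \<xi>) = b + 1"
    using saddle_word[OF assms(2,3,5)] assms(8) by auto
  obtain c where "if circ D (insert i \<xi>) (j, 0) = circ D (insert i \<xi>) (j, 2)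
    then split_word c (saddle D (insert i \<xi>) j) \<and> ncirc (insert i \<xi>) = c + 1
    else merge_word c (saddle D (insert i \<xi>) j) \<and> ncirc (insert i \<xi>) = c + 2"
    using saddle_word[of "insert i \<xi>" j] assms by (auto split: if_splits)
  then have "split_word b (saddle D (insert i \<xi>) j) \<or> (\<exists>c. b = Suc c \<and> merge_word c (saddle D (insert i \<xi>) j))"
    using b(3) by (auto split: if_splits)
  from ground_hom.merge_first_nonzero[OF assms(1) b(1) this] show ?thesis
    by (simp add: b(2) face_path_def)
qed

text \<open>If either saddle at the bottom vertex is a merge, the path starting with it is nonzero.
  Otherwise both are splits; the second step is then a split, or a merge of the two pieces, and only
  the latter needs the even specialisation.\<close>

lemma face_nonzero:
  assumes "ground_hom \<phi>" "cube_face D \<xi> i j" "split_merge_face D \<xi> i j \<Longrightarrow> ground_hom.even_hom \<phi>"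
  shows "\<exists>w. length w = ncirc \<xi> \<and> ground_hom.pull \<phi> (face_path \<xi> j i) (\<lambda>_. 1) w \<noteq> 0"
proof -
  interpret ground_hom \<phi> by fact
  note c = cube_faceD[OF assms(2)]
  \<comment> \<open>The two paths around the face are proportional, so the one that is easier to
    evaluate may be used.\<close>
  have *: ?thesis if "\<exists>w. length w = ncirc \<xi> \<and> pull (face_path \<xi> i j) (\<lambda>_. 1) w \<noteq> 0"
    using that face_pull[OF assms(1,2)] by fastforce
  show ?thesis
  proof (cases "circ D \<xi> (i, 0) = circ D \<xi> (i, 2)")
    case False
    then show ?thesis by (intro * merge_path_nonzero assms c)
  next
    case i: True
    then obtain b where b: "split_word b (saddle D \<xi> i)" "ncirc \<xi> = b + 1" "ncirc (insert i \<xi>) = b + 2"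
      using saddle_word[OF c(1,2,4)] by auto
    show ?thesis
    proof (cases "circ D \<xi> (j, 0) = circ D \<xi> (j, 2)")
      case False
      then show ?thesis using c by (intro merge_path_nonzero assms) auto
    next
      case j: True
      show ?thesis
      proof (cases "circ D (insert i \<xi>) (j, 0) = circ D (insert i \<xi>) (j, 2)")
        case True
        then obtain b' where "split_word b' (saddle D (insert i \<xi>) j)" "ncirc (insert i \<xi>) = b' + 1"
          using saddle_word[of "insert i \<xi>" j] c by auto
        then have "split_word (Suc b) (saddle D (insert i \<xi>) j)" using b(3) by simp
        from split_split_nonzero[OF b(1) this] show ?thesis
          by (intro *) (simp add: b(2) face_path_def)
      next
        case False
        then obtain b' where "merge_word b' (saddle D (insert i \<xi>) j)" "ncirc (insert i \<xi>) = b' + 2"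
          using saddle_word[of "insert i \<xi>" j] c by auto
        then have "merge_word b (saddle D (insert i \<xi>) j)" using b(3) by simp
        moreover have even_hom using assms(3) i j False by (simp add: split_merge_face_def)
        ultimately show ?thesis
          using split_merge_even_nonzero[OF b(1)] by (intro *) (simp add: b(2) face_path_def)
      qed
    qed
  qed
qed

text \<open>The face relation is evaluated under \<open>\<phi>\<close> and under
  \<open>\<phi>'\<close>; \<open>pull_change\<close> relates the two, and a nonzero value of the
  composite can be cancelled.\<close>

lemma face_eta_nonzero:
  assumes "sign_change \<phi> \<phi>' \<sigma> \<tau>" "cube_face D \<xi> i j"
    and "split_merge_face D \<xi> i j \<Longrightarrow> ground_hom.even_hom \<phi>"
  shows "eta \<sigma> \<tau> (merge_level \<xi>) (face_path \<xi> i j) * eta \<sigma> \<tau> (merge_level \<xi>) (face_path \<xi> j i) =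
    \<phi> (\<psi> \<xi> i j) * \<phi>' (\<psi> \<xi> i j)"
proof -
  interpret sign_change \<phi> \<phi>' \<sigma> \<tau> by fact
  note c = cube_faceD[OF assms(2)]
  let ?m = "merge_level \<xi>" and ?m' = "merge_level (insert i (insert j \<xi>))"
  let ?E = "eta \<sigma> \<tau> ?m (face_path \<xi> i j)" and ?E' = "eta \<sigma> \<tau> ?m (face_path \<xi> j i)"
  obtain w where w: "length w = ncirc \<xi>" "A.pull (face_path \<xi> j i) (\<lambda>_. 1) w \<noteq> 0"
    using face_nonzero[OF A.ground_hom_axioms assms(2,3)] by blast
  \<comment> \<open>With this functional the rescaling at the top squares to 1, and the constant
    functional remains on the side of \<open>\<phi>\<close>.\<close>
  let ?f = "tsign \<tau> ?m'" and ?P = "A.pull (face_path \<xi> j i) (\<lambda>_. 1) w"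
  have ff: "(\<lambda>v. ?f v * ?f v) = (\<lambda>_. 1)" by (simp add: tsign_sign[OF tt])
  have m: "?m + merges (face_path \<xi> i j) = ?m'" "?m + merges (face_path \<xi> j i) = ?m'"
    using face_path_typed(3)[of \<xi> i j] face_path_typed(3)[of \<xi> j i] c by (auto simp: insert_commute)
  have 1: "B.pull (face_path \<xi> i j) ?f w * tsign \<tau> ?m w = ?E * A.pull (face_path \<xi> i j) (\<lambda>_. 1) w"
    using pull_change[OF face_path_typed(1,2) w(1), of i j ?f ?m] c by (simp add: m ff)
  have 2: "B.pull (face_path \<xi> j i) ?f w * tsign \<tau> ?m w = ?E' * ?P"
    using pull_change[OF face_path_typed(1,2) w(1), of j i ?f ?m] c by (simp add: m ff)
  have "?E * (\<phi> (\<psi> \<xi> i j) * ?P) = B.pull (face_path \<xi> i j) ?f w * tsign \<tau> ?m w"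
    using 1 by (simp only: face_pull[OF A.ground_hom_axioms assms(2) w(1), of "\<lambda>_. 1"])
  also have "\<dots> = \<phi>' (\<psi> \<xi> i j) * (?E' * ?P)"
    by (simp only: face_pull[OF B.ground_hom_axioms assms(2) w(1), of ?f] mult.assoc 2)
  finally have "?E * (\<phi> (\<psi> \<xi> i j) * ?P) = \<phi>' (\<psi> \<xi> i j) * (?E' * ?P)" .
  \<comment> \<open>Here the nonzero value \<open>?P\<close> is cancelled.\<close>
  then have "?E * \<phi> (\<psi> \<xi> i j) = \<phi>' (\<psi> \<xi> i j) * ?E'"
    using w(2) by (simp flip: mult.assoc)
  then have "\<phi> (\<psi> \<xi> i j) * ?E * (\<phi> (\<psi> \<xi> i j) * ?E') = \<phi>' (\<psi> \<xi> i j) * ?E' * (\<phi> (\<psi> \<xi> i j) * ?E')"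
    by (simp add: mult.commute)
  moreover have "\<phi> (\<psi> \<xi> i j) * \<phi> (\<psi> \<xi> i j) = 1"
    by (rule A.hom_unit) (use face assms(2) in \<open>simp add: face_cocycle_def\<close>)
  moreover have "?E' * ?E' = 1" by (rule eta_sign[OF sg tt])
  ultimately show ?thesis by algebra
qed

text \<open>The left side involves only \<open>\<sigma>\<close> and \<open>\<tau>\<close>, and on a
  split-merge face the right side is 1 for every admissible pair of homomorphisms. The pair may
  therefore be exchanged for one that starts at the even homomorphism.\<close>

lemma face_eta:
  assumes "sign_change \<phi> \<phi>' \<sigma> \<tau>" "cube_face D \<xi> i j"
  shows "eta \<sigma> \<tau> (merge_level \<xi>) (face_path \<xi> i j) * eta \<sigma> \<tau> (merge_level \<xi>) (face_path \<xi> j i) =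
    \<phi> (\<psi> \<xi> i j) * \<phi>' (\<psi> \<xi> i j)"
proof (cases "split_merge_face D \<xi> i j")
  case False
  then show ?thesis using face_eta_nonzero[OF assms] by blast
next
  case True
  have XY: "\<phi>1 (\<psi> \<xi> i j) * \<phi>2 (\<psi> \<xi> i j) = 1" if "sign_change \<phi>1 \<phi>2 \<sigma> \<tau>" for \<phi>1 \<phi>2
  proof -
    interpret sign_change \<phi>1 \<phi>2 \<sigma> \<tau> by fact
    have "\<psi> \<xi> i j = 1 \<or> \<psi> \<xi> i j = KX * KY"
      using face assms(2) True by (auto simp: face_cocycle_def split_merge_value_def)
    moreover have "\<phi>1 (KX * KY) * \<phi>2 (KX * KY) = (\<sigma> * \<sigma>) * ((\<phi>1 KX * \<phi>1 KX) * (\<phi>1 KY * \<phi>1 KY))"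
      by (simp only: A.hom_mult B.hom_mult X' Y' mult_ac)
    then have "\<phi>1 (KX * KY) * \<phi>2 (KX * KY) = 1" by (simp only: sg A.hom_XX A.hom_YY mult_1_left)
    ultimately show ?thesis by (auto simp: A.hom_one B.hom_one)
  qed
  interpret S: sign_change \<phi> \<phi>' \<sigma> \<tau> by fact
  have "\<sigma> * \<tau> * (\<sigma> * \<tau>) = 1" using sign_mult[OF S.sg S.tt] .
  \<comment> \<open>The change with the same \<open>\<sigma>\<close> and \<open>\<tau>\<close>,
    applied to X = Y = Z = 1.\<close>
  then have e: "sign_change (spec_hom 1 1 1) (spec_hom \<sigma> \<sigma> (\<sigma> * \<tau>)) \<sigma> \<tau>"
    using S.sg S.tt by (simp add: sign_change_def sign_change_axioms_def ground_hom_spec spec_hom_values)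
  have "ground_hom.even_hom (spec_hom 1 1 1)"
    by (simp add: ground_hom.even_hom_def[OF ground_hom_spec] spec_hom_values)
  then show ?thesis using face_eta_nonzero[OF e assms(2)] XY[OF e] XY[OF assms(1)] by simp
qed

text \<open>On an edge the two differentials differ by \<open>tsign\<close> at both ends and the
  sign \<open>\<theta>\<close>. The latter is a cocycle, and its potential \<open>\<kappa>\<close>
  is absorbed into the rescaling of the basis.\<close>

lemma cube_rescaling:
  assumes "sign_change \<phi> \<phi>' \<sigma> \<tau>"
  obtains G :: "nat set \<Rightarrow> word \<Rightarrow> int" where "\<And>\<xi> w. G \<xi> w * G \<xi> w = 1"
    "\<And>\<xi> c w w'. \<xi> \<subseteq> {..<ncross D} \<Longrightarrow> c < ncross D \<Longrightarrow> c \<notin> \<xi> \<Longrightarrow> length w = ncirc \<xi> \<Longrightarrow>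
       \<phi>' (\<epsilon> \<xi> c * Poly_Mapping.lookup (F_cob (saddle D \<xi> c) w) w') * G \<xi> w =
       G (insert c \<xi>) w' * \<phi> (\<epsilon> \<xi> c * Poly_Mapping.lookup (F_cob (saddle D \<xi> c) w) w')"
proof -
  interpret sign_change \<phi> \<phi>' \<sigma> \<tau> by fact
  define valid where "valid \<xi> c \<longleftrightarrow> \<xi> \<subseteq> {..<ncross D} \<and> c < ncross D \<and> c \<notin> \<xi>" for \<xi> c
  let ?eta = "\<lambda>\<xi> c. eta \<sigma> \<tau> (merge_level \<xi>) (saddle D \<xi> c)"
  \<comment> \<open>The value 1 off the edges of the cube keeps \<open>\<theta>\<close> a sign for
    all arguments, as \<open>cube_coboundary\<close> requires.\<close>
  define \<theta> where "\<theta> \<xi> c = (if valid \<xi> c then \<phi> (\<epsilon> \<xi> c) * \<phi>' (\<epsilon> \<xi> c) * ?eta \<xi> c else 1)" for \<xi> c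
  have unit: "\<phi> (\<epsilon> \<xi> c) * \<phi> (\<epsilon> \<xi> c) = 1" "\<phi>' (\<epsilon> \<xi> c) * \<phi>' (\<epsilon> \<xi> c) = 1" if "valid \<xi> c" for \<xi> c
  proof -
    have "\<epsilon> \<xi> c dvd 1" using signs that by (simp add: sign_assignment_def valid_def)
    then show "\<phi> (\<epsilon> \<xi> c) * \<phi> (\<epsilon> \<xi> c) = 1" "\<phi>' (\<epsilon> \<xi> c) * \<phi>' (\<epsilon> \<xi> c) = 1"
      by (rule A.hom_unit, rule B.hom_unit)
  qed
  have sign: "\<theta> \<xi> c * \<theta> \<xi> c = 1" for \<xi> c
    using unit[of \<xi> c] eta_sign[OF sg tt] by (auto simp: \<theta>_def intro!: sign_mult)
  have cocycle: "\<theta> (insert i \<xi>) j * \<theta> \<xi> i = \<theta> (insert j \<xi>) i * \<theta> \<xi> j"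
    if h: "\<xi> \<subseteq> {..<ncross D}" "i < ncross D" "j < ncross D" "i \<notin> \<xi>" "j \<notin> \<xi>" "i < j" for \<xi> i j
  proof -
    have f: "cube_face D \<xi> i j" using h by (simp add: cube_face_def)
    have v: "valid \<xi> i" "valid \<xi> j" "valid (insert i \<xi>) j" "valid (insert j \<xi>) i"
      using h by (auto simp: valid_def)
    have s: "\<epsilon> (insert i \<xi>) j * \<epsilon> \<xi> i * \<psi> \<xi> i j = - (\<epsilon> (insert j \<xi>) i * \<epsilon> \<xi> j)"
      using signs f by (simp add: sign_assignment_def)
    have sA: "\<phi> (\<epsilon> (insert i \<xi>) j) * \<phi> (\<epsilon> \<xi> i) * \<phi> (\<psi> \<xi> i j) = - (\<phi> (\<epsilon> (insert j \<xi>) i) * \<phi> (\<epsilon> \<xi> j))"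
      using arg_cong[OF s, of \<phi>] by (simp add: A.hom_mult A.hom_uminus)
    have sB: "\<phi>' (\<epsilon> (insert i \<xi>) j) * \<phi>' (\<epsilon> \<xi> i) * \<phi>' (\<psi> \<xi> i j) = - (\<phi>' (\<epsilon> (insert j \<xi>) i) * \<phi>' (\<epsilon> \<xi> j))"
      using arg_cong[OF s, of \<phi>'] by (simp add: B.hom_mult B.hom_uminus)
    have E: "?eta \<xi> i * ?eta (insert i \<xi>) j * (?eta \<xi> j * ?eta (insert j \<xi>) i) = \<phi> (\<psi> \<xi> i j) * \<phi>' (\<psi> \<xi> i j)"
      using face_eta[OF assms f] saddle_typed(3) h by (simp add: face_path_def eta_append)
    have q: "?eta \<xi> j * ?eta (insert j \<xi>) i * (?eta \<xi> j * ?eta (insert j \<xi>) i) = 1"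
      by (intro sign_mult eta_sign sg tt)
    have "?eta \<xi> i * ?eta (insert i \<xi>) j * (?eta \<xi> j * ?eta (insert j \<xi>) i) * (?eta \<xi> j * ?eta (insert j \<xi>) i) =
        \<phi> (\<psi> \<xi> i j) * \<phi>' (\<psi> \<xi> i j) * (?eta \<xi> j * ?eta (insert j \<xi>) i)"
      by (simp only: E)
    then have E': "?eta \<xi> i * ?eta (insert i \<xi>) j = \<phi> (\<psi> \<xi> i j) * \<phi>' (\<psi> \<xi> i j) * (?eta \<xi> j * ?eta (insert j \<xi>) i)"
      using q by (simp only: mult.assoc mult_1_right)
    have "\<theta> (insert i \<xi>) j * \<theta> \<xi> i =
        \<phi> (\<epsilon> (insert i \<xi>) j) * \<phi> (\<epsilon> \<xi> i) * (\<phi>' (\<epsilon> (insert i \<xi>) j) * \<phi>' (\<epsilon> \<xi> i)) * (?eta \<xi> i * ?eta (insert i \<xi>) j)"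
      using v by (simp add: \<theta>_def mult_ac)
    also have "\<dots> = (\<phi> (\<epsilon> (insert i \<xi>) j) * \<phi> (\<epsilon> \<xi> i) * \<phi> (\<psi> \<xi> i j)) *
        (\<phi>' (\<epsilon> (insert i \<xi>) j) * \<phi>' (\<epsilon> \<xi> i) * \<phi>' (\<psi> \<xi> i j)) * (?eta \<xi> j * ?eta (insert j \<xi>) i)"
      unfolding E' by (simp only: mult_ac)
    \<comment> \<open>The minus signs of the two anticommutation relations cancel, so a cocycle
      results.\<close>
    also have "\<dots> = \<theta> (insert j \<xi>) i * \<theta> \<xi> j"
      unfolding sA sB using v by (simp add: \<theta>_def mult_ac)
    finally show ?thesis .
  qed
  obtain \<kappa> where \<kappa>: "\<And>\<xi>. \<kappa> \<xi> * \<kappa> \<xi> = 1"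
    "\<And>\<xi> c. \<xi> \<subseteq> {..<ncross D} \<Longrightarrow> c < ncross D \<Longrightarrow> c \<notin> \<xi> \<Longrightarrow> \<kappa> (insert c \<xi>) = \<kappa> \<xi> * \<theta> \<xi> c"
    by (rule cube_coboundary[OF sign cocycle]; (assumption | rule that))
  show ?thesis
  proof (rule that[of "\<lambda>\<xi> w. \<kappa> \<xi> * tsign \<tau> (merge_level \<xi>) w"])
    show "\<kappa> \<xi> * tsign \<tau> (merge_level \<xi>) w * (\<kappa> \<xi> * tsign \<tau> (merge_level \<xi>) w) = 1" for \<xi> w
      by (intro sign_mult \<kappa>(1) tsign_sign tt)
    fix \<xi> c and w w' :: word
    assume h: "\<xi> \<subseteq> {..<ncross D}" "c < ncross D" "c \<notin> \<xi>" "length w = ncirc \<xi>"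
    let ?S = "saddle D \<xi> c" and ?\<xi> = "insert c \<xi>"
    \<comment> \<open>The indicator \<open>?I\<close> selects the matrix entry at
      \<open>w'\<close>.\<close>
    let ?t = "tsign \<tau> (merge_level ?\<xi>)" and ?I = "\<lambda>v. if v = w' then 1 else (0 :: int)"
    let ?x = "Poly_Mapping.lookup (F_cob ?S w) w'"
    have v: "valid \<xi> c" using h by (simp add: valid_def)
    note t = saddle_typed[OF h(1-3)]
    have "B.pull ?S ?I w * tsign \<tau> (merge_level \<xi>) w =
        ?eta \<xi> c * A.pull ?S (\<lambda>v. ?t v * ?I v) w"
      using pull_change[OF t(1,2) h(4), of ?I "merge_level \<xi>"] t(3) by simp
    also have "(\<lambda>v. ?t v * ?I v) = (\<lambda>v. ?t w' * ?I v)" by auto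
    finally have "\<phi>' ?x * tsign \<tau> (merge_level \<xi>) w = ?eta \<xi> c * (?t w' * \<phi> ?x)"
      by (simp only: A.pull_cmult) (simp only: A.pull_def B.pull_def A.ev_indicator B.ev_indicator)
    then have "\<phi>' (\<epsilon> \<xi> c * ?x) * (\<kappa> \<xi> * tsign \<tau> (merge_level \<xi>) w) =
        \<phi>' (\<epsilon> \<xi> c) * \<kappa> \<xi> * ?eta \<xi> c * (?t w' * \<phi> ?x)"
      by (simp add: B.hom_mult mult_ac)
    also have "\<dots> = (\<phi> (\<epsilon> \<xi> c) * \<phi> (\<epsilon> \<xi> c)) * (\<phi>' (\<epsilon> \<xi> c) * \<kappa> \<xi> * ?eta \<xi> c * (?t w' * \<phi> ?x))"
      using unit[OF v] by simp
    also have "\<dots> = \<kappa> ?\<xi> * ?t w' * \<phi> (\<epsilon> \<xi> c * ?x)"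
      using \<kappa>(2)[OF h(1-3)] v by (simp add: \<theta>_def A.hom_mult mult_ac)
    finally show "\<phi>' (\<epsilon> \<xi> c * ?x) * (\<kappa> \<xi> * tsign \<tau> (merge_level \<xi>) w) = \<kappa> ?\<xi> * ?t w' * \<phi> (\<epsilon> \<xi> c * ?x)" .
  qed
qed

end

section \<open>Tensor products and homology\<close>

text \<open>The map \<open>f1\<close> carries kernel onto kernel and image onto image, hence cosets
  onto cosets; the isomorphism of the quotients is the direct image under \<open>f1\<close>.\<close>

lemma homology_iso:
  assumes closed: "\<And>x y. x \<in> carrier T1 \<Longrightarrow> y \<in> carrier T1 \<Longrightarrow> x \<otimes>\<^bsub>T1\<^esub> y \<in> carrier T1"
    and f: "f0 \<in> iso T0 S0" "f1 \<in> iso T1 S1" "f2 \<in> iso T2 S2"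
    and one: "\<one>\<^bsub>T2\<^esub> \<in> carrier T2" "f2 \<one>\<^bsub>T2\<^esub> = \<one>\<^bsub>S2\<^esub>"
    and d: "\<And>x. x \<in> carrier T0 \<Longrightarrow> d0 x \<in> carrier T1" "\<And>x. x \<in> carrier T1 \<Longrightarrow> d1 x \<in> carrier T2"
    and e: "\<And>x. x \<in> carrier T0 \<Longrightarrow> e0 (f0 x) = f1 (d0 x)" "\<And>x. x \<in> carrier T1 \<Longrightarrow> e1 (f1 x) = f2 (d1 x)"
  shows "T1\<lparr>carrier := kernel T1 T2 d1\<rparr> Mod (d0 ` carrier T0) \<cong>
    S1\<lparr>carrier := kernel S1 S2 e1\<rparr> Mod (e0 ` carrier S0)"
proof -
  let ?K = "kernel T1 T2 d1" and ?L = "kernel S1 S2 e1"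
  let ?I = "d0 ` carrier T0" and ?J = "e0 ` carrier S0"
  have bij: "bij_betw f0 (carrier T0) (carrier S0)" "bij_betw f1 (carrier T1) (carrier S1)"
    "bij_betw f2 (carrier T2) (carrier S2)" using f by (auto simp: iso_def)
  have hom: "f1 (x \<otimes>\<^bsub>T1\<^esub> y) = f1 x \<otimes>\<^bsub>S1\<^esub> f1 y" if "x \<in> carrier T1" "y \<in> carrier T1" for x y
    using f(2) that by (auto simp: iso_def hom_def)
  have KL: "f1 ` ?K = ?L"
  proof -
    have "d1 x = \<one>\<^bsub>T2\<^esub> \<longleftrightarrow> e1 (f1 x) = \<one>\<^bsub>S2\<^esub>" if "x \<in> carrier T1" for x
      using e(2)[OF that] one bij(3) d(2)[OF that] by (metis bij_betw_inv_into_left)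
    then show ?thesis using bij(2) by (fastforce simp: kernel_def bij_betw_def)
  qed
  have IJ: "f1 ` ?I = ?J"
    using e(1) bij(1) by (force simp: bij_betw_def image_image)
  have IC: "?I \<subseteq> carrier T1" using d(1) by auto
  have KC: "?K \<subseteq> carrier T1" by (auto simp: kernel_def)
  have img: "f1 ` (\<Union>h\<in>?I. {h \<otimes>\<^bsub>T1\<^esub> a}) = (\<Union>h\<in>?J. {h \<otimes>\<^bsub>S1\<^esub> f1 a})" if "a \<in> carrier T1" for a
  proof -
    have "f1 ` (\<Union>h\<in>?I. {h \<otimes>\<^bsub>T1\<^esub> a}) = (\<Union>h\<in>?I. {f1 h \<otimes>\<^bsub>S1\<^esub> f1 a})"
      unfolding image_UN image_insert image_empty
      by (intro SUP_cong refl) (use hom[OF _ that] IC in auto)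
    then show ?thesis unfolding IJ[symmetric] by auto
  qed
  define M where "M = T1\<lparr>carrier := ?K\<rparr> Mod ?I"
  define N where "N = S1\<lparr>carrier := ?L\<rparr> Mod ?J"
  have carM: "carrier M = (\<lambda>a. \<Union>h\<in>?I. {h \<otimes>\<^bsub>T1\<^esub> a}) ` ?K"
    by (auto simp: M_def FactGroup_def RCOSETS_def r_coset_def)
  have carN: "carrier N = (\<lambda>a. \<Union>h\<in>?J. {h \<otimes>\<^bsub>S1\<^esub> a}) ` ?L"
    by (auto simp: N_def FactGroup_def RCOSETS_def r_coset_def)
  have sub: "S \<subseteq> carrier T1" if "S \<in> carrier M" for S
    using that closed IC KC unfolding carM by auto
  have "(`) f1 \<in> hom M N"
  proof (rule homI)
    fix S assume "S \<in> carrier M"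
    then show "f1 ` S \<in> carrier N" using img KC unfolding carM carN KL[symmetric] by auto
  next
    fix S R assume SR: "S \<in> carrier M" "R \<in> carrier M"
    have "f1 ` (\<Union>h\<in>S. \<Union>k\<in>R. {h \<otimes>\<^bsub>T1\<^esub> k}) = (\<Union>h\<in>S. \<Union>k\<in>R. {f1 h \<otimes>\<^bsub>S1\<^esub> f1 k})"
      unfolding image_UN image_insert image_empty
      by (intro SUP_cong refl) (use hom sub[OF SR(1)] sub[OF SR(2)] in auto)
    then show "f1 ` (S \<otimes>\<^bsub>M\<^esub> R) = f1 ` S \<otimes>\<^bsub>N\<^esub> f1 ` R"
      by (simp add: M_def N_def FactGroup_def set_mult_def)
  qed
  moreover have "bij_betw ((`) f1) (carrier M) (carrier N)"
    unfolding bij_betw_def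
  proof
    show "inj_on ((`) f1) (carrier M)"
      by (rule inj_onI) (use sub bij(2) in \<open>metis bij_betw_def inj_on_image_eq_iff\<close>)
    have "(\<lambda>a. f1 ` (\<Union>h\<in>?I. {h \<otimes>\<^bsub>T1\<^esub> a})) ` ?K = (\<lambda>a. \<Union>h\<in>?J. {h \<otimes>\<^bsub>S1\<^esub> f1 a}) ` ?K"
      by (intro image_cong refl img) (use KC in auto)
    then show "(`) f1 ` carrier M = carrier N"
      unfolding carM carN KL[symmetric] image_image .
  qed
  ultimately show ?thesis unfolding is_iso_def iso_def M_def N_def by blast
qed

section \<open>Tensor products of free modules with the integers\<close>

definition free_submodule :: "'a set \<Rightarrow> ('a \<Rightarrow>\<^sub>0 kring) set" where
  "free_submodule B = {x. Poly_Mapping.keys x \<subseteq> B}"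

lemma lookup_sum_single:
  assumes "finite A" "Poly_Mapping.keys x \<subseteq> A"
  shows "(\<Sum>b\<in>A. Poly_Mapping.single b (Poly_Mapping.lookup x b)) = x"
proof (rule poly_mapping_eqI)
  fix e
  have "Poly_Mapping.lookup (\<Sum>b\<in>A. Poly_Mapping.single b (Poly_Mapping.lookup x b)) e =
      (\<Sum>b\<in>A. if b = e then Poly_Mapping.lookup x e else 0)"
    unfolding lookup_sum by (rule sum.cong) (auto simp: lookup_single when_def)
  also have "\<dots> = Poly_Mapping.lookup x e"
    using assms by (auto simp: in_keys_iff)
  finally show "Poly_Mapping.lookup (\<Sum>b\<in>A. Poly_Mapping.single b (Poly_Mapping.lookup x b)) e =
      Poly_Mapping.lookup x e" .
qed

lemma keys_lin_extend:
  "Poly_Mapping.keys (lin_extend g c) \<subseteq> (\<Union>u\<in>Poly_Mapping.keys c. Poly_Mapping.keys (g u))"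
proof
  fix e assume "e \<in> Poly_Mapping.keys (lin_extend g c)"
  then have "(\<Sum>u\<in>Poly_Mapping.keys c. Poly_Mapping.lookup c u * Poly_Mapping.lookup (g u) e) \<noteq> 0"
    by (simp add: lin_extend_def in_keys_iff lookup_sum lookup_kscale)
  then obtain u where "u \<in> Poly_Mapping.keys c" "Poly_Mapping.lookup c u * Poly_Mapping.lookup (g u) e \<noteq> 0"
    by (meson sum.neutral)
  then have "e \<in> Poly_Mapping.keys (g u)" unfolding in_keys_iff by auto
  with \<open>u \<in> _\<close> show "e \<in> (\<Union>u\<in>Poly_Mapping.keys c. Poly_Mapping.keys (g u))" by blast
qed

context ground_hom
begin

lemma hom_sum: "\<phi> (\<Sum>b\<in>A. f b) = (\<Sum>b\<in>A. \<phi> (f b))"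
  by (induction A rule: infinite_finite_induct) (simp_all add: hom_zero hom_add)

definition act :: "kring \<Rightarrow> int \<Rightarrow> int" where
  "act r m = \<phi> r * m"

text \<open>The coordinates of the tensor of \<open>x\<close> and \<open>m\<close> in the free
  abelian group on the same basis.\<close>

definition special :: "int \<Rightarrow> ('a \<Rightarrow>\<^sub>0 kring) \<Rightarrow> ('a \<Rightarrow>\<^sub>0 int)" where
  "special m x = Poly_Mapping.map (\<lambda>r. \<phi> r * m) x"

lemma lookup_special: "Poly_Mapping.lookup (special m x) b = \<phi> (Poly_Mapping.lookup x b) * m"
  by (simp add: special_def Poly_Mapping.map.rep_eq when_def hom_zero)

definition coeffs :: "(('a \<Rightarrow>\<^sub>0 kring) \<times> int \<Rightarrow>\<^sub>0 int) \<Rightarrow> ('a \<Rightarrow>\<^sub>0 int)" where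
  "coeffs = frag_extend (\<lambda>(x, m). special m x)"

lemma coeffs_simps [simp]:
  "coeffs 0 = 0" "coeffs (s + t) = coeffs s + coeffs t" "coeffs (- s) = - coeffs s"
  "coeffs (s - t) = coeffs s - coeffs t" "coeffs (frag_of (x, m)) = special m x"
  by (simp_all add: coeffs_def frag_extend_add frag_extend_diff frag_extend_minus)

definition null :: "'a set \<Rightarrow> (('a \<Rightarrow>\<^sub>0 kring) \<times> int \<Rightarrow>\<^sub>0 int) set" where
  "null B = tensor_null act (free_submodule B)"

abbreviation FA :: "'a set \<Rightarrow> (('a \<Rightarrow>\<^sub>0 kring) \<times> int \<Rightarrow>\<^sub>0 int) monoid" where
  "FA B \<equiv> free_Abelian_group (free_submodule B \<times> UNIV)"

lemma free_submodule_closed: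
  "0 \<in> free_submodule B" "x \<in> free_submodule B \<Longrightarrow> y \<in> free_submodule B \<Longrightarrow> x + y \<in> free_submodule B"
  "x \<in> free_submodule B \<Longrightarrow> kscale r x \<in> free_submodule B"
  "b \<in> B \<Longrightarrow> Poly_Mapping.single b r \<in> free_submodule B"
proof -
  have "Poly_Mapping.keys (kscale r x) \<subseteq> Poly_Mapping.keys x"
    by (auto simp: in_keys_iff lookup_kscale)
  then show "x \<in> free_submodule B \<Longrightarrow> kscale r x \<in> free_submodule B" by (auto simp: free_submodule_def)
qed (use Poly_Mapping.keys_add[of x y] in \<open>auto simp: free_submodule_def split: if_splits\<close>)

lemma relators_carrier: "tensor_relators act (free_submodule B) \<subseteq> carrier (FA B)"
proof
  fix s assume "s \<in> tensor_relators act (free_submodule B)"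
  then consider x y m where "x \<in> free_submodule B" "y \<in> free_submodule B"
      "s = frag_of (x + y, m) - frag_of (x, m) - frag_of (y, m)"
    | x m m' where "x \<in> free_submodule B" "s = frag_of (x, m + m') - frag_of (x, m) - frag_of (x, m')"
    | r x m where "x \<in> free_submodule B" "s = frag_of (kscale r x, m) - frag_of (x, act r m)"
    unfolding tensor_relators_def by blast
  then show "s \<in> carrier (FA B)"
  proof cases
    case 1
    have "Poly_Mapping.keys s \<subseteq> {(x + y, m), (x, m), (y, m)}"
      unfolding 1(3) using keys_diff[of "frag_of (x + y, m) - frag_of (x, m)" "frag_of (y, m)"]
        keys_diff[of "frag_of (x + y, m)" "frag_of (x, m)"] by auto
    then show ?thesis using 1 free_submodule_closed(2)[OF 1(1,2)] by auto
  next
    case 2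
    have "Poly_Mapping.keys s \<subseteq> {(x, m + m'), (x, m), (x, m')}"
      unfolding 2(2) using keys_diff[of "frag_of (x, m + m') - frag_of (x, m)" "frag_of (x, m')"]
        keys_diff[of "frag_of (x, m + m')" "frag_of (x, m)"] by auto
    then show ?thesis using 2 by auto
  next
    case 3
    have "Poly_Mapping.keys s \<subseteq> {(kscale r x, m), (x, act r m)}"
      unfolding 3(2) using keys_diff[of "frag_of (kscale r x, m)" "frag_of (x, act r m)"] by auto
    then show ?thesis using 3 free_submodule_closed(3)[OF 3(1)] by auto
  qed
qed

lemma special_simps:
  "special m (x + y) = special m x + special m y" "special (m + m') x = special m x + special m' x"
  "special m (kscale r x) = special (act r m) x" "special 0 x = 0" "special m 0 = 0"
  by (rule poly_mapping_eqI; simp add: lookup_special lookup_add lookup_kscale hom_add hom_mult hom_zero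
      act_def algebra_simps)+

lemma null_subgroup: "subgroup (null B) (FA B)"
  unfolding null_def tensor_null_def
  by (rule group.generate_is_subgroup[OF group_free_Abelian_group relators_carrier])

lemma null_closed:
  "0 \<in> null B" "s \<in> null B \<Longrightarrow> t \<in> null B \<Longrightarrow> s + t \<in> null B" "s \<in> null B \<Longrightarrow> - s \<in> null B"
  "s \<in> null B \<Longrightarrow> t \<in> null B \<Longrightarrow> s - t \<in> null B" "s \<in> null B \<Longrightarrow> s \<in> carrier (FA B)"
proof -
  show 1: "0 \<in> null B" using subgroup.one_closed[OF null_subgroup] by simp
  show 2: "s + t \<in> null B" if "s \<in> null B" "t \<in> null B" for s t
    using subgroup.m_closed[OF null_subgroup that] by simp
  show car: "s \<in> carrier (FA B)" if "s \<in> null B" for s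
    using subgroup.subset[OF null_subgroup] that by blast
  show 3: "- s \<in> null B" if "s \<in> null B" for s
    using subgroup.m_inv_closed[OF null_subgroup that] car[OF that] by simp
  show "s - t \<in> null B" if "s \<in> null B" "t \<in> null B"
    using 2[OF that(1) 3[OF that(2)]] by simp
qed

lemma relators_null: "tensor_relators act (free_submodule B) \<subseteq> null B"
  unfolding null_def tensor_null_def by (auto intro: generate.incl)

lemma null_relations:
  "x \<in> free_submodule B \<Longrightarrow> y \<in> free_submodule B \<Longrightarrow> frag_of (x + y, m) - frag_of (x, m) - frag_of (y, m) \<in> null B"
  "x \<in> free_submodule B \<Longrightarrow> frag_of (x, m + m') - frag_of (x, m) - frag_of (x, m') \<in> null B"
  "x \<in> free_submodule B \<Longrightarrow> frag_of (kscale r x, m) - frag_of (x, \<phi> r * m) \<in> null B"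
  by (rule subsetD[OF relators_null], unfold tensor_relators_def act_def, blast)+

lemma null_coeffs: "s \<in> null B \<Longrightarrow> coeffs s = 0"
  unfolding null_def tensor_null_def
proof (induction rule: generate.induct)
  case (incl s)
  then show ?case unfolding tensor_relators_def by (auto simp: special_simps)
next
  case (inv s)
  then have "coeffs s = 0" unfolding tensor_relators_def by (auto simp: special_simps)
  then show ?case using inv relators_carrier[of B] by (auto simp: subsetD)
qed simp_all

text \<open>A representative with coordinates \<open>c\<close> when \<open>A\<close> contains the
  keys of \<open>c\<close>. The index set is a separate argument, so that representatives of
  different coordinate vectors can be compared termwise.\<close>

definition lift :: "'a set \<Rightarrow> ('a \<Rightarrow>\<^sub>0 int) \<Rightarrow> (('a \<Rightarrow>\<^sub>0 kring) \<times> int \<Rightarrow>\<^sub>0 int)" where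
  "lift A c = (\<Sum>b\<in>A. frag_of (Poly_Mapping.single b 1, Poly_Mapping.lookup c b))"

lemma null_sum: "(\<And>b. b \<in> A \<Longrightarrow> f b \<in> null B) \<Longrightarrow> (\<Sum>b\<in>A. f b) \<in> null B"
  by (induction A rule: infinite_finite_induct) (auto intro: null_closed)

lemma lift_diff:
  assumes "A \<subseteq> B"
  shows "lift A (c - d) - (lift A c - lift A d) \<in> null B"
proof -
  have "lift A (c - d) - (lift A c - lift A d) = (\<Sum>b\<in>A.
      - (frag_of (Poly_Mapping.single b 1, Poly_Mapping.lookup (c - d) b + Poly_Mapping.lookup d b)
       - frag_of (Poly_Mapping.single b 1, Poly_Mapping.lookup (c - d) b)
       - frag_of (Poly_Mapping.single b 1, Poly_Mapping.lookup d b)))"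
    by (simp add: lift_def lookup_minus algebra_simps flip: sum_subtractf sum.distrib)
  also have "\<dots> \<in> null B"
    by (intro null_sum null_closed(3) null_relations(2) free_submodule_closed(4)) (use assms in auto)
  finally show ?thesis .
qed

lemma lift_zero:
  assumes "A \<subseteq> B"
  shows "lift A 0 \<in> null B"
  using lift_diff[OF assms, of 0 0] by simp

text \<open>The element \<open>x\<close> is expanded in the basis, and each coefficient is moved
  across the tensor sign, one basis element at a time.\<close>

lemma frag_of_lift:
  assumes "finite A" "A \<subseteq> B" "Poly_Mapping.keys x \<subseteq> A"
  shows "frag_of (x, m) - lift A (special m x) \<in> null B"
proof -
  have "frag_of (\<Sum>b\<in>A'. Poly_Mapping.single b (Poly_Mapping.lookup x b), m) - lift A' (special m x) \<in> null B
      \<and> (\<Sum>b\<in>A'. Poly_Mapping.single b (Poly_Mapping.lookup x b)) \<in> free_submodule B"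
    if "finite A'" "A' \<subseteq> B" for A'
    using that
  proof (induction A' rule: finite_induct)
    \<comment> \<open>The additivity relation for 0 + 0 = 0 makes the tensor of 0 with
      \<open>m\<close> a null element.\<close>
    case empty
    show ?case
      using null_closed(3)[OF null_relations(1)[OF free_submodule_closed(1) free_submodule_closed(1)], of m B]
      by (simp add: lift_def free_submodule_closed(1))
  next
    case (insert b A')
    let ?y = "\<Sum>b\<in>A'. Poly_Mapping.single b (Poly_Mapping.lookup x b)"
    let ?r = "Poly_Mapping.lookup x b"
    let ?b = "Poly_Mapping.single b (1 :: kring)"
    have IH: "frag_of (?y, m) - lift A' (special m x) \<in> null B" "?y \<in> free_submodule B"
      using insert by auto
    have k: "Poly_Mapping.single b ?r = kscale ?r ?b"
      by (rule poly_mapping_eqI) (simp add: lookup_kscale lookup_single when_def)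
    have b: "?b \<in> free_submodule B" "Poly_Mapping.single b ?r \<in> free_submodule B"
      using insert.prems free_submodule_closed(4) by auto
    have "(frag_of (Poly_Mapping.single b ?r + ?y, m) - frag_of (Poly_Mapping.single b ?r, m) - frag_of (?y, m))
        + ((frag_of (kscale ?r ?b, m) - frag_of (?b, \<phi> ?r * m)) + (frag_of (?y, m) - lift A' (special m x))) \<in> null B"
      by (intro null_closed(2) null_relations(1,3) IH b)
    then show ?case
      using insert.hyps free_submodule_closed(2)[OF b(2) IH(2)]
      by (simp add: lift_def lookup_special algebra_simps flip: k)
  qed
  from this[OF assms(1,2)] show ?thesis by (simp add: lookup_sum_single[OF assms(1,3)])
qed

lemma carrier_lift:
  assumes "s \<in> carrier (FA B)"
  shows "\<exists>A. finite A \<and> A \<subseteq> B \<and> s - lift A (coeffs s) \<in> null B"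
proof -
  \<comment> \<open>All basis elements that occur in the module entries of \<open>s\<close>;
    finitely many, since \<open>s\<close> is a finite sum.\<close>
  define A where "A = (\<Union>(x, m)\<in>Poly_Mapping.keys s. Poly_Mapping.keys x)"
  have A: "finite A" "A \<subseteq> B"
    using assms by (auto simp: A_def free_submodule_def)
  have "Poly_Mapping.keys s \<subseteq> {x. Poly_Mapping.keys x \<subseteq> A} \<times> UNIV"
    by (auto simp: A_def)
  then have "s - lift A (coeffs s) \<in> null B"
  proof (induction s rule: frag_induction)
    case zero
    show ?case using null_closed(3)[OF lift_zero[OF A(2)]] by simp
  next
    case (one z)
    then show ?case using frag_of_lift[OF A] by (cases z) auto
  next
    case (diff s t)
    have "(s - lift A (coeffs s)) - (t - lift A (coeffs t))
        - (lift A (coeffs s - coeffs t) - (lift A (coeffs s) - lift A (coeffs t))) \<in> null B"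
      by (intro null_closed(4) diff lift_diff A)
    then show ?case by (simp add: algebra_simps)
  qed
  with A show ?thesis by blast
qed

text \<open>Modulo null elements \<open>s\<close> is determined by its coordinates, so the relators
  generate all of the kernel of \<open>coeffs\<close>.\<close>

lemma null_iff: "s \<in> carrier (FA B) \<Longrightarrow> s \<in> null B \<longleftrightarrow> coeffs s = 0"
proof
  assume s: "s \<in> carrier (FA B)" and "coeffs s = 0"
  then obtain A where "A \<subseteq> B" "s - lift A 0 \<in> null B" using carrier_lift[OF s] by auto
  then show "s \<in> null B" using null_closed(2)[OF _ lift_zero, of "s - lift A 0" B A] by simp
qed (rule null_coeffs)

text \<open>Evaluating coefficients identifies the tensor product with the free abelian group on the basis;
  the cosets are its fibers.\<close>

definition fiber :: "'a set \<Rightarrow> ('a \<Rightarrow>\<^sub>0 int) \<Rightarrow> (('a \<Rightarrow>\<^sub>0 kring) \<times> int \<Rightarrow>\<^sub>0 int) set" where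
  "fiber B c = {s \<in> carrier (FA B). coeffs s = c}"

lemma coset_fiber:
  assumes "s \<in> carrier (FA B)"
  shows "null B #>\<^bsub>FA B\<^esub> s = fiber B (coeffs s)"
proof
  show "null B #>\<^bsub>FA B\<^esub> s \<subseteq> fiber B (coeffs s)"
    using assms null_coeffs null_closed(5) Poly_Mapping.keys_add
    by (fastforce simp: r_coset_def fiber_def)
  show "fiber B (coeffs s) \<subseteq> null B #>\<^bsub>FA B\<^esub> s"
  proof
    fix t assume t: "t \<in> fiber B (coeffs s)"
    then have "t - s \<in> carrier (FA B)"
      using assms keys_diff[of t s] by (auto simp: fiber_def)
    then have "t - s \<in> null B" using t by (simp add: null_iff fiber_def)
    then show "t \<in> null B #>\<^bsub>FA B\<^esub> s" by (auto simp: r_coset_def intro: bexI[of _ "t - s"])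
  qed
qed

lemma fiber_nonempty:
  assumes "c \<in> carrier (free_Abelian_group B)"
  obtains s where "s \<in> carrier (FA B)" "coeffs s = c"
proof -
  let ?s = "lift (Poly_Mapping.keys c) c"
  have keys: "Poly_Mapping.keys c \<subseteq> B" using assms by simp
  have "?s \<in> carrier (FA B)"
    using keys_sum[of "\<lambda>b. frag_of (Poly_Mapping.single b (1 :: kring), Poly_Mapping.lookup c b)"]
      free_submodule_closed(4)[of _ B] keys by (fastforce simp: lift_def)
  moreover have "coeffs ?s = c"
  proof -
    have "coeffs (lift A c) = (\<Sum>b\<in>A. Poly_Mapping.single b (Poly_Mapping.lookup c b))" if "finite A" for A
      using that
    proof (induction A rule: finite_induct)
      case (insert b A)
      have "special n (Poly_Mapping.single b 1) = Poly_Mapping.single b n" for n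
        by (rule poly_mapping_eqI) (simp add: lookup_special lookup_single when_def hom_one hom_zero)
      then show ?case using insert by (simp add: lift_def)
    qed (simp add: lift_def)
    then show ?thesis by (simp add: lookup_sum_single)
  qed
  ultimately show ?thesis by (rule that)
qed

lemma coeffs_carrier:
  assumes "s \<in> carrier (FA B)"
  shows "coeffs s \<in> carrier (free_Abelian_group B)"
proof -
  have "Poly_Mapping.keys s \<subseteq> free_submodule B \<times> UNIV" using assms by simp
  then have "Poly_Mapping.keys (coeffs s) \<subseteq> B"
  proof (induction s rule: frag_induction)
    case (one z)
    obtain x m where z: "z = (x, m)" by (cases z)
    have "Poly_Mapping.keys (special m x) \<subseteq> Poly_Mapping.keys x"
      by (auto simp: in_keys_iff lookup_special hom_zero)
    then show ?case using one by (auto simp: z free_submodule_def)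
  next
    case (diff s t)
    then show ?case using keys_diff[of "coeffs s" "coeffs t"] by auto
  qed simp
  then show ?thesis by simp
qed

lemma fiber_iso: "fiber B \<in> iso (free_Abelian_group B) (tensor act (free_submodule B))"
proof -
  have car: "carrier (tensor act (free_submodule B)) = (\<lambda>s. null B #>\<^bsub>FA B\<^esub> s) ` carrier (FA B)"
    by (auto simp: tensor_def FactGroup_def RCOSETS_def null_def)
  have "fiber B \<in> hom (free_Abelian_group B) (tensor act (free_submodule B))"
  proof (rule homI)
    fix c assume "c \<in> carrier (free_Abelian_group B)"
    then obtain s where "s \<in> carrier (FA B)" "coeffs s = c" by (rule fiber_nonempty)
    then show "fiber B c \<in> carrier (tensor act (free_submodule B))"
      unfolding car using coset_fiber[of s B] by (metis imageI)
  next
    fix c d assume "c \<in> carrier (free_Abelian_group B)" "d \<in> carrier (free_Abelian_group B)"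
    obtain t where t: "t \<in> carrier (FA B)" "coeffs t = d"
      using \<open>d \<in> _\<close> by (rule fiber_nonempty)
    \<comment> \<open>The product of cosets is their sumset. It fills the whole fibre because a
      fixed element over \<open>d\<close> can be subtracted.\<close>
    have "fiber B (c + d) = (\<Union>x\<in>fiber B c. \<Union>y\<in>fiber B d. {x + y})"
    proof (intro equalityI subsetI)
      fix z assume z: "z \<in> fiber B (c + d)"
      then have "z - t \<in> fiber B c" "t \<in> fiber B d"
        using t keys_diff[of z t] by (auto simp: fiber_def)
      then show "z \<in> (\<Union>x\<in>fiber B c. \<Union>y\<in>fiber B d. {x + y})" by force
    next
      fix z assume "z \<in> (\<Union>x\<in>fiber B c. \<Union>y\<in>fiber B d. {x + y})"
      then obtain x y where "x \<in> fiber B c" "y \<in> fiber B d" "z = x + y" by auto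
      then show "z \<in> fiber B (c + d)" using Poly_Mapping.keys_add[of x y] by (auto simp: fiber_def)
    qed
    then show "fiber B (c \<otimes>\<^bsub>free_Abelian_group B\<^esub> d) = fiber B c \<otimes>\<^bsub>tensor act (free_submodule B)\<^esub> fiber B d"
      by (simp add: tensor_def FactGroup_def set_mult_def)
  qed
  moreover have "bij_betw (fiber B) (carrier (free_Abelian_group B)) (carrier (tensor act (free_submodule B)))"
    unfolding bij_betw_def
  proof
    show "inj_on (fiber B) (carrier (free_Abelian_group B))"
    proof (rule inj_onI)
      fix c d assume c: "c \<in> carrier (free_Abelian_group B)" and eq: "fiber B c = fiber B d"
      obtain s where s: "s \<in> carrier (FA B)" "coeffs s = c" using c by (rule fiber_nonempty)
      then have "s \<in> fiber B d" using eq by (auto simp: fiber_def)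
      then show "c = d" using s(2) by (simp add: fiber_def)
    qed
    show "fiber B ` carrier (free_Abelian_group B) = carrier (tensor act (free_submodule B))"
    proof (intro equalityI subsetI)
      fix S assume "S \<in> carrier (tensor act (free_submodule B))"
      then obtain s where s: "s \<in> carrier (FA B)" "S = null B #>\<^bsub>FA B\<^esub> s"
        unfolding car by blast
      then have "S = fiber B (coeffs s)" using coset_fiber by metis
      then show "S \<in> fiber B ` carrier (free_Abelian_group B)" using coeffs_carrier[OF s(1)] by blast
    next
      fix S assume "S \<in> fiber B ` carrier (free_Abelian_group B)"
      then show "S \<in> carrier (tensor act (free_submodule B))"
        using calculation by (auto simp: hom_def Pi_iff)
    qed
  qed
  ultimately show ?thesis by (simp add: iso_def)
qed

text \<open>The linear map whose integer matrix is that of \<open>\<beta>\<close> with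
  \<open>\<phi>\<close> applied to every entry.\<close>

definition int_diff :: "('a \<Rightarrow> ('b \<Rightarrow>\<^sub>0 kring)) \<Rightarrow> ('a \<Rightarrow>\<^sub>0 int) \<Rightarrow> ('b \<Rightarrow>\<^sub>0 int)" where
  "int_diff \<beta> = frag_extend (\<lambda>b. special 1 (\<beta> b))"

lemma lookup_int_diff:
  assumes "finite A" "Poly_Mapping.keys c \<subseteq> A"
  shows "Poly_Mapping.lookup (int_diff \<beta> c) e =
    (\<Sum>b\<in>A. Poly_Mapping.lookup c b * \<phi> (Poly_Mapping.lookup (\<beta> b) e))"
proof -
  have "Poly_Mapping.lookup (int_diff \<beta> c) e =
    (\<Sum>b\<in>Poly_Mapping.keys c. Poly_Mapping.lookup c b * \<phi> (Poly_Mapping.lookup (\<beta> b) e))"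
    by (simp add: int_diff_def frag_extend_def lookup_sum lookup_special)
  also have "\<dots> = (\<Sum>b\<in>A. Poly_Mapping.lookup c b * \<phi> (Poly_Mapping.lookup (\<beta> b) e))"
    by (rule sum.mono_neutral_left) (use assms in \<open>auto simp: in_keys_iff\<close>)
  finally show ?thesis .
qed

lemma special_lin_extend: "special m (lin_extend \<beta> x) = int_diff \<beta> (special m x)"
proof (rule poly_mapping_eqI)
  fix e
  have "Poly_Mapping.keys (special m x) \<subseteq> Poly_Mapping.keys x"
    by (auto simp: in_keys_iff lookup_special hom_zero)
  then show "Poly_Mapping.lookup (special m (lin_extend \<beta> x)) e =
      Poly_Mapping.lookup (int_diff \<beta> (special m x)) e"
    by (simp add: lookup_int_diff[OF finite_keys[of x]] lookup_special lin_extend_def lookup_sum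
        lookup_kscale hom_sum hom_mult sum_distrib_left sum_distrib_right mult_ac)
qed

text \<open>In coordinates the induced map is \<open>int_diff\<close>, so every representative of a
  coset contributes the same coset to the union.\<close>

lemma tensor_map_fiber:
  assumes "\<And>b. b \<in> B \<Longrightarrow> Poly_Mapping.keys (\<beta> b) \<subseteq> B'" "c \<in> carrier (free_Abelian_group B)"
  shows "tensor_map act (free_submodule B') (lin_extend \<beta>) (fiber B c) = fiber B' (int_diff \<beta> c)"
proof -
  let ?d = "frag_extend (\<lambda>(x, m :: int). frag_of (lin_extend \<beta> x, m))"
  have mem: "?d s \<in> carrier (FA B') \<and> coeffs (?d s) = int_diff \<beta> (coeffs s)" if "s \<in> carrier (FA B)" for s
  proof -
    have "Poly_Mapping.keys s \<subseteq> free_submodule B \<times> UNIV" using that by simp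
    then show ?thesis
    proof (induction s rule: frag_induction)
      case zero
      show ?case by (simp add: int_diff_def)
    next
      case (one z)
      obtain x m where z: "z = (x, m)" by (cases z)
      have "lin_extend \<beta> x \<in> free_submodule B'"
        using one assms(1) keys_lin_extend[of \<beta> x] unfolding z free_submodule_def by blast
      then show ?case by (simp add: z special_lin_extend)
    next
      case (diff s t)
      then show ?case
        using keys_diff[of "?d s" "?d t"] by (auto simp: frag_extend_diff int_diff_def)
    qed
  qed
  \<comment> \<open>A nonempty fibre is needed, for otherwise the union would be empty instead of a
    coset.\<close>
  obtain s where "s \<in> fiber B c" using fiber_nonempty[OF assms(2)] by (auto simp: fiber_def)
  moreover have "null B' #>\<^bsub>FA B'\<^esub> ?d s = fiber B' (int_diff \<beta> c)" if "s \<in> fiber B c" for s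
    using coset_fiber[of "?d s" B'] mem[of s] that by (simp add: fiber_def)
  ultimately show ?thesis by (auto simp: tensor_map_def null_def)
qed

lemma int_diff_carrier:
  assumes "\<And>b. b \<in> B \<Longrightarrow> Poly_Mapping.keys (\<beta> b) \<subseteq> B'" "c \<in> carrier (free_Abelian_group B)"
  shows "int_diff \<beta> c \<in> carrier (free_Abelian_group B')"
proof -
  have "e \<in> B'" if e: "e \<in> Poly_Mapping.keys (int_diff \<beta> c)" for e
  proof -
    have "(\<Sum>b\<in>Poly_Mapping.keys c. Poly_Mapping.lookup c b * \<phi> (Poly_Mapping.lookup (\<beta> b) e)) \<noteq> 0"
      using e lookup_int_diff[of "Poly_Mapping.keys c" c \<beta> e] by (simp add: in_keys_iff)
    then obtain b where "b \<in> Poly_Mapping.keys c" "\<phi> (Poly_Mapping.lookup (\<beta> b) e) \<noteq> 0"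
      by (metis (no_types, lifting) mult_zero_right sum.neutral)
    then show ?thesis using assms hom_zero by (force simp: in_keys_iff)
  qed
  then show ?thesis by auto
qed

end

section \<open>Rescaling the basis and the complex in coordinates\<close>

definition rescale :: "('a \<Rightarrow> int) \<Rightarrow> ('a \<Rightarrow>\<^sub>0 int) \<Rightarrow> ('a \<Rightarrow>\<^sub>0 int)" where
  "rescale G = frag_extend (\<lambda>b. frag_cmul (G b) (frag_of b))"

lemma lookup_rescale: "Poly_Mapping.lookup (rescale G c) b = G b * Poly_Mapping.lookup c b"
proof -
  have "Poly_Mapping.lookup (rescale G c) b =
      (\<Sum>i\<in>Poly_Mapping.keys c. if b = i then G b * Poly_Mapping.lookup c b else 0)"
    unfolding rescale_def frag_extend_def lookup_sum by (rule sum.cong) auto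
  then show ?thesis by (auto simp: in_keys_iff)
qed

lemma rescale_iso:
  assumes "\<And>b. G b * G b = 1"
  shows "rescale G \<in> iso (free_Abelian_group B) (free_Abelian_group B)"
proof -
  have inv: "rescale G (rescale G c) = c" for c
    by (rule poly_mapping_eqI) (simp add: lookup_rescale assms flip: mult.assoc)
  have keys: "Poly_Mapping.keys (rescale G c) \<subseteq> Poly_Mapping.keys c" for c
    by (auto simp: in_keys_iff lookup_rescale)
  have closed: "rescale G c \<in> carrier (free_Abelian_group B)" if "c \<in> carrier (free_Abelian_group B)" for c
    using keys[of c] that by auto
  have "rescale G \<in> hom (free_Abelian_group B) (free_Abelian_group B)"
    by (rule homI) (use closed in \<open>simp_all add: rescale_def frag_extend_add\<close>)
  moreover have "bij_betw (rescale G) (carrier (free_Abelian_group B)) (carrier (free_Abelian_group B))"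
    by (rule bij_betw_byWitness[where f' = "rescale G"]) (use inv closed in auto)
  ultimately show ?thesis by (simp add: iso_def)
qed

lemma F_gen_keys: "length m = gsrc g \<Longrightarrow> v \<in> Poly_Mapping.keys (F_gen g m) \<Longrightarrow> length v = gtgt g"
proof -
  assume "length m = gsrc g" and v: "v \<in> Poly_Mapping.keys (F_gen g m)"
  from gen_words[OF this(1)] show ?thesis
    using v Poly_Mapping.keys_add[of "Poly_Mapping.single [Vminus, Vplus] 1" "Poly_Mapping.single [Vplus, Vminus] (KY * KZ)"]
    by (auto split: if_splits)
qed

lemma F_cob_keys:
  "cob_typed (length w) W k \<Longrightarrow> v \<in> Poly_Mapping.keys (F_cob W w) \<Longrightarrow> length v = k"
proof (induction W arbitrary: w)
  case Nil
  then show ?case by simp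
next
  case (Cons L W)
  obtain a g b where L: "L = (a, g, b)" by (cases L)
  obtain u where u: "u \<in> Poly_Mapping.keys (F_layer L w)" "v \<in> Poly_Mapping.keys (F_cob W u)"
    using Cons.prems(2) keys_lin_extend[of "F_cob W" "F_layer L w"] by auto
  let ?c = "lin_extend (\<lambda>x. Poly_Mapping.single (take a w @ x @ drop (a + gsrc g) w) 1)
    (F_gen g (take (gsrc g) (drop a w))) :: word \<Rightarrow>\<^sub>0 kring"
  have "u \<in> Poly_Mapping.keys ?c"
    using u(1) by (auto simp: L in_keys_iff lookup_kscale)
  then obtain x where x: "x \<in> Poly_Mapping.keys (F_gen g (take (gsrc g) (drop a w)))"
      "u = take a w @ x @ drop (a + gsrc g) w"
    using keys_lin_extend by fastforce
  have "length x = gtgt g" by (rule F_gen_keys[OF _ x(1)]) (use Cons.prems(1) in \<open>simp add: L\<close>)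
  then have "cob_typed (length u) W k" using Cons.prems(1) by (simp add: L x(2) add.assoc)
  then show ?case using Cons.IH u(2) by blast
qed

lemma lin_extend_single: "lin_extend f (Poly_Mapping.single x r) = kscale r (f x)"
proof (cases "r = 0")
  case True
  have "kscale 0 (f x) = 0" by (rule poly_mapping_eqI) (simp add: lookup_kscale)
  with True show ?thesis by (simp add: lin_extend_def)
qed (simp add: lin_extend_def)

lemma lookup_lin_extend_tag:
  fixes p :: "'b \<Rightarrow>\<^sub>0 kring"
  shows "Poly_Mapping.lookup (lin_extend (\<lambda>w. Poly_Mapping.single (a, w) 1) p) (b, w) =
    (if a = b then Poly_Mapping.lookup p w else 0)"
proof -
  have "Poly_Mapping.lookup (lin_extend (\<lambda>w. Poly_Mapping.single (a, w) 1) p) (b, w) =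
      (\<Sum>v\<in>Poly_Mapping.keys p. if v = w then (if a = b then Poly_Mapping.lookup p w else 0) else 0)"
    unfolding lin_extend_def lookup_sum lookup_kscale
    by (rule sum.cong) (auto simp: lookup_single when_def)
  then show ?thesis by (auto simp: in_keys_iff)
qed

context link_cube
begin

definition kh_basis :: "int \<Rightarrow> (nat set \<times> word) set" where
  "kh_basis i = {(\<xi>, w). \<xi> \<subseteq> {..<ncross D} \<and> int (card \<xi>) = i + int (n_neg D) \<and> length w = ncirc \<xi>}"

definition kh_coeff :: "nat set \<times> word \<Rightarrow> chain" where
  "kh_coeff = (\<lambda>(\<xi>, w). \<Sum>\<xi>'\<in>Pow {..<ncross D}.
     lin_extend (\<lambda>w'. Poly_Mapping.single (\<xi>', w') 1) (F_mor (Kh_diff D \<epsilon> \<xi> \<xi>') w))"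

lemma FKh_eq: "FKh D i = free_submodule (kh_basis i)"
  by (simp add: FKh_def free_submodule_def kh_basis_def)

lemma FKh_diff_eq: "FKh_diff D \<epsilon> = lin_extend kh_coeff"
  by (simp add: FKh_diff_def kh_coeff_def)

lemma lookup_kh_coeff:
  "Poly_Mapping.lookup (kh_coeff (\<xi>, w)) (\<xi>', w') =
    (if \<xi>' \<subseteq> {..<ncross D} then Poly_Mapping.lookup (F_mor (Kh_diff D \<epsilon> \<xi> \<xi>') w) w' else 0)"
  by (simp add: kh_coeff_def lookup_sum lookup_lin_extend_tag)

lemma Kh_diff_edge:
  assumes "c < ncross D" "c \<notin> \<xi>"
  shows "Kh_diff D \<epsilon> \<xi> (insert c \<xi>) = Poly_Mapping.single (saddle D \<xi> c) (\<epsilon> \<xi> c)"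
proof -
  have "{d. d < ncross D \<and> d \<notin> \<xi> \<and> insert c \<xi> = insert d \<xi>} = {c}" using assms by auto
  then show ?thesis by (simp add: Kh_diff_def)
qed

lemma lookup_kh_coeff_edge:
  assumes "\<xi> \<subseteq> {..<ncross D}" "c < ncross D" "c \<notin> \<xi>"
  shows "Poly_Mapping.lookup (kh_coeff (\<xi>, w)) (insert c \<xi>, w') =
    \<epsilon> \<xi> c * Poly_Mapping.lookup (F_cob (saddle D \<xi> c) w) w'"
  using assms by (simp add: lookup_kh_coeff Kh_diff_edge F_mor_def lin_extend_single lookup_kscale)

lemma kh_coeff_edge:
  assumes "Poly_Mapping.lookup (kh_coeff (\<xi>, w)) (\<xi>', w') \<noteq> 0"
  obtains c where "c < ncross D" "c \<notin> \<xi>" "\<xi>' = insert c \<xi>"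
proof -
  have "Kh_diff D \<epsilon> \<xi> \<xi>' \<noteq> 0"
    using assms by (auto simp: lookup_kh_coeff F_mor_def lin_extend_def split: if_splits)
  then have "{c. c < ncross D \<and> c \<notin> \<xi> \<and> \<xi>' = insert c \<xi>} \<noteq> {}"
    unfolding Kh_diff_def by (intro notI) (simp only: sum.empty simp_thms)
  then obtain c where "c < ncross D \<and> c \<notin> \<xi> \<and> \<xi>' = insert c \<xi>" by blast
  then show ?thesis by (intro that[of c]) simp_all
qed

lemma kh_coeff_keys:
  assumes "b \<in> kh_basis i"
  shows "Poly_Mapping.keys (kh_coeff b) \<subseteq> kh_basis (i + 1)"
proof
  fix e assume e: "e \<in> Poly_Mapping.keys (kh_coeff b)"
  obtain \<xi> w \<xi>' w' where be: "b = (\<xi>, w)" "e = (\<xi>', w')" by (metis surj_pair)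
  have \<xi>: "\<xi> \<subseteq> {..<ncross D}" "int (card \<xi>) = i + int (n_neg D)" "length w = ncirc \<xi>"
    using assms by (auto simp: kh_basis_def be)
  have nz: "Poly_Mapping.lookup (kh_coeff (\<xi>, w)) (\<xi>', w') \<noteq> 0"
    using e by (simp add: be in_keys_iff)
  obtain c where c: "c < ncross D" "c \<notin> \<xi>" "\<xi>' = insert c \<xi>"
    using nz by (rule kh_coeff_edge)
  have "Poly_Mapping.lookup (F_cob (saddle D \<xi> c) w) w' \<noteq> 0"
    using nz lookup_kh_coeff_edge[OF \<xi>(1) c(1,2), of w w'] by (auto simp: c(3))
  then have "length w' = ncirc \<xi>'"
    using F_cob_keys[of w "saddle D \<xi> c" "ncirc \<xi>'" w'] saddle_typed(2)[OF \<xi>(1) c(1,2)]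
    by (simp add: c(3) \<xi>(3) in_keys_iff)
  moreover have "card \<xi>' = card \<xi> + 1" using c \<xi>(1) finite_subset by fastforce
  ultimately show "e \<in> kh_basis (i + 1)" using \<xi> c by (auto simp: kh_basis_def be)
qed

text \<open>Entries of the differential off the edges of the cube vanish, and on an edge the
  commutation is \<open>cube_rescaling\<close>.\<close>

lemma int_diff_rescale:
  assumes "sign_change \<phi> \<phi>' \<sigma> \<tau>"
  obtains G where "\<And>b. G b * G b = (1 :: int)"
    "\<And>i c. c \<in> carrier (free_Abelian_group (kh_basis i)) \<Longrightarrow>
      ground_hom.int_diff \<phi>' kh_coeff (rescale G c) = rescale G (ground_hom.int_diff \<phi> kh_coeff c)"
proof -
  interpret sign_change \<phi> \<phi>' \<sigma> \<tau> by fact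
  obtain G :: "nat set \<Rightarrow> word \<Rightarrow> int" where G: "\<And>\<xi> w. G \<xi> w * G \<xi> w = 1"
    "\<And>\<xi> c w w'. \<xi> \<subseteq> {..<ncross D} \<Longrightarrow> c < ncross D \<Longrightarrow> c \<notin> \<xi> \<Longrightarrow> length w = ncirc \<xi> \<Longrightarrow>
       \<phi>' (\<epsilon> \<xi> c * Poly_Mapping.lookup (F_cob (saddle D \<xi> c) w) w') * G \<xi> w =
       G (insert c \<xi>) w' * \<phi> (\<epsilon> \<xi> c * Poly_Mapping.lookup (F_cob (saddle D \<xi> c) w) w')"
    by (rule cube_rescaling[OF assms]; rule that)
  define G' where "G' = (\<lambda>(\<xi>, w). G \<xi> w)"
  have entry: "\<phi>' (Poly_Mapping.lookup (kh_coeff b) e) * G' b = G' e * \<phi> (Poly_Mapping.lookup (kh_coeff b) e)"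
    if b: "b \<in> kh_basis i" for b e i
  proof (cases "Poly_Mapping.lookup (kh_coeff b) e = 0")
    case True
    then show ?thesis by (simp add: A.hom_zero B.hom_zero)
  next
    case False
    obtain \<xi> w \<xi>' w' where be: "b = (\<xi>, w)" "e = (\<xi>', w')" by (metis surj_pair)
    obtain c where c: "c < ncross D" "c \<notin> \<xi>" "\<xi>' = insert c \<xi>"
      using False unfolding be by (rule kh_coeff_edge)
    have \<xi>: "\<xi> \<subseteq> {..<ncross D}" "length w = ncirc \<xi>" using b by (auto simp: kh_basis_def be)
    show ?thesis
      using G(2)[OF \<xi>(1) c(1,2) \<xi>(2), of w'] by (simp add: be c(3) lookup_kh_coeff_edge[OF \<xi>(1) c(1,2)] G'_def)
  qed
  show ?thesis
  proof (rule that[of G'])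
    show "G' b * G' b = 1" for b by (cases b) (simp add: G'_def G(1))
    fix i c assume c: "c \<in> carrier (free_Abelian_group (kh_basis i))"
    show "B.int_diff kh_coeff (rescale G' c) = rescale G' (A.int_diff kh_coeff c)"
    proof (rule poly_mapping_eqI)
      fix e
      have "Poly_Mapping.keys (rescale G' c) \<subseteq> Poly_Mapping.keys c"
        by (auto simp: in_keys_iff lookup_rescale)
      then have "Poly_Mapping.lookup (B.int_diff kh_coeff (rescale G' c)) e =
          (\<Sum>b\<in>Poly_Mapping.keys c. Poly_Mapping.lookup c b * (\<phi>' (Poly_Mapping.lookup (kh_coeff b) e) * G' b))"
        by (simp add: B.lookup_int_diff[OF finite_keys[of c]] lookup_rescale mult_ac)
      also have "\<dots> = (\<Sum>b\<in>Poly_Mapping.keys c. Poly_Mapping.lookup c b * (G' e * \<phi> (Poly_Mapping.lookup (kh_coeff b) e)))"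
        by (intro sum.cong refl arg_cong2[where f = "(*)"] entry) (use c in auto)
      also have "\<dots> = Poly_Mapping.lookup (rescale G' (A.int_diff kh_coeff c)) e"
        by (simp add: A.lookup_int_diff[OF finite_keys[of c]] lookup_rescale sum_distrib_left mult_ac)
      finally show "Poly_Mapping.lookup (B.int_diff kh_coeff (rescale G' c)) e =
          Poly_Mapping.lookup (rescale G' (A.int_diff kh_coeff c)) e" .
    qed
  qed
qed

text \<open>Both tensor complexes are identified with integer complexes on the same basis, and the
  rescaling between these commutes with the differentials.\<close>

lemma kh_homology_sign_change:
  assumes "sign_change \<phi> \<phi>' \<sigma> \<tau>"
  shows "kh_homology D \<epsilon> (ground_hom.act \<phi>) i \<cong> kh_homology D \<epsilon> (ground_hom.act \<phi>') i"
proof -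
  interpret sign_change \<phi> \<phi>' \<sigma> \<tau> by fact
  obtain G where G: "\<And>b. G b * G b = (1 :: int)"
    "\<And>i c. c \<in> carrier (free_Abelian_group (kh_basis i)) \<Longrightarrow>
      B.int_diff kh_coeff (rescale G c) = rescale G (A.int_diff kh_coeff c)"
    by (rule int_diff_rescale[OF assms]; rule that)
  let ?Z = "\<lambda>i. free_Abelian_group (kh_basis i)"
  let ?T = "\<lambda>i. tensor A.act (FKh D i)" and ?S = "\<lambda>i. tensor B.act (FKh D i)"
  let ?d = "\<lambda>i. tensor_map A.act (FKh D (i + 1)) (FKh_diff D \<epsilon>)"
  let ?e = "\<lambda>i. tensor_map B.act (FKh D (i + 1)) (FKh_diff D \<epsilon>)"
  let ?a = "\<lambda>i. A.fiber (kh_basis i)" and ?b = "\<lambda>i. B.fiber (kh_basis i)"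
  \<comment> \<open>Read off the coordinates, rescale them, and pass to the coset with the new
    coordinates.\<close>
  define f where "f i = ?b i \<circ> rescale G \<circ> inv_into (carrier (?Z i)) (?a i)" for i
  have ia: "?a i \<in> iso (?Z i) (?T i)" and ib: "?b i \<in> iso (?Z i) (?S i)" for i
    unfolding FKh_eq by (rule A.fiber_iso B.fiber_iso)+
  have bija: "bij_betw (?a i) (carrier (?Z i)) (carrier (?T i))" for i using ia[of i] by (simp add: iso_def)
  have f_fiber: "f i (?a i c) = ?b i (rescale G c)" if "c \<in> carrier (?Z i)" for i c
    using bij_betw_inv_into_left[OF bija that] by (simp add: f_def)
  have f_iso: "f i \<in> iso (?T i) (?S i)" for i
  proof -
    have "inv_into (carrier (?Z i)) (?a i) \<in> iso (?T i) (?Z i)"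
      by (rule group.iso_set_sym[OF group_free_Abelian_group ia])
    moreover have "?b i \<circ> rescale G \<in> iso (?Z i) (?S i)"
      by (rule iso_set_trans[OF rescale_iso[OF G(1)] ib])
    ultimately show ?thesis unfolding f_def by (rule iso_set_trans)
  qed
  have surj: "\<exists>c\<in>carrier (?Z i). x = ?a i c" if "x \<in> carrier (?T i)" for x i
    using bija[of i] that by (auto simp: bij_betw_def)
  have d: "?d i (?a i c) = ?a (i + 1) (A.int_diff kh_coeff c)" if "c \<in> carrier (?Z i)" for c i
    unfolding FKh_eq FKh_diff_eq by (rule A.tensor_map_fiber[OF kh_coeff_keys that])
  have e: "?e i (?b i c) = ?b (i + 1) (B.int_diff kh_coeff c)" if "c \<in> carrier (?Z i)" for c i
    unfolding FKh_eq FKh_diff_eq by (rule B.tensor_map_fiber[OF kh_coeff_keys that])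
  have diff: "A.int_diff kh_coeff c \<in> carrier (?Z (i + 1))" if "c \<in> carrier (?Z i)" for c i
    by (rule A.int_diff_carrier[OF kh_coeff_keys that])
  have resc: "rescale G c \<in> carrier (?Z i)" if "c \<in> carrier (?Z i)" for c i
    using rescale_iso[OF G(1), where B = "kh_basis i"] that by (auto simp: iso_def hom_def Pi_iff)
  have d_car: "?d i x \<in> carrier (?T (i + 1))" if x: "x \<in> carrier (?T i)" for x i
  proof -
    obtain c where c: "c \<in> carrier (?Z i)" "x = ?a i c" using surj[OF x] by blast
    then show ?thesis using d[OF c(1)] bij_betwE[OF bija] diff[OF c(1)] by auto
  qed
  have comm: "?e i (f i x) = f (i + 1) (?d i x)" if x: "x \<in> carrier (?T i)" for x i
  proof -
    obtain c where c: "c \<in> carrier (?Z i)" "x = ?a i c" using surj[OF x] by blast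
    have "?e i (f i x) = ?b (i + 1) (B.int_diff kh_coeff (rescale G c))"
      using e[OF resc[OF c(1)]] f_fiber[OF c(1)] by (simp only: c(2))
    also have "\<dots> = f (i + 1) (?d i x)"
      using d[OF c(1)] f_fiber[OF diff[OF c(1)]] G(2)[OF c(1)] by (simp only: c(2))
    finally show ?thesis .
  qed
  have hom_a: "?a i (c + c') = ?a i c \<otimes>\<^bsub>?T i\<^esub> ?a i c'" if "c \<in> carrier (?Z i)" "c' \<in> carrier (?Z i)" for i c c'
    using ia[of i] that by (auto simp: iso_def hom_def)
  \<comment> \<open>The identity of the quotient group is the subgroup of null elements, which is
    the fibre over zero.\<close>
  have one: "\<one>\<^bsub>?T i\<^esub> = ?a i 0" "\<one>\<^bsub>?S i\<^esub> = ?b i 0" for i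
    using A.coset_fiber[of 0 "kh_basis i"] B.coset_fiber[of 0 "kh_basis i"] subgroup.subset[OF A.null_subgroup]
      subgroup.subset[OF B.null_subgroup]
    by (auto simp: tensor_def FactGroup_def FKh_eq A.null_def B.null_def r_coset_def)
  have r0: "rescale G 0 = 0" by (rule poly_mapping_eqI) (simp add: lookup_rescale)
  have "?T i\<lparr>carrier := kernel (?T i) (?T (i + 1)) (?d i)\<rparr> Mod (?d (i - 1) ` carrier (?T (i - 1))) \<cong>
    ?S i\<lparr>carrier := kernel (?S i) (?S (i + 1)) (?e i)\<rparr> Mod (?e (i - 1) ` carrier (?S (i - 1)))"
  proof (rule homology_iso[OF _ f_iso f_iso f_iso])
    fix x y assume x: "x \<in> carrier (?T i)" and y: "y \<in> carrier (?T i)"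
    obtain c where c: "c \<in> carrier (?Z i)" "x = ?a i c" using surj[OF x] by blast
    obtain c' where c': "c' \<in> carrier (?Z i)" "y = ?a i c'" using surj[OF y] by blast
    have "c + c' \<in> carrier (?Z i)" using c(1) c'(1) Poly_Mapping.keys_add[of c c'] by auto
    then show "x \<otimes>\<^bsub>?T i\<^esub> y \<in> carrier (?T i)"
      unfolding c(2) c'(2) hom_a[OF c(1) c'(1), symmetric] by (rule bij_betwE[OF bija, rule_format])
  next
    show "\<one>\<^bsub>?T (i + 1)\<^esub> \<in> carrier (?T (i + 1))"
      unfolding one by (rule bij_betwE[OF bija, rule_format]) simp
    show "f (i + 1) \<one>\<^bsub>?T (i + 1)\<^esub> = \<one>\<^bsub>?S (i + 1)\<^esub>"
      unfolding one by (subst f_fiber) (simp_all add: r0)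
  next
    fix x assume "x \<in> carrier (?T (i - 1))"
    then show "?d (i - 1) x \<in> carrier (?T i)" "?e (i - 1) (f (i - 1) x) = f i (?d (i - 1) x)"
      using d_car[of x "i - 1"] comm[of x "i - 1"] by simp_all
  qed (use d_car comm in auto)
  then show ?thesis by (simp add: kh_homology_def Let_def)
qed

end

theorem corollary5p6:
  fixes D :: diagram
    and \<psi> :: "nat set \<Rightarrow> nat \<Rightarrow> nat \<Rightarrow> kring"
    and \<epsilon> :: "nat set \<Rightarrow> nat \<Rightarrow> kring"
    and act :: "kring \<Rightarrow> int \<Rightarrow> int"
  assumes "link_diagram D"
    and "face_cocycle D \<psi>"
    and "sign_assignment D \<psi> \<epsilon>"
    and "module act"
  shows "if \<forall>m. act (KX * KY) m = m
         then \<forall>i. kh_homology D \<epsilon> act i \<cong> kh_homology D \<epsilon> even_act i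
         else \<forall>i. kh_homology D \<epsilon> act i \<cong> kh_homology D \<epsilon> odd_act i"
proof -
  interpret link_cube D \<psi> \<epsilon>
    by unfold_locales (use assms in auto)
  obtain \<phi> where \<phi>: "ground_hom \<phi>" "\<And>r m. act r m = \<phi> r * m"
    by (rule module_act_hom[OF assms(4)]; rule that)
  interpret G: ground_hom \<phi> by (rule \<phi>(1))
  have act: "act = G.act" by (intro ext) (simp add: \<phi>(2) G.act_def)
  have even: "even_act = ground_hom.act (spec_hom 1 1 1)"
    by (intro ext) (simp add: even_act_spec ground_hom.act_def[OF ground_hom_spec])
  have odd: "odd_act = ground_hom.act (spec_hom 1 (-1) 1)"
    by (intro ext) (simp add: odd_act_spec ground_hom.act_def[OF ground_hom_spec])
  have XY: "(\<forall>m. act (KX * KY) m = m) \<longleftrightarrow> \<phi> KX = \<phi> KY"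
    using G.X_cases G.Y_cases by (auto simp: \<phi>(2) G.hom_mult)
  \<comment> \<open>Both targets have X = Z = 1, which forces \<open>\<sigma>\<close> to be the
    image of X and \<open>\<sigma> * \<tau>\<close> that of Z. The image of Y then becomes 1 if X
    and Y act alike, and -1 otherwise.\<close>
  let ?\<sigma> = "\<phi> KX" and ?\<tau> = "\<phi> KX * \<phi> KZ"
  have signs: "?\<sigma> * ?\<sigma> = 1" "?\<tau> * ?\<tau> = 1" by (simp_all add: G.hom_XX G.hom_ZZ sign_mult)
  have Z: "?\<sigma> * ?\<tau> * \<phi> KZ = 1"
    using G.X_cases G.Z_cases by auto
  show ?thesis
  proof (cases "\<phi> KX = \<phi> KY")
    case True
    then have "sign_change \<phi> (spec_hom 1 1 1) ?\<sigma> ?\<tau>"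
      using signs Z \<phi>(1) G.hom_YY
      by (simp add: sign_change_def sign_change_axioms_def ground_hom_spec spec_hom_values)
    from kh_homology_sign_change[OF this]
    have "\<forall>i. kh_homology D \<epsilon> act i \<cong> kh_homology D \<epsilon> even_act i" unfolding act even by blast
    moreover have "\<forall>m. act (KX * KY) m = m" using True XY by blast
    ultimately show ?thesis by (simp only: simp_thms if_True)
  next
    case False
    then have "?\<sigma> * \<phi> KY = - 1" using G.X_cases G.Y_cases by auto
    then have "sign_change \<phi> (spec_hom 1 (-1) 1) ?\<sigma> ?\<tau>"
      using signs Z \<phi>(1)
      by (simp add: sign_change_def sign_change_axioms_def ground_hom_spec spec_hom_values)
    from kh_homology_sign_change[OF this]
    have "\<forall>i. kh_homology D \<epsilon> act i \<cong> kh_homology D \<epsilon> odd_act i" unfolding act odd by blast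
    moreover have "\<not> (\<forall>m. act (KX * KY) m = m)" using False XY by blast
    ultimately show ?thesis by (simp only: simp_thms if_False)
  qed
qed

end
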